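(* Let $\tfrac12<H<1$, let $U=(U_t)_{t\in[t_0,T]}$ be the solution of $$dU_t=(AU_t+f(t,U_t))\,dt+\sum_{i=1}^m b_i(t)\,dB_i^H(t),\quad t\in[t_0,T],\qquad U_{t_0}=u_0,$$ where $A\in\mathbb{R}^{n\times n}$ is invertible, $f:[t_0,T]\times\mathbb{R}^n\to\mathbb{R}^n$ and $b_1,\dots,b_m:[t_0,T]\to\mathbb{R}^n$. Assume $\mathbb{E}|u_0|^2<\infty$ and $\mathbb{E}|Au_0|^2<\infty$, and that the following hold. (1) $f$ is continuous and there are constants $D,K>0$ such that $|f(t,x)|\le D(1+|x|)$ and $|f(t,x)-f(s,y)|\le K(|t-s|+|x-y|)$ for all $t,s\in[t_0,T]$ and $x,y\in\mathbb{R}^n$. (2) There is a constant $M$ such that $|b_i(t)|^2\le M$ for all $t\in[t_0,T]$ and $i=1,\dots,m$. (3) There is a constant $L>0$ such that for all $t>s$: $|Ae^{A(t-s)}|\le \frac{L}{t-s}$ and $|A^{-1}(I-e^{A(t-s)})|\le L(t-s)$; further, $\sup_{t_0\le t\le T}e^{\mu[A](t-t_0)}$ is bounded by a (finite) constant. Then for every $\varepsilon>0$ there exists a constant $C>0$ such that for all $N\ge 2$ and every time discretization $t_0<t_1<\dots<t_N=T$ with step sizes $h_k=t_{k+1}-t_k$ (possibly non-equidistant) and $h_{\max}=\max_{0\le k\le N-1}h_k$, $$\sup_{k=0,\dots,N}\sqrt{\mathbb{E}|U_{t_k}-V_k|^2}\le C\,h_{\max}^{H-\varepsilon},$$ where $V_0=u_0$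 and, for $k=0,\dots,N-1$, $V_k$ is given by the exponential Euler scheme $$V_{k+1}=e^{Ah_k}V_k+A^{-1}\left(e^{Ah_k}-I\right)f(t_k,V_k)+\sum_{i=1}^m\int_{t_k}^{t_{k+1}}e^{A(t_{k+1}-s)}b_i(s)\,dB_i^H(s).$$
   Context: $t_0<T$ are real numbers and $n,m\in\mathbb{N}$. $|\cdot|$ is the Euclidean norm on $\mathbb{R}^n$ and the induced matrix norm on $\mathbb{R}^{n\times n}$. For a square real matrix $B$, the logarithmic norm is $\mu[B]=\lambda_{\max}\left(\frac{B+B^T}{2}\right)$, the largest eigenvalue of the symmetric part. A fractional Brownian motion with Hurst parameter $H$ is a zero-mean Gaussian process $B^H$ with covariance $\mathbb{E}[B^H_tB^H_s]=\frac12(|t|^{2H}+|s|^{2H}-|t-s|^{2H})$; $B_1^H,\dots,B_m^H$ are independent two-sided (defined for all $t\in\mathbb{R}$) fractional Brownian motions. The initial value $u_0$ is a (possibly random) $\mathbb{R}^n$-valued vector. The functions $b_i$ are deterministic (Borel measurable). The solution of the equation is the process satisfying $$U_t=e^{A(t-t_0)}u_0+\int_{t_0}^te^{A(t-s)}f(s,U_s)\,ds+\sum_{i=1}^m\int_{t_0}^te^{A(t-s)}b_i(s)\,dB^H_i(s),\quad t\in[t_0,T],$$ where the integrals with respect to $B_i^H$ are pathwise Riemann-Stieltjes integrals of deterministic kernels. For deterministic scalar kernels $g_1,g_2$ with $\int\int g_j(u)g_j(v)\phi(u,v)\,du\,dv<\infty$, $\phi(u,v)=H(2H-1)|u-v|^{2H-2}$,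 the integrals $\int g_j\,dB^H$ are zero-mean Gaussian random variables with $\mathbb{E}\left(\int g_1\,dB^H\int g_2\,dB^H\right)=\int\int g_1(u)g_2(v)\phi(u,v)\,du\,dv$. *)

theory Defs
  imports "HOL-Probability.Probability"
begin

(* Multiplication and power on the type real^'n^'n are componentwise, hence the explicit
   iteration of the matrix product. *)
definition mat_exp :: "real^'n^'n \<Rightarrow> real^'n^'n" where
  "mat_exp A = (\<Sum>k. (1 / fact k) *\<^sub>R (((**) A ^^ k) (mat 1)))"

(* The norm of the type real^'n^'n is the Frobenius norm; this is the norm induced by the
   Euclidean vector norm. *)
definition mat_norm :: "real^'n^'n \<Rightarrow> real" where
  "mat_norm A = onorm ((*v) A)"

definition real_eigenvalues :: "real^'n^'n \<Rightarrow> real set" where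
  "real_eigenvalues S = {l. \<exists>v. v \<noteq> 0 \<and> S *v v = l *\<^sub>R v}"

(* The symmetric part is real symmetric, so its set of real eigenvalues is finite and nonempty. *)
definition log_norm :: "real^'n^'n \<Rightarrow> real" where
  "log_norm A = Max (real_eigenvalues ((1 / 2) *\<^sub>R (A + transpose A)))"

(* Almost surely constant variables count as (degenerate) Gaussian variables. *)
definition gaussian_rv :: "'w measure \<Rightarrow> ('w \<Rightarrow> real) \<Rightarrow> bool" where
  "gaussian_rv P X \<longleftrightarrow> X \<in> borel_measurable P \<and>
     (\<exists>m \<sigma>. (\<sigma> > 0 \<and> distributed P lborel X (normal_density m \<sigma>)) \<or> (AE \<omega> in P. X \<omega> = m))"

definition gaussian_process :: "'w measure \<Rightarrow> ('t \<Rightarrow> 'w \<Rightarrow> real) \<Rightarrow> bool" where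
  "gaussian_process P X \<longleftrightarrow>
     (\<forall>S c. finite S \<longrightarrow> gaussian_rv P (\<lambda>\<omega>. \<Sum>t\<in>S. c t * X t \<omega>))"

(* Two-sided: the time parameter ranges over all of the reals. *)
definition fractional_brownian_motion ::
    "'w measure \<Rightarrow> real \<Rightarrow> (real \<Rightarrow> 'w \<Rightarrow> real) \<Rightarrow> bool" where
  "fractional_brownian_motion P H W \<longleftrightarrow> gaussian_process P W \<and>
     (\<forall>t. prob_space.expectation P (W t) = 0) \<and>
     (\<forall>t s. prob_space.expectation P (\<lambda>\<omega>. W t \<omega> * W s \<omega>)
        = 1 / 2 * (\<bar>t\<bar> powr (2 * H) + \<bar>s\<bar> powr (2 * H) - \<bar>t - s\<bar> powr (2 * H)))"

(* Independence of the processes is independence of their paths, regarded as random elements of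
   the space of all functions on the real line with the product sigma-algebra. *)
definition independent_fbms ::
    "'w measure \<Rightarrow> real \<Rightarrow> nat \<Rightarrow> (nat \<Rightarrow> real \<Rightarrow> 'w \<Rightarrow> real) \<Rightarrow> bool" where
  "independent_fbms P H m B \<longleftrightarrow>
     (\<forall>i\<in>{1..m}. fractional_brownian_motion P H (B i)) \<and>
     prob_space.indep_vars P (\<lambda>_. PiM UNIV (\<lambda>_::real. borel)) (\<lambda>i \<omega> t. B i t \<omega>) {1..m}"

(* Points p 0, ..., p n of a subdivision of [a,b]; points may coincide. *)
definition subdivision :: "real \<Rightarrow> real \<Rightarrow> nat \<Rightarrow> (nat \<Rightarrow> real) \<Rightarrow> bool" where
  "subdivision a b n p \<longleftrightarrow> p 0 = a \<and> p n = b \<and> (\<forall>j<n. p j \<le> p (Suc j))"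

(* The integral of the vector-valued g against the path w over [a,b] exists and equals I. *)
definition has_RS_integral ::
    "(real \<Rightarrow> 'v::real_normed_vector) \<Rightarrow> (real \<Rightarrow> real) \<Rightarrow> real \<Rightarrow> real \<Rightarrow> 'v \<Rightarrow> bool" where
  "has_RS_integral g w a b I \<longleftrightarrow>
     (\<forall>e>0. \<exists>d>0. \<forall>n p \<xi>.
        subdivision a b n p \<longrightarrow>
        (\<forall>j<n. p j \<le> \<xi> j \<and> \<xi> j \<le> p (Suc j) \<and> p (Suc j) - p j < d) \<longrightarrow>
        norm ((\<Sum>j<n. (w (p (Suc j)) - w (p j)) *\<^sub>R g (\<xi> j)) - I) < e)"

definition fbm_kernel :: "real \<Rightarrow> real \<Rightarrow> real \<Rightarrow> real" where
  "fbm_kernel H u v = H * (2 * H - 1) * \<bar>u - v\<bar> powr (2 * H - 2)"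

(* The L2 (Wiener) integral of a deterministic kernel: g is approximated by step functions in
   the norm given by the double integral of |g(u)| |g(v)| phi(u,v), and X is the mean-square
   limit of the elementary integrals of the step functions. *)
definition has_wiener_integral ::
    "'w measure \<Rightarrow> real \<Rightarrow> (real \<Rightarrow> 'w \<Rightarrow> real) \<Rightarrow> (real \<Rightarrow> 'v::euclidean_space)
      \<Rightarrow> real \<Rightarrow> real \<Rightarrow> ('w \<Rightarrow> 'v) \<Rightarrow> bool" where
  "has_wiener_integral P H W g a b X \<longleftrightarrow>
     (\<forall>e>0. \<exists>n p c. subdivision a b n p \<and>
        (let d = (\<lambda>u. norm (g u - (\<Sum>j<n. indicat_real {p j<..p (Suc j)} u *\<^sub>R c j))) in
           (\<integral>\<^sup>+u\<in>{a..b}. (\<integral>\<^sup>+v\<in>{a..b}. ennreal (d u * d v * fbm_kernel H u v) \<partial>lborel) \<partial>lborel)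
             < ennreal e) \<and>
        (\<integral>\<^sup>+\<omega>. ennreal ((norm ((\<Sum>j<n. (W (p (Suc j)) \<omega> - W (p j) \<omega>) *\<^sub>R c j) - X \<omega>))\<^sup>2) \<partial>P)
             < ennreal e)"

(* The random vector X is the integral of the deterministic kernel g against W over [a,b].
   The pathwise Riemann-Stieltjes integral need not exist for kernels that are merely bounded
   and Borel; for these the integral is the Wiener integral.  When both exist they agree almost
   surely, so X is determined up to almost sure equality. *)
definition is_fbm_integral ::
    "'w measure \<Rightarrow> real \<Rightarrow> (real \<Rightarrow> 'w \<Rightarrow> real) \<Rightarrow> (real \<Rightarrow> 'v::euclidean_space)
      \<Rightarrow> real \<Rightarrow> real \<Rightarrow> ('w \<Rightarrow> 'v) \<Rightarrow> bool" where
  "is_fbm_integral P H W g a b X \<longleftrightarrow> X \<in> borel_measurable P \<and>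
     ((AE \<omega> in P. has_RS_integral g (\<lambda>t. W t \<omega>) a b (X \<omega>)) \<or> has_wiener_integral P H W g a b X)"

(* Joint measurability of U is what makes the time integral of f(s, U_s) a random variable. *)
definition is_solution ::
    "'w measure \<Rightarrow> real \<Rightarrow> nat \<Rightarrow> (nat \<Rightarrow> real \<Rightarrow> 'w \<Rightarrow> real) \<Rightarrow> real \<Rightarrow> real \<Rightarrow> real^'n^'n
      \<Rightarrow> (real \<Rightarrow> real^'n \<Rightarrow> real^'n) \<Rightarrow> (nat \<Rightarrow> real \<Rightarrow> real^'n) \<Rightarrow> ('w \<Rightarrow> real^'n)
      \<Rightarrow> (real \<Rightarrow> 'w \<Rightarrow> real^'n) \<Rightarrow> bool" where
  "is_solution P H m B t0 T A f b u0 U \<longleftrightarrow>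
     (\<lambda>(t, \<omega>). U t \<omega>) \<in> borel_measurable (restrict_space borel {t0..T} \<Otimes>\<^sub>M P) \<and>
     (\<forall>t\<in>{t0..T}. \<exists>J.
        (\<forall>i\<in>{1..m}. is_fbm_integral P H (B i) (\<lambda>s. mat_exp ((t - s) *\<^sub>R A) *v b i s) t0 t (J i)) \<and>
        (AE \<omega> in P.
           set_integrable lborel {t0..t} (\<lambda>s. mat_exp ((t - s) *\<^sub>R A) *v f s (U s \<omega>)) \<and>
           U t \<omega> = mat_exp ((t - t0) *\<^sub>R A) *v u0 \<omega>
                   + (LINT s:{t0..t}|lborel. mat_exp ((t - s) *\<^sub>R A) *v f s (U s \<omega>))
                   + (\<Sum>i=1..m. J i \<omega>)))"

definition time_grid :: "real \<Rightarrow> real \<Rightarrow> nat \<Rightarrow> (nat \<Rightarrow> real) \<Rightarrow> bool" where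
  "time_grid t0 T N t \<longleftrightarrow> t 0 = t0 \<and> t N = T \<and> (\<forall>k<N. t k < t (Suc k))"

definition max_step :: "nat \<Rightarrow> (nat \<Rightarrow> real) \<Rightarrow> real" where
  "max_step N t = Max ((\<lambda>k. t (Suc k) - t k) ` {0..<N})"

definition is_exponential_euler ::
    "'w measure \<Rightarrow> real \<Rightarrow> nat \<Rightarrow> (nat \<Rightarrow> real \<Rightarrow> 'w \<Rightarrow> real) \<Rightarrow> real^'n^'n
      \<Rightarrow> (real \<Rightarrow> real^'n \<Rightarrow> real^'n) \<Rightarrow> (nat \<Rightarrow> real \<Rightarrow> real^'n) \<Rightarrow> ('w \<Rightarrow> real^'n)
      \<Rightarrow> nat \<Rightarrow> (nat \<Rightarrow> real) \<Rightarrow> (nat \<Rightarrow> 'w \<Rightarrow> real^'n) \<Rightarrow> bool" where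
  "is_exponential_euler P H m B A f b u0 N t V \<longleftrightarrow>
     (\<forall>k\<le>N. V k \<in> borel_measurable P) \<and>
     (AE \<omega> in P. V 0 \<omega> = u0 \<omega>) \<and>
     (\<forall>k<N. \<exists>J.
        (\<forall>i\<in>{1..m}. is_fbm_integral P H (B i) (\<lambda>s. mat_exp ((t (Suc k) - s) *\<^sub>R A) *v b i s)
                        (t k) (t (Suc k)) (J i)) \<and>
        (AE \<omega> in P.
           V (Suc k) \<omega> = mat_exp ((t (Suc k) - t k) *\<^sub>R A) *v V k \<omega>
             + (matrix_inv A ** (mat_exp ((t (Suc k) - t k) *\<^sub>R A) - mat 1)) *v f (t k) (V k \<omega>)
             + (\<Sum>i=1..m. J i \<omega>)))"

end

theory Submission
  imports Defs
begin

text \<open>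
  The exponential Euler scheme treats the linear part and the noise exactly. If the integral equation,
  restarted at a grid point (\<open>mild_restart\<close>), is compared with one step of the scheme, the stochastic
  integrals cancel, and the error \<open>e k = U (t k) - V k\<close> satisfies, path by path, an inequality of the
  form \<open>norm (e (k + 1)) \<le> (1 + \<kappa> * h) * norm (e k)\<close> plus an integral of \<open>h + norm (U s - U (t k))\<close> over
  the step (\<open>euler_step_error\<close>). A discrete Gronwall inequality bounds the error by one time integral
  of these local terms. Its mean square is governed by the modulus of continuity of \<open>U\<close> in mean
  square (\<open>U_increment_L2\<close>), which is of order \<open>H\<close>, because the noise gathered during a time \<open>h\<close> has
  second moment of order \<open>h powr (2 * H)\<close>. This yields the rate \<open>h powr H\<close>, and
  \<open>h powr (H - \<epsilon>)\<close> is weaker on a bounded interval.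

  The cancellation needs the stochastic integrals to be additive in the interval of integration and
  independent of the way in which they are obtained, pathwise or as mean-square limits. Both kinds are
  subsumed under \<open>wiener_limit\<close>: the integrand is approximated by step functions in the energy given
  by the covariance kernel, the random variable by their elementary integrals in mean square. By the
  isometry \<open>step_integral_L2_le\<close> the integrand determines the random variable, once the energy is known to
  satisfy a triangle inequality up to a constant. The latter (\<open>fbm_energy_add_le\<close>) expresses that the
  kernel \<open>\<bar>u - v\<bar> powr (2 * H - 2)\<close> is positive definite, and follows by writing the kernel as a
  superposition of products of indicators of one and the same window, evaluated at \<open>u\<close> and at \<open>v\<close>. A
  Riemann-Stieltjes integral falls under this notion because its Riemann sums may be formed with tags
  that make the step functions converge in energy (\<open>riemann_steps_L1_approx\<close>).

  The second moments of \<open>U\<close> are not given in advance. They come from a Gronwall inequality for the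
  integral of \<open>norm (f s (U s))\<close> along each path, which is finite because the drift integral exists
  (\<open>cumulated_drift_L2\<close>). The matrix exponential enters through its bounds on a compact
  time interval (\<open>mat_exp_bounds\<close>).
\<close>

section \<open>The matrix exponential\<close>

lemma bounded_bilinear_matrix_matrix_mult:
  "bounded_bilinear ((**) :: real^'n^'n \<Rightarrow> real^'n^'n \<Rightarrow> real^'n^'n)"
proof -
  have "bilinear ((**) :: real^'n^'n \<Rightarrow> real^'n^'n \<Rightarrow> real^'n^'n)"
    unfolding bilinear_def
    by (intro conjI allI linearI)
       (simp_all add: vec_eq_iff matrix_matrix_mult_def sum.distrib algebra_simps sum_distrib_left)
  then show ?thesis by (simp add: bilinear_conv_bounded_bilinear)
qed

lemma bounded_bilinear_matrix_vector_mult: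
  "bounded_bilinear ((*v) :: real^'n^'n \<Rightarrow> real^'n \<Rightarrow> real^'n)"
proof -
  have "bilinear ((*v) :: real^'n^'n \<Rightarrow> real^'n \<Rightarrow> real^'n)"
    unfolding bilinear_def
    by (intro conjI allI linearI)
       (simp_all add: vec_eq_iff matrix_vector_mult_def sum.distrib algebra_simps sum_distrib_left)
  then show ?thesis by (simp add: bilinear_conv_bounded_bilinear)
qed

interpretation mm: bounded_bilinear "(**) :: real^'n^'n \<Rightarrow> real^'n^'n \<Rightarrow> real^'n^'n"
  by (rule bounded_bilinear_matrix_matrix_mult)

interpretation mv: bounded_bilinear "(*v) :: real^'n^'n \<Rightarrow> real^'n \<Rightarrow> real^'n"
  by (rule bounded_bilinear_matrix_vector_mult)

abbreviation mat_power :: "real^'n^'n \<Rightarrow> nat \<Rightarrow> real^'n^'n" where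
  "mat_power A k \<equiv> ((**) A ^^ k) (mat 1)"

lemma mat_power_scaleR: "mat_power (s *\<^sub>R A) k = s ^ k *\<^sub>R mat_power A k"
proof (induction k)
  case (Suc k)
  then show ?case by (simp add: mm.scaleR_left mm.scaleR_right)
qed simp

text \<open>
  The matrix product is bounded for the Frobenius norm up to a constant factor, so the
  exponential series of a real variable dominates the one defining \<open>mat_exp\<close>.
\<close>
lemma mat_exp_scaleR_sums:
  fixes A :: "real^'n^'n"
  shows "(\<lambda>k. (s ^ k / fact k) *\<^sub>R mat_power A k) sums mat_exp (s *\<^sub>R A)"
proof -
  have "\<exists>c>0. \<forall>(X :: real^'n^'n) (Y :: real^'n^'n). norm (X ** Y) \<le> norm X * norm Y * c"
    by (rule mm.pos_bounded)
  then obtain c where c: "c > 0" "\<And>(X :: real^'n^'n) (Y :: real^'n^'n). norm (X ** Y) \<le> norm X * norm Y * c"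
    by blast
  have bound: "norm (mat_power A k) \<le> norm (mat 1 :: real^'n^'n) * (norm A * c) ^ k" for k
  proof (induction k)
    case (Suc k)
    have "norm (mat_power A (Suc k)) \<le> norm A * norm (mat_power A k) * c"
      using c(2) by simp
    also have "\<dots> \<le> norm A * (norm (mat 1 :: real^'n^'n) * (norm A * c) ^ k) * c"
      using Suc c(1) by (intro mult_right_mono mult_left_mono) auto
    finally show ?case by (simp add: ac_simps)
  qed simp
  have "summable (\<lambda>k. (s ^ k / fact k) *\<^sub>R mat_power A k)"
  proof (rule summable_comparison_test)
    show "summable (\<lambda>k. norm (mat 1 :: real^'n^'n)
            * (inverse (fact k) * (\<bar>s\<bar> * (norm A * c)) ^ k))"
      by (intro summable_mult summable_exp)
    have "norm ((s ^ k / fact k) *\<^sub>R mat_power A k)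
        \<le> (\<bar>s\<bar> ^ k / fact k) * (norm (mat 1 :: real^'n^'n) * (norm A * c) ^ k)" for k
      unfolding norm_scaleR by (intro mult_mono bound) (auto simp: power_abs)
    then show "\<exists>N. \<forall>k\<ge>N. norm ((s ^ k / fact k) *\<^sub>R mat_power A k)
        \<le> norm (mat 1 :: real^'n^'n) * (inverse (fact k) * (\<bar>s\<bar> * (norm A * c)) ^ k)"
      by (auto simp: field_simps power_mult_distrib)
  qed
  then have "(\<lambda>k. (s ^ k / fact k) *\<^sub>R mat_power A k) sums
      (\<Sum>k. (s ^ k / fact k) *\<^sub>R mat_power A k)"
    by (rule summable_sums)
  moreover have "mat_exp (s *\<^sub>R A) = (\<Sum>k. (s ^ k / fact k) *\<^sub>R mat_power A k)"
    unfolding mat_exp_def mat_power_scaleR by simp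
  ultimately show ?thesis by simp
qed

lemma mat_exp_zero [simp]: "mat_exp 0 = (mat 1 :: real^'n^'n)"
proof -
  have "(\<lambda>k. (0 ^ k / fact k) *\<^sub>R mat_power (0::real^'n^'n) k) sums (mat 1 :: real^'n^'n)"
    using sums_finite[of "{0}" "\<lambda>k. (0 ^ k / fact k) *\<^sub>R mat_power (0::real^'n^'n) k"] by simp
  with mat_exp_scaleR_sums[of 0 "0::real^'n^'n"] show ?thesis
    using sums_unique2 by force
qed

lemma has_vector_derivative_matrixI:
  fixes X :: "real \<Rightarrow> real^'n^'m"
  assumes "\<And>i j. ((\<lambda>s. X s $ i $ j) has_real_derivative X' $ i $ j) (at s)"
  shows "(X has_vector_derivative X') (at s)"
  unfolding has_vector_derivative_def
proof (subst has_derivative_componentwise_within, rule ballI)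
  fix e :: "real^'n^'m" assume "e \<in> Basis"
  then obtain i j where e: "e = axis i (axis j 1)"
    by (auto simp: Basis_vec_def)
  have commute: "(\<lambda>x. x * X' $ i $ j) = (*) (X' $ i $ j)"
    by (rule ext) (rule mult.commute)
  show "((\<lambda>x. X x \<bullet> e) has_derivative (\<lambda>x. x *\<^sub>R X' \<bullet> e)) (at s)"
    using assms[of i j] unfolding e has_field_derivative_def by (simp add: inner_axis commute)
qed

lemma mat_exp_scaleR_has_vector_derivative:
  fixes A :: "real^'n^'n"
  shows "((\<lambda>s. mat_exp (s *\<^sub>R A)) has_vector_derivative A ** mat_exp (s *\<^sub>R A)) (at s)"
proof (rule has_vector_derivative_matrixI)
  fix i j
  define c where "c k = mat_power A k $ i $ j / fact k" for k
  have entry: "bounded_linear (\<lambda>X :: real^'n^'n. X $ i $ j)"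
    by (intro bounded_linear_compose[OF bounded_linear_vec_nth bounded_linear_vec_nth])
  have sums: "(\<lambda>k. c k * r ^ k) sums (mat_exp (r *\<^sub>R A) $ i $ j)" for r
    using bounded_linear.sums[OF entry mat_exp_scaleR_sums[of r A]] by (simp add: c_def mult_ac)
  have "((\<lambda>r. \<Sum>k. c k * r ^ k) has_real_derivative (\<Sum>k. diffs c k * s ^ k)) (at s)"
    by (rule termdiffs_strong_converges_everywhere) (use sums sums_summable in blast)
  moreover have "(\<lambda>k. diffs c k * s ^ k) sums ((A ** mat_exp (s *\<^sub>R A)) $ i $ j)"
  proof -
    have "(\<lambda>k. (A ** ((s ^ k / fact k) *\<^sub>R mat_power A k)) $ i $ j)
            sums ((A ** mat_exp (s *\<^sub>R A)) $ i $ j)"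
      by (intro bounded_linear.sums[OF entry] bounded_linear.sums[OF mm.bounded_linear_right]
            mat_exp_scaleR_sums)
    moreover have "(A ** ((s ^ k / fact k) *\<^sub>R mat_power A k)) $ i $ j = diffs c k * s ^ k" for k
      by (simp add: diffs_def c_def mm.scaleR_right field_simps del: of_nat_Suc)
    ultimately show ?thesis by simp
  qed
  ultimately show "((\<lambda>s. mat_exp (s *\<^sub>R A) $ i $ j) has_real_derivative
      (A ** mat_exp (s *\<^sub>R A)) $ i $ j) (at s)"
    using sums by (simp add: sums_iff)
qed

lemma mat_power_commute: "A ** mat_power A k = mat_power A k ** A"
proof (induction k)
  case (Suc k)
  have "A ** mat_power A (Suc k) = A ** (A ** mat_power A k)" by simp
  also have "\<dots> = A ** (mat_power A k ** A)" by (rule arg_cong[OF Suc])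
  also have "\<dots> = mat_power A (Suc k) ** A" by (simp add: matrix_mul_assoc)
  finally show ?case .
qed simp

lemma mat_exp_commute:
  fixes A :: "real^'n^'n"
  shows "A ** mat_exp (s *\<^sub>R A) = mat_exp (s *\<^sub>R A) ** A"
proof -
  have "(\<lambda>k. A ** ((s ^ k / fact k) *\<^sub>R mat_power A k)) sums (A ** mat_exp (s *\<^sub>R A))"
    by (intro bounded_linear.sums[OF mm.bounded_linear_right] mat_exp_scaleR_sums)
  moreover have "(\<lambda>k. ((s ^ k / fact k) *\<^sub>R mat_power A k) ** A) sums (mat_exp (s *\<^sub>R A) ** A)"
    by (intro bounded_linear.sums[OF mm.bounded_linear_left] mat_exp_scaleR_sums)
  ultimately show ?thesis
    by (simp add: mm.scaleR_left mm.scaleR_right mat_power_commute sums_unique2)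
qed

lemma continuous_on_mat_exp: "continuous_on UNIV (\<lambda>s. mat_exp (s *\<^sub>R A))"
  by (intro continuous_at_imp_continuous_on ballI
      has_vector_derivative_continuous[OF mat_exp_scaleR_has_vector_derivative])

lemma mat_exp_reflected_has_vector_derivative:
  fixes A :: "real^'n^'n"
  shows "((\<lambda>s. mat_exp ((t - s) *\<^sub>R A)) has_vector_derivative
      - (A ** mat_exp ((t - s) *\<^sub>R A))) (at s)"
proof -
  have "((\<lambda>s. t - s) has_vector_derivative - 1) (at s)"
    by (auto intro!: derivative_eq_intros)
  from vector_diff_chain_at[OF this mat_exp_scaleR_has_vector_derivative]
  show ?thesis by (simp add: o_def)
qed

text \<open>
  The product of the exponentials at \<open>s + t - r\<close> and at \<open>r\<close> does not depend on \<open>r\<close>: its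
  derivative vanishes, because \<open>A\<close> commutes with its exponentials. The two ends \<open>r = t\<close> and
  \<open>r = 0\<close> give the semigroup law.
\<close>
lemma mat_exp_add:
  fixes A :: "real^'n^'n"
  shows "mat_exp ((s + t) *\<^sub>R A) = mat_exp (s *\<^sub>R A) ** mat_exp (t *\<^sub>R A)"
proof -
  let ?E = "\<lambda>r. mat_exp (r *\<^sub>R A)"
  define F where "F r = ?E (s + t - r) ** ?E r" for r
  have "(F has_vector_derivative 0) (at r)" for r
  proof -
    from mm.has_vector_derivative[OF mat_exp_reflected_has_vector_derivative[of "s + t" A r]
        mat_exp_scaleR_has_vector_derivative[of A r]]
    show ?thesis
      by (simp add: F_def[abs_def] mm.minus_left matrix_mul_assoc mat_exp_commute[of A "s + t - r"])
  qed
  then have "F t = F 0"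
    by (metis has_vector_derivative_at_within has_vector_derivative_zero_constant convex_UNIV UNIV_I)
  then show ?thesis by (simp add: F_def)
qed

lemma continuous_on_mat_exp_vector:
  fixes A :: "real^'n^'n" and x :: "'a::topological_space \<Rightarrow> real^'n"
  assumes "continuous_on S g" "continuous_on S x"
  shows "continuous_on S (\<lambda>s. mat_exp (g s *\<^sub>R A) *v x s)"
proof -
  from continuous_on_compose2[OF continuous_on_mat_exp assms(1)] show ?thesis
    by (intro mv.continuous_on assms(2)) auto
qed

abbreviation flow :: "real^'n^'n \<Rightarrow> real \<Rightarrow> real^'n \<Rightarrow> real^'n" where
  "flow A s x \<equiv> mat_exp (s *\<^sub>R A) *v x"

text \<open>
  On a compact time interval the exponential and its derivative are bounded by continuity; the
  bound on the derivative gives the Lipschitz estimate at time zero.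
\<close>
lemma mat_exp_bounds:
  fixes A :: "real^'n^'n"
  obtains c where "c \<ge> 1"
    "\<And>s x. 0 \<le> s \<Longrightarrow> s \<le> R \<Longrightarrow> norm (flow A s x) \<le> c * norm x"
    "\<And>s x. 0 \<le> s \<Longrightarrow> s \<le> R \<Longrightarrow> norm (flow A s x - x) \<le> c * s * norm x"
proof -
  let ?E = "\<lambda>r. mat_exp (r *\<^sub>R A)"
  have "\<exists>k>0. \<forall>(X :: real^'n^'n) x. norm (X *v x) \<le> norm X * norm x * k"
    by (rule mv.pos_bounded)
  then obtain k where k: "k > 0" "\<And>(X :: real^'n^'n) x. norm (X *v x) \<le> norm X * norm x * k"
    by blast
  note cont = continuous_on_mat_exp[of A]
  have "bounded (?E ` {0..R})"
    by (intro compact_imp_bounded compact_continuous_image continuous_on_subset[OF cont]) auto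
  then obtain b where b: "\<And>s. 0 \<le> s \<Longrightarrow> s \<le> R \<Longrightarrow> norm (?E s) \<le> b"
    unfolding bounded_iff by fastforce
  have "bounded ((\<lambda>s. A ** ?E s) ` {0..R})"
    by (intro compact_imp_bounded compact_continuous_image mm.continuous_on
        continuous_on_subset[OF cont] continuous_on_const) auto
  then obtain d where d: "\<And>s. 0 \<le> s \<Longrightarrow> s \<le> R \<Longrightarrow> norm (A ** ?E s) \<le> d"
    unfolding bounded_iff by fastforce
  define c where "c = max 1 (max (b * k) (d * k))"
  show thesis
  proof (rule that)
    show "c \<ge> 1" by (simp add: c_def)
  next
    fix s and x :: "real^'n" assume s: "0 \<le> s" "s \<le> R"
    have "norm (?E s *v x) \<le> norm (?E s) * norm x * k" by (rule k)
    also have "\<dots> \<le> b * norm x * k" using b[OF s] k(1) by (intro mult_right_mono) auto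
    also have "\<dots> = (b * k) * norm x" by simp
    also have "\<dots> \<le> c * norm x" by (intro mult_right_mono) (auto simp: c_def)
    finally show "norm (?E s *v x) \<le> c * norm x" .
    have "norm (?E s - ?E 0) \<le> d * norm (s - 0)"
    proof (rule differentiable_bound[where S="{0..s}" and f'="\<lambda>r h. h *\<^sub>R (A ** ?E r)"])
      show "(?E has_derivative (\<lambda>h. h *\<^sub>R (A ** ?E r))) (at r within {0..s})" for r
        using mat_exp_scaleR_has_vector_derivative
        unfolding has_vector_derivative_def by (rule has_derivative_at_withinI)
      show "onorm (\<lambda>h. h *\<^sub>R (A ** ?E r)) \<le> d" if "r \<in> {0..s}" for r
      proof (rule onorm_bound)
        show "norm (h *\<^sub>R (A ** ?E r)) \<le> d * norm h" for h :: real
          using mult_left_mono[OF d[of r] norm_ge_zero[of h]] that s by (simp add: mult.commute)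
        show "0 \<le> d" using order_trans[OF norm_ge_zero d[of r]] that s by simp
      qed
    qed (use s in auto)
    then have 1: "norm (?E s - mat 1) \<le> s * d" using s by (simp add: mult.commute)
    have "?E s *v x - x = (?E s - mat 1) *v x" by (simp add: mv.diff_left)
    also have "norm \<dots> \<le> norm (?E s - mat 1) * norm x * k" by (rule k)
    also have "\<dots> \<le> (s * d) * norm x * k" using 1 k(1) by (intro mult_right_mono) auto
    also have "\<dots> = (d * k) * (s * norm x)" by simp
    also have "\<dots> \<le> c * (s * norm x)" using s by (intro mult_right_mono) (auto simp: c_def)
    finally show "norm (?E s *v x - x) \<le> c * s * norm x" by simp
  qed
qed

text \<open>
  This turns the drift term of the exponential Euler step into an integral over the step, which
  can be subtracted from the drift integral of the solution.
\<close>
lemma matrix_inv_mat_exp_integral: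
  fixes A :: "real^'n^'n"
  assumes "invertible A" "r \<le> t"
  shows "set_integrable lborel {r..t} (\<lambda>s. flow A (t - s) x)"
    and "(LINT s:{r..t}|lborel. flow A (t - s) x)
           = (matrix_inv A ** (mat_exp ((t - r) *\<^sub>R A) - mat 1)) *v x"
proof -
  have cont: "continuous_on {r..t} (\<lambda>s. flow A (t - s) x)"
    by (intro continuous_on_mat_exp_vector continuous_intros)
  show int: "set_integrable lborel {r..t} (\<lambda>s. flow A (t - s) x)"
    by (rule borel_integrable_atLeastAtMost'[OF cont])
  have inv: "matrix_inv A ** A = mat 1" 
    using assms(1) unfolding invertible_def matrix_inv_def by (rule someI2_ex) simp
  define F where "F s = - (matrix_inv A *v (flow A (t - s) x))" for s
  have "(F has_vector_derivative flow A (t - s) x) (at s within {r..t})" for s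
  proof -
    have "((\<lambda>s. matrix_inv A *v (flow A (t - s) x)) has_vector_derivative
        matrix_inv A *v ((- (A ** mat_exp ((t - s) *\<^sub>R A))) *v x)) (at s)"
      by (intro bounded_linear.has_vector_derivative[OF mv.bounded_linear_right]
            bounded_linear.has_vector_derivative[OF mv.bounded_linear_left]
            mat_exp_reflected_has_vector_derivative)
    from has_vector_derivative_minus[OF this] have "(F has_vector_derivative
        matrix_inv A *v ((A ** mat_exp ((t - s) *\<^sub>R A)) *v x)) (at s)"
      by (simp add: F_def[abs_def] mv.minus_left mv.minus_right)
    then show ?thesis
      by (simp add: matrix_vector_mul_assoc matrix_mul_assoc inv has_vector_derivative_at_within)
  qed
  then have "((\<lambda>s. flow A (t - s) x) has_integral F t - F r) {r..t}"
    using assms(2) by (intro fundamental_theorem_of_calculus) auto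
  moreover have "((\<lambda>s. flow A (t - s) x) has_integral
      (LINT s:{r..t}|lborel. flow A (t - s) x)) {r..t}"
    using has_integral_set_lebesgue set_borel_integral_eq_integral(1)[OF int]
      set_borel_integral_eq_integral(2)[OF int] by (simp add: has_integral_integral)
  ultimately have "(LINT s:{r..t}|lborel. flow A (t - s) x) = F t - F r"
    by (rule has_integral_unique[rotated])
  then show "(LINT s:{r..t}|lborel. flow A (t - s) x)
           = (matrix_inv A ** (mat_exp ((t - r) *\<^sub>R A) - mat 1)) *v x"
    by (simp add: F_def mm.diff_right mv.diff_left matrix_vector_mul_assoc)
qed

section \<open>The covariance kernel and its energy\<close>

text \<open>
  The odd power \<open>sgn x * \<bar>x\<bar> powr p\<close>, in a form whose continuity at zero is evident.
\<close>
definition signed_powr :: "real \<Rightarrow> real \<Rightarrow> real" where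
  "signed_powr p x = max 0 x powr p - max 0 (- x) powr p"

lemma continuous_on_signed_powr [continuous_intros]:
  assumes "p > 0" "continuous_on S f"
  shows "continuous_on S (\<lambda>x. signed_powr p (f x))"
  unfolding signed_powr_def using assms
  by (intro continuous_intros continuous_on_powr') auto

lemma has_real_derivative_signed_powr:
  assumes "x \<noteq> 0"
  shows "(signed_powr p has_real_derivative p * \<bar>x\<bar> powr (p - 1)) (at x)"
proof (cases "x > 0")
  case True
  have "((\<lambda>x. x powr p) has_real_derivative p * \<bar>x\<bar> powr (p - 1)) (at x)"
    using True by (auto intro!: derivative_eq_intros)
  then show ?thesis
    by (rule has_field_derivative_transform_within_open[where S="{0<..}"])
       (use True in \<open>auto simp: signed_powr_def max_def\<close>)
next
  case False
  with assms have "x < 0" by simp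
  then have "((\<lambda>x. - ((- x) powr p)) has_real_derivative p * \<bar>x\<bar> powr (p - 1)) (at x)"
    by (auto intro!: derivative_eq_intros)
  then show ?thesis
    by (rule has_field_derivative_transform_within_open[where S="{..<0}"])
       (use \<open>x < 0\<close> in \<open>auto simp: signed_powr_def max_def\<close>)
qed

lemma has_real_derivative_abs_powr:
  assumes "x \<noteq> 0"
  shows "((\<lambda>x. \<bar>x\<bar> powr p) has_real_derivative p * signed_powr (p - 1) x) (at x)"
proof (cases "x > 0")
  case True
  have "((\<lambda>x. x powr p) has_real_derivative p * signed_powr (p - 1) x) (at x)"
    using True by (auto intro!: derivative_eq_intros simp: signed_powr_def max_def)
  then show ?thesis
    by (rule has_field_derivative_transform_within_open[where S="{0<..}"]) (use True in auto)
next
  case False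
  with assms have "x < 0" by simp
  then have "((\<lambda>x. (- x) powr p) has_real_derivative p * signed_powr (p - 1) x) (at x)"
    by (auto intro!: derivative_eq_intros simp: signed_powr_def max_def)
  then show ?thesis
    by (rule has_field_derivative_transform_within_open[where S="{..<0}"]) (use \<open>x < 0\<close> in auto)
qed

lemma borel_measurable_fbm_kernel [measurable]:
  "case_prod (fbm_kernel H) \<in> borel_measurable (borel \<Otimes>\<^sub>M borel)"
  unfolding fbm_kernel_def by measurable

text \<open>
  For fixed \<open>u\<close> the odd power of \<open>v - u\<close> with exponent \<open>2 * H - 1\<close> is a primitive of the kernel
  away from the diagonal and is continuous across it, so the singularity of the kernel does no harm
  and the endpoints may lie on either side of \<open>u\<close>.
\<close>
lemma fbm_kernel_has_integral:
  assumes "1 / 2 < H" "c \<le> d"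
  shows "(fbm_kernel H u has_integral
    H * (signed_powr (2 * H - 1) (d - u) - signed_powr (2 * H - 1) (c - u))) {c..d}"
proof -
  let ?F = "\<lambda>v. H * signed_powr (2 * H - 1) (v - u)"
  have "(fbm_kernel H u has_integral ?F d - ?F c) {c..d}"
  proof (rule fundamental_theorem_of_calculus_interior_strong[where S="{u}"])
    fix v assume "v \<in> {c<..<d} - {u}"
    then have "v - u \<noteq> 0" by simp
    have "((\<lambda>v. signed_powr (2 * H - 1) (v - u)) has_real_derivative
        ((2 * H - 1) * \<bar>v - u\<bar> powr (2 * H - 1 - 1)) * 1) (at v)"
      by (rule DERIV_chain2[where g="\<lambda>v. v - u", OF has_real_derivative_signed_powr])
         (use \<open>v - u \<noteq> 0\<close> in \<open>auto intro!: derivative_eq_intros\<close>)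
    from DERIV_cmult[OF this, of H] show "(?F has_vector_derivative fbm_kernel H u v) (at v)"
      by (simp add: fbm_kernel_def has_real_derivative_iff_has_vector_derivative
          abs_minus_commute mult_ac)
  qed (use assms in \<open>auto intro!: continuous_intros\<close>)
  then show ?thesis by (simp add: right_diff_distrib)
qed

lemma fbm_kernel_nonneg: "1 / 2 < H \<Longrightarrow> 0 \<le> fbm_kernel H u v"
  by (simp add: fbm_kernel_def)

lemma nn_integral_fbm_kernel:
  assumes "1 / 2 < H" "c \<le> d"
  shows "(\<integral>\<^sup>+v\<in>{c..d}. ennreal (fbm_kernel H u v) \<partial>lborel)
    = ennreal (H * (signed_powr (2 * H - 1) (d - u) - signed_powr (2 * H - 1) (c - u)))"
  using nn_integral_has_integral_lebesgue'[OF fbm_kernel_nonneg fbm_kernel_has_integral] assms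
  by simp

text \<open>
  The covariance of the increments of a fractional Brownian motion over \<open>[a, b]\<close> and \<open>[c, d]\<close>.
\<close>
definition fbm_increment_cov :: "real \<Rightarrow> real \<Rightarrow> real \<Rightarrow> real \<Rightarrow> real \<Rightarrow> real" where
  "fbm_increment_cov H a b c d = 1 / 2 * (\<bar>d - a\<bar> powr (2 * H) - \<bar>d - b\<bar> powr (2 * H)
      - \<bar>c - a\<bar> powr (2 * H) + \<bar>c - b\<bar> powr (2 * H))"

text \<open>
  The kernel is the density of the increment covariance, also for overlapping intervals: the
  inner integral is a difference of odd powers, and these are the derivatives of even powers.
\<close>
lemma
  assumes "1 / 2 < H" "a \<le> b" "c \<le> d"
  shows fbm_increment_cov_nonneg: "0 \<le> fbm_increment_cov H a b c d"
    and nn_integral_fbm_kernel_rectangle: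
      "(\<integral>\<^sup>+u\<in>{a..b}. (\<integral>\<^sup>+v\<in>{c..d}. ennreal (fbm_kernel H u v) \<partial>lborel) \<partial>lborel)
        = ennreal (fbm_increment_cov H a b c d)"
proof -
  let ?g = "\<lambda>u. H * (signed_powr (2 * H - 1) (d - u) - signed_powr (2 * H - 1) (c - u))"
  let ?F = "\<lambda>u. 1 / 2 * (\<bar>c - u\<bar> powr (2 * H) - \<bar>d - u\<bar> powr (2 * H))"
  have int: "(?g has_integral ?F b - ?F a) {a..b}"
  proof (rule fundamental_theorem_of_calculus_interior_strong[where S="{c, d}"])
    fix u assume "u \<in> {a<..<b} - {c, d}"
    then have "c - u \<noteq> 0" "d - u \<noteq> 0" by auto
    have "((\<lambda>u. \<bar>r - u\<bar> powr (2 * H)) has_real_derivative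
            (2 * H * signed_powr (2 * H - 1) (r - u)) * (- 1)) (at u)" if "r - u \<noteq> 0" for r
      by (rule DERIV_chain2[where g="\<lambda>u. r - u", OF has_real_derivative_abs_powr[OF that]])
         (auto intro!: derivative_eq_intros)
    note this[OF \<open>c - u \<noteq> 0\<close>] this[OF \<open>d - u \<noteq> 0\<close>]
    from DERIV_cmult[OF DERIV_diff[OF this], of "1 / 2"]
    show "(?F has_vector_derivative ?g u) (at u)"
      by (simp add: has_real_derivative_iff_has_vector_derivative algebra_simps)
  qed (use assms in \<open>auto intro!: continuous_intros continuous_on_powr'\<close>)
  have nonneg: "0 \<le> ?g u" for u
    using has_integral_nonneg[OF fbm_kernel_has_integral[of H c d u]] assms fbm_kernel_nonneg[of H u]
    by simp
  have cov: "?F b - ?F a = fbm_increment_cov H a b c d"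
    by (simp add: fbm_increment_cov_def algebra_simps)
  from has_integral_nonneg[OF int nonneg] show "0 \<le> fbm_increment_cov H a b c d"
    unfolding cov by simp
  have "(\<integral>\<^sup>+u\<in>{a..b}. ennreal (?g u) \<partial>lborel) = ennreal (?F b - ?F a)"
    using nonneg int by (rule nn_integral_has_integral_lebesgue')
  then show "(\<integral>\<^sup>+u\<in>{a..b}. (\<integral>\<^sup>+v\<in>{c..d}. ennreal (fbm_kernel H u v) \<partial>lborel) \<partial>lborel)
        = ennreal (fbm_increment_cov H a b c d)"
    unfolding cov using assms by (simp add: nn_integral_fbm_kernel)
qed

text \<open>
  The squared seminorm in which step functions approximate an integrand. Values in \<open>ennreal\<close>
  allow arbitrary nonnegative integrands without integrability conditions.
\<close>
definition fbm_energy :: "real \<Rightarrow> (real \<Rightarrow> ennreal) \<Rightarrow> ennreal" where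
  "fbm_energy H d = (\<integral>\<^sup>+u. \<integral>\<^sup>+v. d u * d v * ennreal (fbm_kernel H u v) \<partial>lborel \<partial>lborel)"

lemma fbm_energy_mono:
  assumes "AE u in lborel. d u \<le> d' u"
  shows "fbm_energy H d \<le> fbm_energy H d'"
  unfolding fbm_energy_def
proof (rule nn_integral_mono_AE)
  show "AE u in lborel. (\<integral>\<^sup>+v. d u * d v * ennreal (fbm_kernel H u v) \<partial>lborel)
      \<le> (\<integral>\<^sup>+v. d' u * d' v * ennreal (fbm_kernel H u v) \<partial>lborel)"
    using assms
  proof eventually_elim
    case (elim u)
    show ?case
    proof (rule nn_integral_mono_AE)
      show "AE v in lborel. d u * d v * ennreal (fbm_kernel H u v)
          \<le> d' u * d' v * ennreal (fbm_kernel H u v)"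
        using assms by eventually_elim (use elim in \<open>auto intro!: mult_mono\<close>)
    qed
  qed
qed

lemma fbm_energy_zero: "fbm_energy H (\<lambda>_. 0) = 0"
  by (simp add: fbm_energy_def)

lemma fbm_energy_cmult:
  assumes [measurable]: "d \<in> borel_measurable borel"
  shows "fbm_energy H (\<lambda>u. c * d u) = c\<^sup>2 * fbm_energy H d"
proof -
  have "fbm_energy H (\<lambda>u. c * d u)
      = (\<integral>\<^sup>+u. \<integral>\<^sup>+v. c\<^sup>2 * (d u * d v * ennreal (fbm_kernel H u v)) \<partial>lborel \<partial>lborel)"
    by (simp add: fbm_energy_def power2_eq_square mult_ac)
  also have "\<dots> = c\<^sup>2 * fbm_energy H d"
    unfolding fbm_energy_def by (simp add: nn_integral_cmult)
  finally show ?thesis .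
qed

lemma fbm_energy_indicator_le:
  assumes "1 / 2 < H" "a \<le> b" "\<And>u. d u \<le> ennreal M * indicator {a..b} u" "0 \<le> M"
  shows "fbm_energy H d \<le> ennreal (M\<^sup>2 * (b - a) powr (2 * H))"
proof -
  have "fbm_energy H d \<le> fbm_energy H (\<lambda>u. ennreal M * indicator {a..b} u)"
    using assms(3) by (intro fbm_energy_mono) simp
  also have "\<dots> = (ennreal M)\<^sup>2 * fbm_energy H (indicator {a..b})"
    by (intro fbm_energy_cmult) measurable
  also have "fbm_energy H (indicator {a..b})
      = (\<integral>\<^sup>+u\<in>{a..b}. (\<integral>\<^sup>+v\<in>{a..b}. ennreal (fbm_kernel H u v) \<partial>lborel) \<partial>lborel)"
    unfolding fbm_energy_def
    by (intro nn_integral_cong) (simp add: nn_integral_cmult[symmetric] mult_ac split: split_indicator)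
  also have "\<dots> = ennreal ((b - a) powr (2 * H))"
    using assms by (subst nn_integral_fbm_kernel_rectangle)
      (auto simp: fbm_increment_cov_def abs_minus_commute)
  also have "(ennreal M)\<^sup>2 * ennreal ((b - a) powr (2 * H)) = ennreal (M\<^sup>2 * (b - a) powr (2 * H))"
    using assms(4) by (simp only: ennreal_power ennreal_mult'' powr_ge_zero)
  finally show ?thesis .
qed

text \<open>
  Schur's test: the kernel has uniformly bounded integrals over a bounded interval, so for uniformly
  bounded functions convergence in mean implies convergence in energy.
\<close>
lemma fbm_energy_le_L1:
  assumes "1 / 2 < H" "a \<le> b" "\<And>u. d u \<le> ennreal M * indicator {a..b} u" "0 \<le> M"
    and [measurable]: "d \<in> borel_measurable borel"
  shows "fbm_energy H d
    \<le> ennreal (M * (2 * H * (b - a) powr (2 * H - 1))) * (\<integral>\<^sup>+u. d u \<partial>lborel)"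
proof -
  let ?c = "M * (2 * H * (b - a) powr (2 * H - 1))"
  have "(\<integral>\<^sup>+v. d u * d v * ennreal (fbm_kernel H u v) \<partial>lborel) \<le> d u * ennreal ?c" for u
  proof (cases "u \<in> {a..b}")
    case True
    have sp: "signed_powr (2 * H - 1) (b - u) \<le> (b - a) powr (2 * H - 1)"
      "- signed_powr (2 * H - 1) (a - u) \<le> (b - a) powr (2 * H - 1)"
      using True assms(1) by (auto simp: signed_powr_def intro!: powr_mono2)
    have "(\<integral>\<^sup>+v. d v * ennreal (fbm_kernel H u v) \<partial>lborel)
        \<le> (\<integral>\<^sup>+v. ennreal M * (ennreal (fbm_kernel H u v) * indicator {a..b} v) \<partial>lborel)"
    proof (rule nn_integral_mono)
      fix v
      show "d v * ennreal (fbm_kernel H u v)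
          \<le> ennreal M * (ennreal (fbm_kernel H u v) * indicator {a..b} v)"
        using mult_right_mono[OF assms(3)[of v], of "ennreal (fbm_kernel H u v)"]
        by (simp add: mult_ac)
    qed
    also have "\<dots> = ennreal M * (\<integral>\<^sup>+v\<in>{a..b}. ennreal (fbm_kernel H u v) \<partial>lborel)"
      by (rule nn_integral_cmult) measurable
    also have "\<dots> \<le> ennreal M * ennreal (2 * H * (b - a) powr (2 * H - 1))"
    proof (subst nn_integral_fbm_kernel)
      have "H * (signed_powr (2 * H - 1) (b - u) - signed_powr (2 * H - 1) (a - u))
          \<le> H * (2 * (b - a) powr (2 * H - 1))"
        using sp assms(1) by (intro mult_left_mono) auto
      then show "ennreal M * ennreal (H * (signed_powr (2 * H - 1) (b - u)
            - signed_powr (2 * H - 1) (a - u)))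
          \<le> ennreal M * ennreal (2 * H * (b - a) powr (2 * H - 1))"
        by (intro mult_left_mono ennreal_leI) auto
    qed (use assms in auto)
    also have "\<dots> = ennreal ?c" using assms(4) by (simp add: ennreal_mult')
    finally have "d u * (\<integral>\<^sup>+v. d v * ennreal (fbm_kernel H u v) \<partial>lborel) \<le> d u * ennreal ?c"
      by (rule mult_left_mono) simp
    then show ?thesis by (subst (asm) nn_integral_cmult[symmetric]) (auto simp: mult_ac)
  next
    case False
    then have "d u = 0" using assms(3)[of u] by simp
    then show ?thesis by simp
  qed
  then have "fbm_energy H d \<le> (\<integral>\<^sup>+u. d u * ennreal ?c \<partial>lborel)"
    unfolding fbm_energy_def by (intro nn_integral_mono)
  also have "\<dots> = ennreal ?c * (\<integral>\<^sup>+u. d u \<partial>lborel)"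
    by (subst nn_integral_multc) (auto simp: mult.commute)
  finally show ?thesis .
qed

lemma ennreal_square_add_le: "(a + b)\<^sup>2 \<le> 2 * a\<^sup>2 + 2 * (b::ennreal)\<^sup>2"
proof (cases "a = top \<or> b = top")
  case True
  then show ?thesis by (auto simp: power2_eq_square ennreal_mult_top)
next
  case False
  then obtain x y where xy: "a = ennreal x" "b = ennreal y" "0 \<le> x" "0 \<le> y"
    by (metis ennreal_cases)
  have "ennreal ((x + y)\<^sup>2) \<le> ennreal (2 * x\<^sup>2 + 2 * y\<^sup>2)"
    using sum_squares_bound[of x y] by (intro ennreal_leI) (simp add: power2_sum)
  also have "ennreal ((x + y)\<^sup>2) = (a + b)\<^sup>2"
    using xy by (simp add: ennreal_power del: ennreal_plus flip: ennreal_plus)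
  also have "ennreal (2 * x\<^sup>2 + 2 * y\<^sup>2) = 2 * a\<^sup>2 + 2 * b\<^sup>2"
    using xy by (simp add: ennreal_mult' ennreal_power)
  finally show ?thesis .
qed

text \<open>
  The scale integral of the tent functions \<open>max 0 (r - y)\<close>, weighted by a power of the scale \<open>r\<close>,
  is again a pure power of \<open>y\<close>. This is the source of the factorization of the kernel below.
\<close>
lemma nn_integral_tent:
  assumes "al > 0" "y > 0"
  shows "(\<integral>\<^sup>+r. ennreal ((r - y) * r powr (- al - 2)) * indicator {y..} r \<partial>lborel)
    = ennreal (y powr (- al) / (al * (al + 1)))"
proof -
  define F where "F r = y * r powr (- al - 1) / (al + 1) - r powr (- al) / al" for r
  have "(\<integral>\<^sup>+r. ennreal ((r - y) * r powr (- al - 2)) * indicator {y..} r \<partial>lborel) = ennreal (0 - F y)"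
  proof (rule nn_integral_FTC_atLeast)
    fix r assume r: "y \<le> r"
    with assms have "r > 0" by simp
    have "(F has_real_derivative y * ((- al - 1) * r powr (- al - 1 - 1)) / (al + 1)
        - (- al) * r powr (- al - 1) / al) (at r)"
      unfolding F_def using \<open>r > 0\<close> assms
      by (auto intro!: derivative_eq_intros)
    moreover have "y * ((- al - 1) * r powr (- al - 1 - 1)) / (al + 1)
        - (- al) * r powr (- al - 1) / al = (r - y) * r powr (- al - 2)"
    proof -
      have "r powr (- al - 1) = r * r powr (- al - 2)"
      proof -
        have e: "1 + (- al - 2) = - al - 1" by simp
        show ?thesis using powr_mult_base[of r "- al - 2", unfolded e] \<open>r > 0\<close> by linarith
      qed
      moreover have "(- al - 1) / (al + 1) = - 1" using assms by (simp add: field_simps)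
      ultimately show ?thesis using assms by (simp add: field_simps)
    qed
    ultimately show "DERIV F r :> (r - y) * r powr (- al - 2)" by simp
    show "0 \<le> (r - y) * r powr (- al - 2)" using r by simp
  next
    have "((\<lambda>r. r powr (- al - 1)) \<longlongrightarrow> 0) at_top" "((\<lambda>r. r powr (- al)) \<longlongrightarrow> 0) at_top"
      using assms by (auto intro!: tendsto_neg_powr filterlim_ident)
    then have "((\<lambda>r. y * r powr (- al - 1) / (al + 1) - r powr (- al) / al) \<longlongrightarrow> y * 0 / (al + 1) - 0 / al) at_top"
      using assms by (intro tendsto_intros) auto
    then show "(F \<longlongrightarrow> 0) at_top" unfolding F_def[abs_def] by simp
  qed measurable
  also have "0 - F y = y powr (- al) / (al * (al + 1))"
  proof -
    have "y * y powr (- al - 1) = y powr (- al)"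
      using powr_mult_base[of y "- al - 1"] assms by simp
    then show ?thesis using assms unfolding F_def by (simp add: field_simps)
  qed
  finally show ?thesis .
qed

text \<open>
  A parameter \<open>z = (x, r)\<close> stands for the window \<open>[x, x + r]\<close> of length \<open>r\<close>; the weight depends on the
  length only and is normalized so that the superposition of windows is exactly the kernel.
\<close>
definition tent_weight :: "real \<Rightarrow> real \<times> real \<Rightarrow> ennreal" where
  "tent_weight H z = ennreal (H * (2 * H - 1) * (2 - 2 * H) * (3 - 2 * H) * snd z powr (2 * H - 4))
      * indicator {0<..} (snd z)"

definition window :: "real \<Rightarrow> real \<times> real \<Rightarrow> ennreal" where
  "window u z = indicator {(u, x, r). x \<le> u \<and> u \<le> x + r} (u, z)"

lemma borel_measurable_tent_weight [measurable]: "tent_weight H \<in> borel_measurable borel"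
  unfolding tent_weight_def borel_prod[symmetric] by measurable

lemma borel_measurable_window [measurable]:
  "case_prod window \<in> borel_measurable (borel \<Otimes>\<^sub>M borel)"
proof -
  have "{(u, x, r). x \<le> u \<and> u \<le> x + (r::real)} \<in> sets (borel :: (real \<times> real \<times> real) measure)"
    unfolding split_beta'
    by (intro borel_closed closed_Collect_conj closed_Collect_le continuous_intros)
  then show ?thesis
    unfolding window_def borel_prod by (simp add: split_beta)
qed

text \<open>
  The windows of length \<open>r\<close> that contain both \<open>u\<close> and \<open>v\<close> have starting points filling an interval of
  length \<open>max 0 (r - \<bar>u - v\<bar>)\<close>. Integration over \<open>r\<close> then produces the power of \<open>\<bar>u - v\<bar>\<close>.
\<close>
lemma fbm_kernel_eq_tent_integral:
  assumes "1 / 2 < H" "H < 1" "u \<noteq> v"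
  shows "ennreal (fbm_kernel H u v)
    = (\<integral>\<^sup>+z. tent_weight H z * (window u z * window v z) \<partial>lborel)"
proof -
  define y where "y = \<bar>u - v\<bar>"
  define al where "al = 2 - 2 * H"
  define c where "c = H * (2 * H - 1) * (al * (al + 1))"
  have "y > 0" "al > 0" "c \<ge> 0" using assms by (auto simp: y_def al_def c_def)
  have inner: "(\<integral>\<^sup>+x. tent_weight H (x, r) * (window u (x, r) * window v (x, r)) \<partial>lborel)
      = ennreal c * (ennreal ((r - y) * r powr (- al - 2)) * indicator {y..} r)" for r
  proof -
    have "(\<integral>\<^sup>+x. tent_weight H (x, r) * (window u (x, r) * window v (x, r)) \<partial>lborel)
        = (\<integral>\<^sup>+x. tent_weight H (0, r) * indicator {max u v - r..min u v} x \<partial>lborel)"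
      by (intro nn_integral_cong)
         (auto simp: tent_weight_def window_def split: split_indicator)
    also have "\<dots> = tent_weight H (0, r) * emeasure lborel {max u v - r..min u v}"
      by (simp add: nn_integral_cmult_indicator)
    also have "emeasure lborel {max u v - r..min u v} = ennreal (r - y)"
    proof (cases "y \<le> r")
      case True
      have y: "max u v - min u v = y" by (simp add: y_def max_def min_def)
      with True have "max u v - r \<le> min u v" by linarith
      from emeasure_lborel_Icc[OF this] y show ?thesis by (simp add: algebra_simps)
    next
      case False
      then show ?thesis by (auto simp: y_def ennreal_neg)
    qed
    also have "tent_weight H (0, r) * ennreal (r - y)
        = ennreal c * (ennreal ((r - y) * r powr (- al - 2)) * indicator {y..} r)"
    proof (cases "y \<le> r")
      case True
      with \<open>y > 0\<close> have "r > 0" by simp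
      have coeff: "H * (2 * H - 1) * (2 - 2 * H) * (3 - 2 * H) = c" "2 * H - 4 = - al - 2"
        by (simp_all add: c_def al_def algebra_simps)
      have "tent_weight H (0, r) = ennreal (c * r powr (- al - 2))"
        unfolding tent_weight_def snd_conv coeff using \<open>r > 0\<close> by simp
      then show ?thesis using True \<open>c \<ge> 0\<close>
        by (simp add: ennreal_mult[symmetric] mult_ac)
    next
      case False
      then show ?thesis by (simp add: ennreal_neg)
    qed
    finally show ?thesis .
  qed
  have "(\<integral>\<^sup>+z. tent_weight H z * (window u z * window v z) \<partial>lborel)
      = (\<integral>\<^sup>+r. \<integral>\<^sup>+x. tent_weight H (x, r) * (window u (x, r) * window v (x, r)) \<partial>lborel \<partial>lborel)"
  proof -
    have "(\<lambda>z. tent_weight H z * (window u z * window v z)) \<in> borel_measurable (lborel \<Otimes>\<^sub>M lborel)"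
      unfolding lborel_prod by measurable
    then show ?thesis
      unfolding lborel_prod[symmetric] by (subst lborel_pair.nn_integral_snd[symmetric]) auto
  qed
  also have "\<dots> = ennreal c * ennreal (y powr (- al) / (al * (al + 1)))"
    unfolding inner using nn_integral_tent[OF \<open>al > 0\<close> \<open>y > 0\<close>]
    by (subst nn_integral_cmult) auto
  also have "\<dots> = ennreal (fbm_kernel H u v)"
    using \<open>al > 0\<close> \<open>c \<ge> 0\<close>
    by (simp add: ennreal_mult[symmetric] c_def fbm_kernel_def y_def al_def mult.assoc)
  finally show ?thesis by simp
qed

text \<open>
  Exchanging the order of integration exhibits the energy as a weighted integral of squares, that
  is, the kernel as positive definite.
\<close>
lemma fbm_energy_eq_tent:
  assumes "1 / 2 < H" "H < 1" and [measurable]: "d \<in> borel_measurable borel"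
  shows "fbm_energy H d = (\<integral>\<^sup>+z. tent_weight H z * (\<integral>\<^sup>+u. d u * window u z \<partial>lborel)\<^sup>2 \<partial>lborel)"
proof -
  let ?w = "tent_weight H"
  have "fbm_energy H d = (\<integral>\<^sup>+u. \<integral>\<^sup>+v. \<integral>\<^sup>+z. (?w z * (d u * window u z)) * (d v * window v z)
      \<partial>lborel \<partial>lborel \<partial>lborel)"
    unfolding fbm_energy_def
  proof (rule nn_integral_cong, rule nn_integral_cong_AE)
    fix u
    show "AE v in lborel. d u * d v * ennreal (fbm_kernel H u v)
       = (\<integral>\<^sup>+z. (?w z * (d u * window u z)) * (d v * window v z) \<partial>lborel)"
      using AE_lborel_singleton[of u]
    proof eventually_elim
      case (elim v)
      then show ?case
        using assms(1,2) by (simp add: fbm_kernel_eq_tent_integral)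
          (subst nn_integral_cmult[symmetric], auto simp: mult_ac)
    qed
  qed
  also have "\<dots> = (\<integral>\<^sup>+u. \<integral>\<^sup>+z. \<integral>\<^sup>+v. (?w z * (d u * window u z)) * (d v * window v z)
      \<partial>lborel \<partial>lborel \<partial>lborel)"
    by (intro nn_integral_cong lborel_pair.Fubini') measurable
  also have "\<dots> = (\<integral>\<^sup>+u. \<integral>\<^sup>+z. (?w z * (\<integral>\<^sup>+v. d v * window v z \<partial>lborel)) * (d u * window u z)
      \<partial>lborel \<partial>lborel)"
    by (intro nn_integral_cong, subst nn_integral_cmult) (auto simp: mult_ac)
  also have "\<dots> = (\<integral>\<^sup>+z. \<integral>\<^sup>+u. (?w z * (\<integral>\<^sup>+v. d v * window v z \<partial>lborel)) * (d u * window u z)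
      \<partial>lborel \<partial>lborel)"
    by (intro lborel_pair.Fubini') measurable
  also have "\<dots> = (\<integral>\<^sup>+z. ?w z * (\<integral>\<^sup>+u. d u * window u z \<partial>lborel)\<^sup>2 \<partial>lborel)"
    by (intro nn_integral_cong, subst nn_integral_cmult) (auto simp: power2_eq_square mult_ac)
  finally show ?thesis .
qed

text \<open>
  The energy contains the cross terms \<open>d u * d' v\<close>, which no pointwise estimate absorbs; as an
  integral of squares it inherits \<open>(a + b)\<^sup>2 \<le> 2 a\<^sup>2 + 2 b\<^sup>2\<close>.
\<close>
lemma fbm_energy_add_le:
  assumes "1 / 2 < H" "H < 1"
    and [measurable]: "d \<in> borel_measurable borel" "d' \<in> borel_measurable borel"
  shows "fbm_energy H (\<lambda>u. d u + d' u) \<le> 2 * fbm_energy H d + 2 * fbm_energy H d'"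
proof -
  let ?w = "tent_weight H"
  let ?I = "\<lambda>d z. \<integral>\<^sup>+u. d u * window u z \<partial>lborel"
  have "fbm_energy H (\<lambda>u. d u + d' u) = (\<integral>\<^sup>+z. ?w z * (?I (\<lambda>u. d u + d' u) z)\<^sup>2 \<partial>lborel)"
    using assms(1,2) by (intro fbm_energy_eq_tent) measurable
  also have "\<dots> \<le> (\<integral>\<^sup>+z. 2 * (?w z * (?I d z)\<^sup>2) + 2 * (?w z * (?I d' z)\<^sup>2) \<partial>lborel)"
  proof (rule nn_integral_mono)
    fix z
    have "?I (\<lambda>u. d u + d' u) z = ?I d z + ?I d' z"
      unfolding distrib_right by (rule nn_integral_add) measurable
    then have "?w z * (?I (\<lambda>u. d u + d' u) z)\<^sup>2 \<le> ?w z * (2 * (?I d z)\<^sup>2 + 2 * (?I d' z)\<^sup>2)"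
      by (simp add: mult_left_mono ennreal_square_add_le)
    then show "?w z * (?I (\<lambda>u. d u + d' u) z)\<^sup>2 \<le> 2 * (?w z * (?I d z)\<^sup>2) + 2 * (?w z * (?I d' z)\<^sup>2)"
      by (simp add: distrib_left mult_ac)
  qed
  also have "\<dots> = 2 * fbm_energy H d + 2 * fbm_energy H d'"
    using assms(1,2) by (simp add: nn_integral_add nn_integral_cmult fbm_energy_eq_tent)
  finally show ?thesis .
qed

section \<open>Step functions and Wiener integrals\<close>

text \<open>
  Step functions are lists of weighted intervals that may overlap. Sums and linear images of step
  functions are then list operations, and no common refinement of partitions is ever needed.
\<close>
definition step_fun :: "(real \<times> real \<times> 'v::real_normed_vector) list \<Rightarrow> real \<Rightarrow> 'v" where
  "step_fun xs u = (\<Sum>(p, q, c)\<leftarrow>xs. indicat_real {p<..q} u *\<^sub>R c)"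

definition step_integral ::
    "(real \<Rightarrow> real) \<Rightarrow> (real \<times> real \<times> 'v::real_normed_vector) list \<Rightarrow> 'v" where
  "step_integral w xs = (\<Sum>(p, q, c)\<leftarrow>xs. (w q - w p) *\<^sub>R c)"

definition ordered_steps :: "(real \<times> real \<times> 'v) list \<Rightarrow> bool" where
  "ordered_steps xs \<longleftrightarrow> (\<forall>(p, q, c)\<in>set xs. p \<le> q)"

lemma step_fun_append: "step_fun (xs @ ys) u = step_fun xs u + step_fun ys u"
  by (simp add: step_fun_def)

lemma step_integral_append: "step_integral w (xs @ ys) = step_integral w xs + step_integral w ys"
  by (simp add: step_integral_def)

lemma ordered_steps_append: "ordered_steps (xs @ ys) \<longleftrightarrow> ordered_steps xs \<and> ordered_steps ys"
  unfolding ordered_steps_def set_append ball_Un ..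

definition map_steps :: "('v \<Rightarrow> 'u) \<Rightarrow> (real \<times> real \<times> 'v) list \<Rightarrow> (real \<times> real \<times> 'u) list" where
  "map_steps h xs = map (\<lambda>(p, q, c). (p, q, h c)) xs"

lemma ordered_steps_map_steps: "ordered_steps (map_steps h xs) \<longleftrightarrow> ordered_steps xs"
  by (auto simp: ordered_steps_def map_steps_def)

lemma
  assumes "bounded_linear h"
  shows step_fun_map_steps: "step_fun (map_steps h xs) u = h (step_fun xs u)"
    and step_integral_map_steps: "step_integral w (map_steps h xs) = h (step_integral w xs)"
proof -
  interpret bounded_linear h by fact
  show "step_fun (map_steps h xs) u = h (step_fun xs u)"
    by (induction xs) (auto simp: step_fun_def map_steps_def add scaleR zero)
  show "step_integral w (map_steps h xs) = h (step_integral w xs)"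
    by (induction xs) (auto simp: step_integral_def map_steps_def add scaleR zero)
qed

lemma borel_measurable_step_fun [measurable]:
  fixes xs :: "(real \<times> real \<times> 'v::euclidean_space) list"
  shows "step_fun xs \<in> borel_measurable borel"
proof (induction xs)
  case (Cons x xs)
  obtain p q c where x: "x = (p, q, c)" by (cases x)
  have "step_fun (x # xs) = (\<lambda>u. indicat_real {p<..q} u *\<^sub>R c + step_fun xs u)"
    by (simp add: step_fun_def x fun_eq_iff)
  then show ?case using Cons by simp
qed (simp add: step_fun_def)

abbreviation mean_sq :: "'w measure \<Rightarrow> ('w \<Rightarrow> ennreal) \<Rightarrow> ennreal" where
  "mean_sq M Z \<equiv> (\<integral>\<^sup>+\<omega>. (Z \<omega>)\<^sup>2 \<partial>M)"

abbreviation norm_mean_sq :: "'w measure \<Rightarrow> ('w \<Rightarrow> 'v::real_normed_vector) \<Rightarrow> ennreal" where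
  "norm_mean_sq M X \<equiv> (\<integral>\<^sup>+\<omega>. ennreal ((norm (X \<omega>))\<^sup>2) \<partial>M)"

text \<open>
  Only the second moments of a fractional Brownian motion enter the theory of its integrals.
\<close>
locale fractional_process = prob_space P for P :: "'w measure" +
  fixes H :: real and W :: "real \<Rightarrow> 'w \<Rightarrow> real"
  assumes H: "1 / 2 < H" "H < 1"
    and W_measurable [measurable]: "\<And>t. W t \<in> borel_measurable P"
    and W_integrable: "\<And>t s. integrable P (\<lambda>\<omega>. W t \<omega> * W s \<omega>)"
    and W_cov: "\<And>t s. expectation (\<lambda>\<omega>. W t \<omega> * W s \<omega>)
        = 1 / 2 * (\<bar>t\<bar> powr (2 * H) + \<bar>s\<bar> powr (2 * H) - \<bar>t - s\<bar> powr (2 * H))"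
begin

abbreviation elementary :: "'w \<Rightarrow> (real \<times> real \<times> 'v::real_normed_vector) list \<Rightarrow> 'v" where
  "elementary \<omega> xs \<equiv> step_integral (\<lambda>t. W t \<omega>) xs"

abbreviation energy :: "(real \<Rightarrow> 'v::real_normed_vector) \<Rightarrow> ennreal" where
  "energy G \<equiv> fbm_energy H (\<lambda>u. ennreal (norm (G u)))"

lemma step_integral_measurable [measurable]:
  fixes xs :: "(real \<times> real \<times> 'v::euclidean_space) list"
  shows "(\<lambda>\<omega>. elementary \<omega> xs) \<in> borel_measurable P"
proof (induction xs)
  case (Cons x xs)
  obtain p q c where x: "x = (p, q, c)" by (cases x)
  have "(\<lambda>\<omega>. elementary \<omega> (x # xs))
      = (\<lambda>\<omega>. (W q \<omega> - W p \<omega>) *\<^sub>R c + elementary \<omega> xs)"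
    by (simp add: step_integral_def x)
  then show ?case using Cons by simp
qed (simp add: step_integral_def)

lemma increment_integrable: "integrable P (\<lambda>\<omega>. (W b \<omega> - W a \<omega>) * (W d \<omega> - W c \<omega>))"
  using W_integrable by (simp add: algebra_simps)

lemma increment_cov:
  "expectation (\<lambda>\<omega>. (W b \<omega> - W a \<omega>) * (W d \<omega> - W c \<omega>)) = fbm_increment_cov H a b c d"
proof -
  have "expectation (\<lambda>\<omega>. (W b \<omega> - W a \<omega>) * (W d \<omega> - W c \<omega>))
      = expectation (\<lambda>\<omega>. W b \<omega> * W d \<omega>) - expectation (\<lambda>\<omega>. W b \<omega> * W c \<omega>)
        - (expectation (\<lambda>\<omega>. W a \<omega> * W d \<omega>) - expectation (\<lambda>\<omega>. W a \<omega> * W c \<omega>))"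
    using W_integrable by (simp add: left_diff_distrib right_diff_distrib)
  then show ?thesis
    by (simp add: W_cov fbm_increment_cov_def abs_minus_commute field_simps)
qed

lemma has_bochner_integral_kernel_rectangle:
  assumes "a \<le> b" "c \<le> d"
  shows "has_bochner_integral lborel (\<lambda>z. indicat_real {a<..b} (fst z) * indicat_real {c<..d} (snd z)
      * fbm_kernel H (fst z) (snd z)) (fbm_increment_cov H a b c d)"
proof (rule has_bochner_integral_nn_integral)
  let ?f = "\<lambda>u v. indicat_real {a<..b} u * indicat_real {c<..d} v * fbm_kernel H u v"
  show meas: "(\<lambda>z. ?f (fst z) (snd z)) \<in> borel_measurable lborel"
  proof -
    have "(\<lambda>z. ?f (fst z) (snd z)) \<in> borel_measurable (borel \<Otimes>\<^sub>M borel)" by measurable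
    then show ?thesis by (simp add: borel_prod)
  qed
  have "(\<integral>\<^sup>+z. ennreal (?f (fst z) (snd z)) \<partial>lborel)
      = (\<integral>\<^sup>+u. \<integral>\<^sup>+v. ennreal (?f u v) \<partial>lborel \<partial>lborel)"
    using lborel.nn_integral_fst[of "\<lambda>z. ennreal (?f (fst z) (snd z))" lborel] meas
    by (simp add: lborel_prod)
  also have "\<dots> = (\<integral>\<^sup>+u\<in>{a..b}. (\<integral>\<^sup>+v\<in>{c..d}. ennreal (fbm_kernel H u v) \<partial>lborel) \<partial>lborel)"
  proof (rule nn_integral_cong_AE)
    show "AE u in lborel. (\<integral>\<^sup>+v. ennreal (?f u v) \<partial>lborel)
        = (\<integral>\<^sup>+v\<in>{c..d}. ennreal (fbm_kernel H u v) \<partial>lborel) * indicator {a..b} u"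
      using AE_lborel_singleton[of a]
    proof eventually_elim
      case (elim u)
      have "(\<integral>\<^sup>+v. ennreal (?f u v) \<partial>lborel)
          = (\<integral>\<^sup>+v. (ennreal (fbm_kernel H u v) * indicator {c..d} v) * indicator {a..b} u \<partial>lborel)"
      proof (rule nn_integral_cong_AE)
        show "AE v in lborel. ennreal (?f u v)
            = (ennreal (fbm_kernel H u v) * indicator {c..d} v) * indicator {a..b} u"
          using AE_lborel_singleton[of c]
          by eventually_elim (use elim in \<open>auto split: split_indicator\<close>)
      qed
      then show ?case by (simp add: nn_integral_multc)
    qed
  qed
  also have "\<dots> = ennreal (fbm_increment_cov H a b c d)"
    using H assms by (intro nn_integral_fbm_kernel_rectangle)
  finally show "(\<integral>\<^sup>+z. ennreal (?f (fst z) (snd z)) \<partial>lborel)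
      = ennreal (fbm_increment_cov H a b c d)" .
qed (use H assms fbm_kernel_nonneg[of H] fbm_increment_cov_nonneg[of H a b c d] in auto)

text \<open>
  The isometry of the Wiener integral on step functions: the second moment is the sum of increment
  covariances weighted by inner products of coefficients, hence a double integral of
  \<open>step_fun xs u \<bullet> step_fun xs v\<close> against the kernel.
\<close>
lemma step_integral_L2_le:
  fixes xs :: "(real \<times> real \<times> 'v::euclidean_space) list"
  assumes "ordered_steps xs"
  shows "norm_mean_sq P (\<lambda>\<omega>. elementary \<omega> xs)
    \<le> energy (\<lambda>u. step_fun xs u)"
proof -
  define I where "I = {..<length xs}"
  define p where "p i = fst (xs ! i)" for i
  define q where "q i = fst (snd (xs ! i))" for i
  define c where "c i = snd (snd (xs ! i))" for i
  define D where "D i \<omega> = W (q i) \<omega> - W (p i) \<omega>" for i \<omega>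
  have pq: "p i \<le> q i" if "i \<in> I" for i
    using assms nth_mem[of i xs] that by (auto simp: I_def p_def q_def ordered_steps_def split_beta)
  have si: "elementary \<omega> xs = (\<Sum>i\<in>I. D i \<omega> *\<^sub>R c i)" for \<omega>
    unfolding step_integral_def I_def D_def p_def q_def c_def
    by (simp add: sum_list_sum_nth split_beta atLeast0LessThan)
  have sf: "step_fun xs u = (\<Sum>i\<in>I. indicat_real {p i<..q i} u *\<^sub>R c i)" for u
    unfolding step_fun_def I_def p_def q_def c_def
    by (simp add: sum_list_sum_nth split_beta atLeast0LessThan)
  let ?R = "\<lambda>i j z. indicat_real {p i<..q i} (fst z) * indicat_real {p j<..q j} (snd z)
      * fbm_kernel H (fst z) (snd z)"
  let ?k = "\<lambda>z. (step_fun xs (fst z) \<bullet> step_fun xs (snd z)) * fbm_kernel H (fst z) (snd z)"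
  have sq: "(norm (elementary \<omega> xs))\<^sup>2 = (\<Sum>i\<in>I. \<Sum>j\<in>I. (D i \<omega> * D j \<omega>) * (c i \<bullet> c j))" for \<omega>
    unfolding si by (simp add: power2_norm_eq_inner inner_sum_left inner_sum_right mult_ac inner_commute)
  have int_D: "integrable P (\<lambda>\<omega>. D i \<omega> * D j \<omega>)" for i j
    unfolding D_def by (rule increment_integrable)
  have cov_D: "expectation (\<lambda>\<omega>. D i \<omega> * D j \<omega>) = fbm_increment_cov H (p i) (q i) (p j) (q j)" for i j
    unfolding D_def by (rule increment_cov)
  have k_sum: "?k = (\<lambda>z. \<Sum>i\<in>I. \<Sum>j\<in>I. ?R i j z * (c i \<bullet> c j))"
    unfolding sf inner_sum_left
    by (simp add: fun_eq_iff inner_sum_right sum_distrib_left sum_distrib_right mult_ac)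
  have R: "integrable lborel (?R i j)"
      "integral\<^sup>L lborel (?R i j) = fbm_increment_cov H (p i) (q i) (p j) (q j)"
    if "i \<in> I" "j \<in> I" for i j
    using has_bochner_integral_kernel_rectangle[OF pq[OF that(1)] pq[OF that(2)]]
    by (auto simp: has_bochner_integral_iff)
  have int_sq: "integrable P (\<lambda>\<omega>. (norm (elementary \<omega> xs))\<^sup>2)"
    unfolding sq by (intro Bochner_Integration.integrable_sum integrable_mult_left int_D)
  have "norm_mean_sq P (\<lambda>\<omega>. elementary \<omega> xs)
      = ennreal (expectation (\<lambda>\<omega>. (norm (elementary \<omega> xs))\<^sup>2))"
    by (rule nn_integral_eq_integral[OF int_sq]) simp
  also have "expectation (\<lambda>\<omega>. (norm (elementary \<omega> xs))\<^sup>2)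
      = (\<Sum>i\<in>I. \<Sum>j\<in>I. fbm_increment_cov H (p i) (q i) (p j) (q j) * (c i \<bullet> c j))"
    unfolding sq using int_D by (simp add: cov_D)
  also have "\<dots> = integral\<^sup>L lborel ?k"
    unfolding k_sum using R by simp
  also have "ennreal \<dots> \<le> ennreal (norm (integral\<^sup>L lborel ?k))"
    by (intro ennreal_leI) simp
  also have "\<dots> \<le> (\<integral>\<^sup>+z. ennreal (norm (?k z)) \<partial>lborel)"
  proof (rule integral_norm_bound_ennreal)
    show "integrable lborel ?k" unfolding k_sum using R by (intro Bochner_Integration.integrable_sum integrable_mult_left)
  qed
  also have "\<dots> \<le> (\<integral>\<^sup>+z. ennreal (norm (step_fun xs (fst z))) * ennreal (norm (step_fun xs (snd z)))
      * ennreal (fbm_kernel H (fst z) (snd z)) \<partial>lborel)"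
  proof (rule nn_integral_mono)
    fix z :: "real \<times> real"
    have "norm (?k z) \<le> norm (step_fun xs (fst z)) * norm (step_fun xs (snd z))
        * fbm_kernel H (fst z) (snd z)"
      using fbm_kernel_nonneg[OF H(1)] Cauchy_Schwarz_ineq2
      by (auto simp: abs_mult intro!: mult_right_mono)
    then show "ennreal (norm (?k z)) \<le> ennreal (norm (step_fun xs (fst z)))
        * ennreal (norm (step_fun xs (snd z))) * ennreal (fbm_kernel H (fst z) (snd z))"
      using fbm_kernel_nonneg[OF H(1)] by (simp add: ennreal_mult[symmetric] ennreal_leI)
  qed
  also have "\<dots> = energy (\<lambda>u. step_fun xs u)"
  proof -
    have "(\<lambda>z. ennreal (norm (step_fun xs (fst z))) * ennreal (norm (step_fun xs (snd z)))
        * ennreal (fbm_kernel H (fst z) (snd z))) \<in> borel_measurable (lborel \<Otimes>\<^sub>M lborel)"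
      by measurable
    from lborel.nn_integral_fst[OF this] show ?thesis
      by (simp add: fbm_energy_def lborel_prod)
  qed
  finally show ?thesis .
qed

text \<open>
  The Wiener integral of a function on the whole line. Integrals over different intervals become
  integrals of different functions and can be added.
\<close>
definition wiener_limit :: "(real \<Rightarrow> 'v::euclidean_space) \<Rightarrow> ('w \<Rightarrow> 'v) \<Rightarrow> bool" where
  "wiener_limit G X \<longleftrightarrow> G \<in> borel_measurable borel \<and> X \<in> borel_measurable P \<and>
     (\<forall>e>0. \<exists>xs. ordered_steps xs \<and>
        energy (\<lambda>u. G u - step_fun xs u) < ennreal e \<and>
        norm_mean_sq P (\<lambda>\<omega>. elementary \<omega> xs - X \<omega>) < ennreal e)"

lemma wiener_limitD:
  assumes "wiener_limit G X"
  shows "G \<in> borel_measurable borel" "X \<in> borel_measurable P"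
    "\<And>e. e > 0 \<Longrightarrow> \<exists>xs. ordered_steps xs \<and>
        energy (\<lambda>u. G u - step_fun xs u) < ennreal e \<and>
        norm_mean_sq P (\<lambda>\<omega>. elementary \<omega> xs - X \<omega>) < ennreal e"
  using assms unfolding wiener_limit_def by blast+

lemma fbm_energy_norm_le:
  fixes F G K :: "real \<Rightarrow> 'v::euclidean_space"
  assumes [measurable]: "G \<in> borel_measurable borel" "K \<in> borel_measurable borel"
    and "\<And>u. norm (F u) \<le> norm (G u) + norm (K u)"
  shows "energy F \<le> 2 * energy G + 2 * energy K"
proof -
  have "energy F \<le> fbm_energy H (\<lambda>u. ennreal (norm (G u)) + ennreal (norm (K u)))"
    using assms(3) by (intro fbm_energy_mono) (simp add: ennreal_leI flip: ennreal_plus)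
  also have "\<dots> \<le> 2 * energy G + 2 * energy K"
    using H by (intro fbm_energy_add_le) measurable
  finally show ?thesis .
qed

lemma nn_integral_norm_square_add_le:
  fixes X Y Z :: "'a \<Rightarrow> 'v::euclidean_space"
  assumes [measurable]: "Y \<in> borel_measurable M" "Z \<in> borel_measurable M"
    and "AE \<omega> in M. norm (X \<omega>) \<le> norm (Y \<omega>) + norm (Z \<omega>)"
  shows "norm_mean_sq M X \<le> 2 * norm_mean_sq M Y + 2 * norm_mean_sq M Z"
proof -
  have "norm_mean_sq M X
      \<le> (\<integral>\<^sup>+\<omega>. 2 * ennreal ((norm (Y \<omega>))\<^sup>2) + 2 * ennreal ((norm (Z \<omega>))\<^sup>2) \<partial>M)"
  proof (rule nn_integral_mono_AE)
    show "AE \<omega> in M. ennreal ((norm (X \<omega>))\<^sup>2)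
        \<le> 2 * ennreal ((norm (Y \<omega>))\<^sup>2) + 2 * ennreal ((norm (Z \<omega>))\<^sup>2)"
      using assms(3)
    proof eventually_elim
      case (elim \<omega>)
      have "ennreal ((norm (X \<omega>))\<^sup>2) \<le> (ennreal (norm (Y \<omega>)) + ennreal (norm (Z \<omega>)))\<^sup>2"
        using elim by (simp add: ennreal_power power_mono ennreal_leI del: ennreal_plus flip: ennreal_plus)
      also have "\<dots> \<le> 2 * (ennreal (norm (Y \<omega>)))\<^sup>2 + 2 * (ennreal (norm (Z \<omega>)))\<^sup>2"
        by (rule ennreal_square_add_le)
      finally show ?case by (simp add: ennreal_power)
    qed
  qed
  then show ?thesis by (simp add: nn_integral_add nn_integral_cmult)
qed

lemma ennreal_add_quarters_less:
  assumes "a < ennreal (e / 4)" "b < ennreal (e / 4)" "e > 0"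
  shows "2 * a + 2 * b < ennreal e"
proof -
  obtain x y where xy: "a = ennreal x" "b = ennreal y" "0 \<le> x" "0 \<le> y"
    using assms by (metis ennreal_cases infinity_ennreal_def top.not_eq_extremum order_less_trans ennreal_less_top)
  then have "x < e / 4" "y < e / 4" using assms by (auto simp: ennreal_less_iff)
  then have "2 * x + 2 * y < e" by simp
  then have "ennreal (2 * x + 2 * y) < ennreal e" using xy by (subst ennreal_less_iff) auto
  then show ?thesis using xy by (simp add: ennreal_mult')
qed

lemma wiener_limit_add:
  assumes "wiener_limit G X" "wiener_limit G' X'"
  shows "wiener_limit (\<lambda>u. G u + G' u) (\<lambda>\<omega>. X \<omega> + X' \<omega>)"
  unfolding wiener_limit_def
proof (intro conjI allI impI)
  note [measurable] = wiener_limitD(1,2)[OF assms(1)] wiener_limitD(1,2)[OF assms(2)]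
  show "(\<lambda>u. G u + G' u) \<in> borel_measurable borel" "(\<lambda>\<omega>. X \<omega> + X' \<omega>) \<in> borel_measurable P"
    by measurable
  fix e :: real assume "e > 0"
  then have "e / 4 > 0" by simp
  obtain xs where xs: "ordered_steps xs"
      "energy (\<lambda>u. G u - step_fun xs u) < ennreal (e / 4)"
      "norm_mean_sq P (\<lambda>\<omega>. elementary \<omega> xs - X \<omega>) < ennreal (e / 4)"
    using wiener_limitD(3)[OF assms(1) \<open>e / 4 > 0\<close>] by blast
  obtain ys where ys: "ordered_steps ys"
      "energy (\<lambda>u. G' u - step_fun ys u) < ennreal (e / 4)"
      "norm_mean_sq P (\<lambda>\<omega>. elementary \<omega> ys - X' \<omega>) < ennreal (e / 4)"
    using wiener_limitD(3)[OF assms(2) \<open>e / 4 > 0\<close>] by blast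
  have "energy (\<lambda>u. G u + G' u - step_fun (xs @ ys) u)
      \<le> 2 * energy (\<lambda>u. G u - step_fun xs u)
        + 2 * energy (\<lambda>u. G' u - step_fun ys u)"
    by (intro fbm_energy_norm_le)
       (auto simp: step_fun_append add_diff_add intro: norm_triangle_ineq)
  also have "\<dots> < ennreal e"
    using xs(2) ys(2) \<open>e > 0\<close> by (rule ennreal_add_quarters_less)
  finally have 1: "energy (\<lambda>u. G u + G' u - step_fun (xs @ ys) u) < ennreal e" .
  have "norm_mean_sq P (\<lambda>\<omega>. elementary \<omega> (xs @ ys) - (X \<omega> + X' \<omega>))
      \<le> 2 * norm_mean_sq P (\<lambda>\<omega>. elementary \<omega> xs - X \<omega>)
        + 2 * norm_mean_sq P (\<lambda>\<omega>. elementary \<omega> ys - X' \<omega>)"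
    by (intro nn_integral_norm_square_add_le)
       (auto simp: step_integral_append add_diff_add intro: norm_triangle_ineq)
  also have "\<dots> < ennreal e"
    using xs(3) ys(3) \<open>e > 0\<close> by (rule ennreal_add_quarters_less)
  finally show "\<exists>zs. ordered_steps zs \<and>
      energy (\<lambda>u. G u + G' u - step_fun zs u) < ennreal e \<and>
      norm_mean_sq P (\<lambda>\<omega>. elementary \<omega> zs - (X \<omega> + X' \<omega>)) < ennreal e"
    using 1 xs(1) ys(1) by (intro exI[of _ "xs @ ys"]) (simp add: ordered_steps_append)
qed

lemma wiener_limit_linear:
  fixes h :: "'v::euclidean_space \<Rightarrow> 'u::euclidean_space"
  assumes "bounded_linear h" "wiener_limit G X"
  shows "wiener_limit (\<lambda>u. h (G u)) (\<lambda>\<omega>. h (X \<omega>))"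
  unfolding wiener_limit_def
proof (intro conjI allI impI)
  note [measurable] = wiener_limitD(1,2)[OF assms(2)]
  interpret bounded_linear h by fact
  have [measurable]: "h \<in> borel_measurable borel"
    by (rule borel_measurable_continuous_onI[OF linear_continuous_on[OF assms(1)]])
  show "(\<lambda>u. h (G u)) \<in> borel_measurable borel" "(\<lambda>\<omega>. h (X \<omega>)) \<in> borel_measurable P"
    by measurable
  obtain k where k: "k > 0" "\<And>x. norm (h x) \<le> norm x * k"
    using pos_bounded by blast
  fix e :: real assume "e > 0"
  \<comment> \<open>Energies and second moments are quadratic in the operator bound \<open>k\<close> of \<open>h\<close>.\<close>
  then have "e / k\<^sup>2 > 0" using k by simp
  obtain xs where xs: "ordered_steps xs"
      "energy (\<lambda>u. G u - step_fun xs u) < ennreal (e / k\<^sup>2)"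
      "norm_mean_sq P (\<lambda>\<omega>. elementary \<omega> xs - X \<omega>) < ennreal (e / k\<^sup>2)"
    using wiener_limitD(3)[OF assms(2) \<open>e / k\<^sup>2 > 0\<close>] by blast
  have scale: "(ennreal k)\<^sup>2 * z < ennreal e" if "z < ennreal (e / k\<^sup>2)" for z
  proof -
    have "(ennreal k)\<^sup>2 * z < (ennreal k)\<^sup>2 * ennreal (e / k\<^sup>2)"
      using that k by (intro ennreal_mult_strict_left_mono) (auto simp: ennreal_power)
    also have "\<dots> = ennreal e" using k \<open>e > 0\<close> by (simp add: ennreal_power ennreal_mult[symmetric])
    finally show ?thesis .
  qed
  have "energy (\<lambda>u. h (G u) - step_fun (map_steps h xs) u)
      \<le> fbm_energy H (\<lambda>u. ennreal k * ennreal (norm (G u - step_fun xs u)))"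
    using k by (intro fbm_energy_mono)
      (auto simp: step_fun_map_steps[OF assms(1)] diff[symmetric] ennreal_mult'[symmetric] mult.commute
        intro!: ennreal_leI)
  also have "\<dots> = (ennreal k)\<^sup>2 * energy (\<lambda>u. G u - step_fun xs u)"
    by (rule fbm_energy_cmult) measurable
  also have "\<dots> < ennreal e" by (rule scale) fact
  finally have 1: "energy (\<lambda>u. h (G u) - step_fun (map_steps h xs) u) < ennreal e" .
  have "norm_mean_sq P (\<lambda>\<omega>. elementary \<omega> (map_steps h xs) - h (X \<omega>))
      \<le> (\<integral>\<^sup>+\<omega>. (ennreal k)\<^sup>2 * ennreal ((norm (elementary \<omega> xs - X \<omega>))\<^sup>2) \<partial>P)"
  proof (rule nn_integral_mono)
    fix \<omega>
    have "(norm (h (elementary \<omega> xs - X \<omega>)))\<^sup>2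
        \<le> (norm (elementary \<omega> xs - X \<omega>) * k)\<^sup>2"
      by (intro power_mono k) simp
    then show "ennreal ((norm (elementary \<omega> (map_steps h xs) - h (X \<omega>)))\<^sup>2)
        \<le> (ennreal k)\<^sup>2 * ennreal ((norm (elementary \<omega> xs - X \<omega>))\<^sup>2)"
      using k(1) by (simp add: step_integral_map_steps[OF assms(1)] diff[symmetric] ennreal_power
          ennreal_mult[symmetric] power_mult_distrib mult.commute ennreal_leI)
  qed
  also have "\<dots> = (ennreal k)\<^sup>2 * norm_mean_sq P (\<lambda>\<omega>. elementary \<omega> xs - X \<omega>)"
    by (rule nn_integral_cmult) measurable
  also have "\<dots> < ennreal e" by (rule scale) fact
  finally show "\<exists>zs. ordered_steps zs \<and>
      energy (\<lambda>u. h (G u) - step_fun zs u) < ennreal e \<and>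
      norm_mean_sq P (\<lambda>\<omega>. elementary \<omega> zs - h (X \<omega>)) < ennreal e"
    using 1 xs(1) by (intro exI[of _ "map_steps h xs"]) (simp add: ordered_steps_map_steps)
qed

lemma wiener_limit_diff:
  assumes "wiener_limit G X" "wiener_limit G' X'"
  shows "wiener_limit (\<lambda>u. G u - G' u) (\<lambda>\<omega>. X \<omega> - X' \<omega>)"
  using wiener_limit_add[OF assms(1) wiener_limit_linear[OF bounded_linear_minus[OF bounded_linear_ident] assms(2)]]
  by simp

text \<open>
  Compare with step functions, where the isometry applies. The quasi triangle inequality is used
  twice, first for the random variables and then for the energies, which gives the factor four.
\<close>
lemma wiener_limit_L2_le:
  assumes "wiener_limit G X"
  shows "norm_mean_sq P X \<le> 4 * energy G"
proof (rule ennreal_le_epsilon)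
  note [measurable] = wiener_limitD(1,2)[OF assms]
  fix e :: real assume "e > 0"
  then have "e / 6 > 0" by simp
  obtain xs where xs: "ordered_steps xs"
      "energy (\<lambda>u. G u - step_fun xs u) < ennreal (e / 6)"
      "norm_mean_sq P (\<lambda>\<omega>. elementary \<omega> xs - X \<omega>) < ennreal (e / 6)"
    using wiener_limitD(3)[OF assms \<open>e / 6 > 0\<close>] by blast
  let ?E = "energy G"
  have "norm_mean_sq P X
      \<le> 2 * norm_mean_sq P (\<lambda>\<omega>. elementary \<omega> xs - X \<omega>)
        + 2 * norm_mean_sq P (\<lambda>\<omega>. elementary \<omega> xs)"
    by (intro nn_integral_norm_square_add_le)
       (auto intro!: order_trans[OF norm_triangle_sub] simp: norm_minus_commute add.commute)
  also have "\<dots> \<le> 2 * ennreal (e / 6) + 2 * energy (\<lambda>u. step_fun xs u)"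
    using xs by (intro add_mono mult_left_mono step_integral_L2_le) auto
  also have "energy (\<lambda>u. step_fun xs u)
      \<le> 2 * energy (\<lambda>u. G u - step_fun xs u) + 2 * ?E"
    by (intro fbm_energy_norm_le)
       (auto intro!: order_trans[OF norm_triangle_sub] simp: norm_minus_commute add.commute)
  also have "\<dots> \<le> 2 * ennreal (e / 6) + 2 * ?E"
    using xs by (intro add_mono mult_left_mono) auto
  also have "2 * ennreal (e / 6) + 2 * (2 * ennreal (e / 6) + 2 * ?E) = 4 * ?E + 6 * ennreal (e / 6)"
  proof -
    have "2 * x + 2 * (2 * x + 2 * y) = 4 * y + 6 * x" for x y :: ennreal
    proof -
      have "4 * y + 6 * x = (2 * 2) * y + (2 + 2 * 2) * x" by simp
      then show ?thesis by (simp only: distrib_left distrib_right mult.assoc add_ac)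
    qed
    then show ?thesis .
  qed
  also have "6 * ennreal (e / 6) = ennreal e"
    using \<open>e > 0\<close> by (simp add: ennreal_mult'[symmetric] flip: ennreal_numeral)
  finally show "norm_mean_sq P X \<le> 4 * ?E + ennreal e"
    by (simp add: add_mono mult_left_mono)
qed

text \<open>
  Uniqueness and additivity of the integral both reduce to this: differences of integrals are
  integrals of differences, and an integrand that vanishes almost everywhere has no energy.
\<close>
lemma wiener_limit_AE_zero:
  assumes "wiener_limit G X" "AE u in lborel. G u = 0"
  shows "AE \<omega> in P. X \<omega> = 0"
proof -
  note [measurable] = wiener_limitD(1,2)[OF assms(1)]
  have "energy G \<le> fbm_energy H (\<lambda>_. 0)"
    using assms(2) by (intro fbm_energy_mono) (auto elim: AE_mp)
  with wiener_limit_L2_le[OF assms(1)]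
  have "norm_mean_sq P X = 0"
    by (simp add: fbm_energy_zero)
  then show ?thesis by (subst (asm) nn_integral_0_iff_AE) auto
qed

end

section \<open>Riemann sums of bounded measurable functions\<close>

text \<open>
  Measurable functions are almost everywhere limits of continuous ones. Projecting these onto the
  ball of radius \<open>M\<close> keeps them continuous and makes dominated convergence applicable.
\<close>
lemma integrable_bounded_approx_continuous:
  fixes G :: "real \<Rightarrow> 'v::euclidean_space"
  assumes [measurable]: "G \<in> borel_measurable borel" and bound: "\<And>u. norm (G u) \<le> M" and "e > 0"
  obtains k where "continuous_on UNIV k" "(\<integral>\<^sup>+u\<in>{a..b}. ennreal (norm (G u - k u)) \<partial>lborel) < ennreal e"
proof -
  have "M \<ge> 0" using order_trans[OF norm_ge_zero bound] .
  have "G \<in> borel_measurable (lebesgue_on UNIV)"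
    using measurable_completion[of G lborel borel] assms(1)
    by (intro measurable_restrict_space1) simp
  then have "G measurable_on UNIV"
    by (subst measurable_on_iff_borel_measurable) auto
  then obtain N g where g: "negligible N" "\<And>n. continuous_on UNIV (g n)"
      "\<And>x. x \<notin> N \<Longrightarrow> (\<lambda>n. g n x) \<longlonglongrightarrow> G x"
    unfolding measurable_on_def by (auto simp: fun_eq_iff)
  define k where "k n x = closest_point (cball 0 M) (g n x)" for n :: nat and x
  have cont_cp: "continuous_on UNIV (closest_point (cball (0::'v) M))"
    using \<open>M \<ge> 0\<close> by (intro continuous_on_closest_point) auto
  have cont: "continuous_on UNIV (k n)" for n
    unfolding k_def using continuous_on_compose2[OF cont_cp g(2)] by auto
  then have [measurable]: "k n \<in> borel_measurable borel" for n
    by (rule borel_measurable_continuous_onI)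
  have k_bound: "norm (k n x) \<le> M" for n x
    using closest_point_in_set[of "cball (0::'v) M" "g n x"] \<open>M \<ge> 0\<close> by (simp add: k_def)
  have lim: "(\<lambda>n. k n x) \<longlonglongrightarrow> G x" if "x \<notin> N" for x
  proof -
    have "(\<lambda>n. closest_point (cball 0 M) (g n x)) \<longlonglongrightarrow> closest_point (cball 0 M) (G x)"
      using continuous_on_tendsto_compose[OF cont_cp g(3)[OF that]] by simp
    then show ?thesis using bound[of x] by (simp add: k_def closest_point_self)
  qed
  have AE_N: "AE x in lborel. x \<notin> N"
    using g(1) by (metis AE_not_in completion.AE_iff_null_sets negligible_iff_null_sets AE_completion_iff)
  have "(\<lambda>n. \<integral>\<^sup>+u. ennreal (norm (G u - k n u)) * indicator {a..b} u \<partial>lborel)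
      \<longlonglongrightarrow> (\<integral>\<^sup>+u. 0 \<partial>(lborel :: real measure))"
  proof (rule nn_integral_dominated_convergence[where w = "\<lambda>u. ennreal (2 * M) * indicator {a..b} u"])
    show "AE u in lborel. ennreal (norm (G u - k n u)) * indicator {a..b} u
        \<le> ennreal (2 * M) * indicator {a..b} u" for n
    proof (rule AE_I2)
      fix u
      have "norm (G u - k n u) \<le> 2 * M"
        using norm_triangle_ineq4[of "G u" "k n u"] bound[of u] k_bound[of n u] by simp
      then show "ennreal (norm (G u - k n u)) * indicator {a..b} u
        \<le> ennreal (2 * M) * indicator {a..b} u" by (intro mult_right_mono ennreal_leI) auto
    qed
    show "(\<integral>\<^sup>+u. ennreal (2 * M) * indicator {a..b} u \<partial>lborel) < \<infinity>"
      by (subst nn_integral_cmult_indicator)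
         (auto simp: ennreal_mult_less_top emeasure_lborel_Icc_eq)
    show "AE u in lborel. (\<lambda>n. ennreal (norm (G u - k n u)) * indicator {a..b} u) \<longlonglongrightarrow> 0"
      using AE_N
    proof eventually_elim
      case (elim u)
      have "(\<lambda>n. G u - k n u) \<longlonglongrightarrow> G u - G u"
        by (intro tendsto_intros lim elim)
      then have "(\<lambda>n. ennreal (norm (G u - k n u))) \<longlonglongrightarrow> ennreal 0"
        by (intro tendsto_ennrealI tendsto_norm_zero) simp
      then show ?case by (simp split: split_indicator)
    qed
  qed measurable
  then have "(\<lambda>n. \<integral>\<^sup>+u. ennreal (norm (G u - k n u)) * indicator {a..b} u \<partial>lborel) \<longlonglongrightarrow> 0"
    by simp
  from order_tendstoD(2)[OF this, of "ennreal e"] \<open>e > 0\<close>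
  have "eventually (\<lambda>n. (\<integral>\<^sup>+u\<in>{a..b}. ennreal (norm (G u - k n u)) \<partial>lborel) < ennreal e) sequentially"
    by simp
  then obtain n where "(\<integral>\<^sup>+u\<in>{a..b}. ennreal (norm (G u - k n u)) \<partial>lborel) < ennreal e"
    unfolding eventually_sequentially by auto
  with cont show thesis by (intro that) auto
qed

text \<open>
  Otherwise the integral would exceed the mean value times the length of the interval. The slack \<open>e\<close>
  avoids a strict inequality between integrals.
\<close>
lemma exists_le_average:
  fixes f :: "real \<Rightarrow> real"
  assumes [measurable]: "f \<in> borel_measurable borel" and nonneg: "\<And>u. 0 \<le> f u" and "p < q" "e > 0"
  shows "\<exists>\<xi>\<in>{p..q}. ennreal (f \<xi> * (q - p)) \<le> (\<integral>\<^sup>+u\<in>{p..q}. ennreal (f u) \<partial>lborel) + ennreal (e * (q - p))"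
proof (rule ccontr)
  assume "\<not> ?thesis"
  then have less: "(\<integral>\<^sup>+u\<in>{p..q}. ennreal (f u) \<partial>lborel) + ennreal (e * (q - p)) < ennreal (f \<xi> * (q - p))"
    if "\<xi> \<in> {p..q}" for \<xi> using that by (auto simp: not_le)
  let ?I = "\<integral>\<^sup>+u\<in>{p..q}. ennreal (f u) \<partial>lborel"
  have "?I < \<top>" using less[of p] assms(3) by (cases ?I) (auto simp: top_unique)
  then obtain r where r: "?I = ennreal r" "r \<ge> 0" by (cases ?I) auto
  have "r / (q - p) + e \<le> f \<xi>" if "\<xi> \<in> {p..q}" for \<xi>
  proof -
    have "r + e * (q - p) < f \<xi> * (q - p)"
      using less[OF that] r assms(3,4) by (simp add: ennreal_less_iff flip: ennreal_plus)
    then show ?thesis using assms(3) by (simp add: field_simps)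
  qed
  then have "(\<integral>\<^sup>+u. ennreal (r / (q - p) + e) * indicator {p..q} u \<partial>lborel) \<le> ?I"
    by (intro nn_integral_mono) (auto split: split_indicator intro: ennreal_leI)
  then have "ennreal ((r / (q - p) + e) * (q - p)) \<le> ennreal r"
    using assms(3,4) r by (simp add: nn_integral_cmult_indicator ennreal_mult'')
  then have "(r / (q - p) + e) * (q - p) \<le> r" using r by (simp add: ennreal_le_iff)
  moreover have "(r / (q - p) + e) * (q - p) = r + e * (q - p)"
    using assms(3) by (simp add: field_simps)
  moreover have "e * (q - p) > 0" using assms(3,4) by simp
  ultimately show False by linarith
qed

definition uniform_point :: "real \<Rightarrow> real \<Rightarrow> nat \<Rightarrow> nat \<Rightarrow> real" where
  "uniform_point a b n j = a + real j * ((b - a) / real n)"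

definition riemann_steps ::
    "(real \<Rightarrow> 'v) \<Rightarrow> (nat \<Rightarrow> real) \<Rightarrow> nat \<Rightarrow> (nat \<Rightarrow> real) \<Rightarrow> (real \<times> real \<times> 'v) list" where
  "riemann_steps g p n \<xi> = map (\<lambda>j. (p j, p (Suc j), g (\<xi> j))) [0..<n]"

lemma step_fun_map: "step_fun (map (\<lambda>j. (p j, q j, c j)) [0..<n]) u
    = (\<Sum>j<n. indicat_real {p j<..q j} u *\<^sub>R c j)"
  by (simp add: step_fun_def o_def interv_sum_list_conv_sum_set_nat atLeast0LessThan)

lemma step_integral_map: "step_integral w (map (\<lambda>j. (p j, q j, c j)) [0..<n])
    = (\<Sum>j<n. (w (q j) - w (p j)) *\<^sub>R c j)"
  by (simp add: step_integral_def o_def interv_sum_list_conv_sum_set_nat atLeast0LessThan)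

lemma subdivision_mono:
  assumes "subdivision a b n p" "i \<le> j" "j \<le> n"
  shows "p i \<le> p j"
  using assms(2,3)
proof (induction j rule: dec_induct)
  case (step k)
  have "p k \<le> p (Suc k)" using assms(1) step.prems by (simp add: subdivision_def)
  with step show ?case by (meson Suc_leD order_trans)
qed simp

lemma subdivision_cell_unique:
  assumes "subdivision a b n p" "i < n" "j < n" "u \<in> {p i<..p (Suc i)}" "u \<in> {p j<..p (Suc j)}"
  shows "i = j"
proof (rule ccontr)
  assume "i \<noteq> j"
  then have "p (Suc i) \<le> p j \<or> p (Suc j) \<le> p i"
    using subdivision_mono[OF assms(1), of "Suc i" j] subdivision_mono[OF assms(1), of "Suc j" i] assms(2,3)
    by linarith
  then show False using assms(4,5) by auto
qed

lemma subdivision_step_eq: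
  fixes c :: "nat \<Rightarrow> 'v::real_normed_vector"
  assumes "subdivision a b n p" "j < n" "u \<in> {p j<..p (Suc j)}"
  shows "(\<Sum>i<n. indicat_real {p i<..p (Suc i)} u *\<^sub>R c i) = c j"
proof -
  have "indicat_real {p i<..p (Suc i)} u *\<^sub>R c i = (if i = j then c j else 0)" if "i < n" for i
  proof (cases "i = j")
    case False
    then have "u \<notin> {p i<..p (Suc i)}"
      using subdivision_cell_unique[OF assms(1) \<open>i < n\<close> assms(2) _ assms(3)] by blast
    then show ?thesis using False by simp
  qed (use assms(3) in simp)
  then have "(\<Sum>i<n. indicat_real {p i<..p (Suc i)} u *\<^sub>R c i) = (\<Sum>i<n. if i = j then c j else 0)"
    by (intro sum.cong) simp_all
  then show ?thesis using assms(2) by simp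
qed

lemma subdivision_covers:
  assumes "subdivision a b n p" "u \<in> {a<..b}"
  obtains j where "j < n" "u \<in> {p j<..p (Suc j)}"
proof -
  define j where "j = (LEAST i. u \<le> p i)"
  have ex: "u \<le> p n" using assms by (simp add: subdivision_def)
  have j: "u \<le> p j" "j \<le> n" unfolding j_def using ex by (rule LeastI, rule Least_le)
  have "j \<noteq> 0" using j(1) assms by (auto simp: subdivision_def intro: ccontr)
  then obtain i where i: "j = Suc i" by (cases j) auto
  have "\<not> u \<le> p i" using not_less_Least[of i "\<lambda>i. u \<le> p i"] i by (simp add: j_def)
  with j i show thesis by (intro that[of i]) auto
qed

lemma subdivision_step_outside:
  fixes c :: "nat \<Rightarrow> 'v::real_normed_vector"
  assumes "subdivision a b n p" "u \<notin> {a<..b}"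
  shows "(\<Sum>i<n. indicat_real {p i<..p (Suc i)} u *\<^sub>R c i) = 0"
proof (rule sum.neutral, rule ballI)
  fix i assume "i \<in> {..<n}"
  then have "p 0 \<le> p i" "p (Suc i) \<le> p n" by (auto intro!: subdivision_mono[OF assms(1)])
  then have "u \<notin> {p i<..p (Suc i)}" using assms by (auto simp: subdivision_def)
  then show "indicat_real {p i<..p (Suc i)} u *\<^sub>R c i = 0" by simp
qed

lemma subdivision_uniform:
  assumes "a \<le> b" "n > 0"
  shows "subdivision a b n (uniform_point a b n)"
  using assms by (auto simp: subdivision_def uniform_point_def divide_right_mono mult_right_mono)

text \<open>
  For a merely measurable function arbitrary tags are useless, but good tags exist: take a
  continuous \<open>k\<close> close to \<open>G\<close> in mean, and in each cell a tag where \<open>G\<close> is as close to \<open>k\<close> as it is on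
  average over the cell. The oscillation of \<open>k\<close> within a cell is small by uniform continuity.
\<close>
lemma riemann_steps_L1_approx:
  fixes G :: "real \<Rightarrow> 'v::euclidean_space"
  assumes [measurable]: "G \<in> borel_measurable borel" and bound: "\<And>u. norm (G u) \<le> M"
    and "a < b" "e > 0"
  shows "\<exists>N. \<forall>n\<ge>N. \<exists>\<xi>. (\<forall>j<n. \<xi> j \<in> {uniform_point a b n j..uniform_point a b n (Suc j)}) \<and>
    (\<integral>\<^sup>+u\<in>{a..b}. ennreal (norm (G u - step_fun (riemann_steps G (uniform_point a b n) n \<xi>) u)) \<partial>lborel)
      \<le> ennreal e"
proof -
  \<comment> \<open>Approximation of \<open>G\<close> and the excess over the average each enter twice, the latter over the
    whole interval.\<close>
  define \<delta> where "\<delta> = e / (2 + 2 * (b - a))"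
  have "\<delta> > 0" using assms(3,4) by (simp add: \<delta>_def)
  obtain k where k: "continuous_on UNIV k" "(\<integral>\<^sup>+u\<in>{a..b}. ennreal (norm (G u - k u)) \<partial>lborel) < ennreal \<delta>"
    using integrable_bounded_approx_continuous[OF assms(1,2) \<open>\<delta> > 0\<close>] .
  have [measurable]: "k \<in> borel_measurable borel" using k(1) by (rule borel_measurable_continuous_onI)
  have "uniformly_continuous_on {a..b} k"
    by (intro compact_uniformly_continuous continuous_on_subset[OF k(1)]) auto
  then obtain \<eta> where \<eta>: "\<eta> > 0"
      "\<And>x y. x \<in> {a..b} \<Longrightarrow> y \<in> {a..b} \<Longrightarrow> dist x y < \<eta> \<Longrightarrow> dist (k x) (k y) < \<delta>"
    unfolding uniformly_continuous_on_def using \<open>\<delta> > 0\<close> by metis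
  obtain N where N: "(b - a) / \<eta> < real N" using reals_Archimedean2 by blast
  show ?thesis
  proof (intro exI[of _ "Suc N"] allI impI)
    fix n assume "n \<ge> Suc N"
    then have "n > 0" and "(b - a) / \<eta> < real n" using N by auto
    then have mesh: "(b - a) / real n < \<eta>" using \<eta>(1) by (simp add: field_simps)
    define p where "p = uniform_point a b n"
    define h where "h = (b - a) / real n"
    have "h > 0" using assms(3) \<open>n > 0\<close> by (simp add: h_def)
    have sub: "subdivision a b n p"
      unfolding p_def using assms(3) \<open>n > 0\<close> by (intro subdivision_uniform) auto
    have p_Suc: "p (Suc j) = p j + h" for j
      by (simp add: p_def uniform_point_def h_def distrib_right add_divide_distrib)
    have p_in: "p j \<in> {a..b}" if "j \<le> n" for j
      using subdivision_mono[OF sub, of 0 j] subdivision_mono[OF sub, of j n] that sub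
      by (simp add: subdivision_def)
    let ?f = "\<lambda>u. norm (G u - k u)"
    let ?I = "\<lambda>j. \<integral>\<^sup>+u\<in>{p j..p (Suc j)}. ennreal (?f u) \<partial>lborel"
    have "\<forall>j. \<exists>\<xi>\<in>{p j..p (Suc j)}. ennreal (?f \<xi> * h) \<le> ?I j + ennreal (\<delta> * h)"
    proof
      fix j
      show "\<exists>\<xi>\<in>{p j..p (Suc j)}. ennreal (?f \<xi> * h) \<le> ?I j + ennreal (\<delta> * h)"
        using exists_le_average[of ?f "p j" "p (Suc j)" \<delta>] \<open>h > 0\<close> \<open>\<delta> > 0\<close> by (simp add: p_Suc)
    qed
    then obtain \<xi> where \<xi>: "\<And>j. \<xi> j \<in> {p j..p (Suc j)}"
        "\<And>j. ennreal (?f (\<xi> j) * h) \<le> ?I j + ennreal (\<delta> * h)" by metis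
    let ?s = "step_fun (riemann_steps G p n \<xi>)"
    let ?J = "\<lambda>j u. ennreal (?f u) * indicator {p j..p (Suc j)} u
        + (ennreal \<delta> + ennreal (?f (\<xi> j))) * indicator {p j..p (Suc j)} u"
    have s_eq: "?s u = G (\<xi> j)" if "j < n" "u \<in> {p j<..p (Suc j)}" for u j
      using subdivision_step_eq[OF sub that] by (simp add: riemann_steps_def step_fun_map)
    have pw: "ennreal (norm (G u - ?s u)) * indicator {a..b} u \<le> (\<Sum>j<n. ?J j u)" if "u \<noteq> a" for u
    proof (cases "u \<in> {a..b}")
      case True
      with that have "u \<in> {a<..b}" by auto
      then obtain j where j: "j < n" "u \<in> {p j<..p (Suc j)}"
        using subdivision_covers[OF sub] by blast
      have in_ab: "u \<in> {a..b}" "\<xi> j \<in> {a..b}"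
        using True \<xi>(1)[of j] p_in[of j] p_in[of "Suc j"] j(1) by auto
      have "dist u (\<xi> j) < \<eta>"
        using \<xi>(1)[of j] j(2) mesh unfolding h_def[symmetric] by (auto simp: p_Suc dist_real_def)
      then have "norm (k u - k (\<xi> j)) < \<delta>" using \<eta>(2)[OF in_ab] by (simp add: dist_norm)
      moreover have "norm (G u - ?s u) \<le> ?f u + norm (k u - k (\<xi> j)) + ?f (\<xi> j)"
        unfolding s_eq[OF j] by norm
      ultimately have "norm (G u - ?s u) \<le> ?f u + (\<delta> + ?f (\<xi> j))" by simp
      then have "ennreal (norm (G u - ?s u)) \<le> ennreal (?f u) + (ennreal \<delta> + ennreal (?f (\<xi> j)))"
        using \<open>\<delta> > 0\<close> by (simp add: ennreal_leI flip: ennreal_plus)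
      also have "\<dots> = ?J j u" using j(2) by simp
      also have "\<dots> \<le> (\<Sum>j<n. ?J j u)" using j(1) by (intro member_le_sum) auto
      finally show ?thesis using True by simp
    qed simp
    have "(\<integral>\<^sup>+u\<in>{a..b}. ennreal (norm (G u - ?s u)) \<partial>lborel) \<le> (\<integral>\<^sup>+u. (\<Sum>j<n. ?J j u) \<partial>lborel)"
      using AE_lborel_singleton[of a] by (intro nn_integral_mono_AE, eventually_elim) (rule pw)
    also have "\<dots> = (\<Sum>j<n. ?I j + (ennreal \<delta> + ennreal (?f (\<xi> j))) * ennreal h)"
      using \<open>h > 0\<close> by (simp add: nn_integral_sum nn_integral_add nn_integral_cmult_indicator p_Suc)
    also have "\<dots> \<le> (\<Sum>j<n. 2 * ?I j + ennreal (2 * \<delta> * h))"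
    proof (rule sum_mono)
      fix j
      have "?I j + (ennreal \<delta> + ennreal (?f (\<xi> j))) * ennreal h
          = ?I j + (ennreal (\<delta> * h) + ennreal (?f (\<xi> j) * h))"
        using \<open>h > 0\<close> \<open>\<delta> > 0\<close> by (simp add: distrib_right ennreal_mult)
      also have "\<dots> \<le> ?I j + (ennreal (\<delta> * h) + (?I j + ennreal (\<delta> * h)))"
        by (intro add_mono order_refl \<xi>(2))
      also have "\<dots> = 2 * ?I j + (ennreal (\<delta> * h) + ennreal (\<delta> * h))"
        by (simp add: mult_2 add_ac)
      also have "ennreal (\<delta> * h) + ennreal (\<delta> * h) = ennreal (2 * \<delta> * h)"
        using \<open>h > 0\<close> \<open>\<delta> > 0\<close> by (subst ennreal_plus[symmetric]) auto
      finally show "?I j + (ennreal \<delta> + ennreal (?f (\<xi> j))) * ennreal h \<le> 2 * ?I j + ennreal (2 * \<delta> * h)" .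
    qed
    also have "\<dots> = 2 * (\<Sum>j<n. ?I j) + ennreal (2 * \<delta> * (b - a))"
    proof -
      have "(\<Sum>j<n. ennreal (2 * \<delta> * h)) = ennreal (\<Sum>j<n. 2 * \<delta> * h)"
        using \<open>h > 0\<close> \<open>\<delta> > 0\<close> by (intro sum_ennreal) auto
      also have "(\<Sum>j<n. 2 * \<delta> * h) = 2 * \<delta> * (b - a)" using \<open>n > 0\<close> by (simp add: h_def)
      finally show ?thesis by (simp add: sum.distrib sum_distrib_left)
    qed
    also have "(\<Sum>j<n. ?I j) \<le> (\<integral>\<^sup>+u\<in>{a..b}. ennreal (?f u) \<partial>lborel)"
    proof -
      have "(\<Sum>j<n. ?I j) = (\<integral>\<^sup>+u. (\<Sum>j<n. ennreal (?f u) * indicator {p j..p (Suc j)} u) \<partial>lborel)"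
        by (rule nn_integral_sum[symmetric]) measurable
      also have "\<dots> = (\<integral>\<^sup>+u. (\<Sum>j<n. ennreal (?f u) * indicator {p j<..p (Suc j)} u) \<partial>lborel)"
      proof (rule nn_integral_cong_AE)
        have "AE u in lborel. \<forall>j\<in>{..<n}. u \<noteq> p j"
          by (intro AE_finite_allI AE_lborel_singleton) auto
        then show "AE u in lborel. (\<Sum>j<n. ennreal (?f u) * indicator {p j..p (Suc j)} u)
            = (\<Sum>j<n. ennreal (?f u) * indicator {p j<..p (Suc j)} u)"
          by eventually_elim (intro sum.cong, auto split: split_indicator)
      qed
      also have "\<dots> \<le> (\<integral>\<^sup>+u\<in>{a..b}. ennreal (?f u) \<partial>lborel)"
      proof (rule nn_integral_mono)
        fix u
        have "(\<Sum>j<n. indicat_real {p j<..p (Suc j)} u) \<le> indicat_real {a..b} u"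
        proof (cases "u \<in> {a<..b}")
          case True
          then obtain j where "j < n" "u \<in> {p j<..p (Suc j)}" using subdivision_covers[OF sub] by blast
          with subdivision_step_eq[OF sub this, of "\<lambda>_. 1::real"] True show ?thesis by simp
        next
          case False
          then show ?thesis using subdivision_step_outside[OF sub False, of "\<lambda>_. 1::real"] by simp
        qed
        then have "ennreal (\<Sum>j<n. indicat_real {p j<..p (Suc j)} u) \<le> ennreal (indicat_real {a..b} u)"
          by (rule ennreal_leI)
        then have "(\<Sum>j<n. indicator {p j<..p (Suc j)} u) \<le> (indicator {a..b} u :: ennreal)"
          by (simp add: sum_ennreal[symmetric] ennreal_indicator)
        then show "(\<Sum>j<n. ennreal (?f u) * indicator {p j<..p (Suc j)} u) \<le> ennreal (?f u) * indicator {a..b} u"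
          by (simp add: sum_distrib_left[symmetric] mult_left_mono)
      qed
      finally show ?thesis .
    qed
    also have "(\<integral>\<^sup>+u\<in>{a..b}. ennreal (?f u) \<partial>lborel) \<le> ennreal \<delta>" using k(2) by simp
    also have "2 * ennreal \<delta> + ennreal (2 * \<delta> * (b - a)) = ennreal (2 * \<delta> + 2 * \<delta> * (b - a))"
      using \<open>\<delta> > 0\<close> assms(3) by (simp add: ennreal_mult')
    also have "2 * \<delta> + 2 * \<delta> * (b - a) = \<delta> * (2 + 2 * (b - a))" by (simp add: algebra_simps)
    also have "\<dots> = e" using assms(3) by (simp add: \<delta>_def)
    finally have "(\<integral>\<^sup>+u\<in>{a..b}. ennreal (norm (G u - ?s u)) \<partial>lborel) \<le> ennreal e"
      by (simp add: add_mono mult_left_mono)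
    then show "\<exists>\<xi>. (\<forall>j<n. \<xi> j \<in> {uniform_point a b n j..uniform_point a b n (Suc j)}) \<and>
        (\<integral>\<^sup>+u\<in>{a..b}. ennreal (norm (G u - step_fun (riemann_steps G (uniform_point a b n) n \<xi>) u)) \<partial>lborel)
          \<le> ennreal e"
      using \<xi>(1) by (intro exI[of _ \<xi>]) (simp add: p_def)
  qed
qed

section \<open>Both kinds of stochastic integral as Wiener limits\<close>

context fractional_process
begin

lemma wiener_limit_if_has_wiener_integral:
  fixes g G :: "real \<Rightarrow> 'v::euclidean_space"
  assumes "has_wiener_integral P H W g a b X"
    and [measurable]: "X \<in> borel_measurable P" "G \<in> borel_measurable borel"
    and G: "\<And>u. G u = indicat_real {a..b} u *\<^sub>R g u"
  shows "wiener_limit G X"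
  unfolding wiener_limit_def
proof (intro conjI allI impI assms(2,3))
  fix e :: real assume "e > 0"
  then obtain n p c where sub: "subdivision a b n p"
    and d: "(let d = (\<lambda>u. norm (g u - (\<Sum>j<n. indicat_real {p j<..p (Suc j)} u *\<^sub>R c j))) in
           (\<integral>\<^sup>+u\<in>{a..b}. (\<integral>\<^sup>+v\<in>{a..b}. ennreal (d u * d v * fbm_kernel H u v) \<partial>lborel) \<partial>lborel)
             < ennreal e)"
    and i: "norm_mean_sq P (\<lambda>\<omega>. (\<Sum>j<n. (W (p (Suc j)) \<omega> - W (p j) \<omega>) *\<^sub>R c j) - X \<omega>)
             < ennreal e"
    using assms(1) unfolding has_wiener_integral_def Let_def by blast
  define xs where "xs = map (\<lambda>j. (p j, p (Suc j), c j)) [0..<n]"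
  define d where "d u = norm (g u - (\<Sum>j<n. indicat_real {p j<..p (Suc j)} u *\<^sub>R c j))" for u
  have D: "norm (G u - step_fun xs u) = d u * indicat_real {a..b} u" for u
  proof (cases "u \<in> {a..b}")
    case False
    then have "u \<notin> {a<..b}" by auto
    from subdivision_step_outside[OF sub this, of c] False show ?thesis
      by (simp add: G xs_def step_fun_map)
  qed (simp add: G xs_def step_fun_map d_def)
  have "energy (\<lambda>u. G u - step_fun xs u)
      = (\<integral>\<^sup>+u\<in>{a..b}. (\<integral>\<^sup>+v\<in>{a..b}. ennreal (d u * d v * fbm_kernel H u v) \<partial>lborel) \<partial>lborel)"
    unfolding fbm_energy_def D
  proof (rule nn_integral_cong)
    fix u
    show "(\<integral>\<^sup>+v. ennreal (d u * indicat_real {a..b} u) * ennreal (d v * indicat_real {a..b} v)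
          * ennreal (fbm_kernel H u v) \<partial>lborel)
        = (\<integral>\<^sup>+v\<in>{a..b}. ennreal (d u * d v * fbm_kernel H u v) \<partial>lborel) * indicator {a..b} u"
    proof (cases "u \<in> {a..b}")
      case True
      have "d v \<ge> 0" for v by (simp add: d_def)
      then show ?thesis using True fbm_kernel_nonneg[OF H(1)]
        by (auto intro!: nn_integral_cong simp: ennreal_mult split: split_indicator)
    qed simp
  qed
  with d have "energy (\<lambda>u. G u - step_fun xs u) < ennreal e"
    by (simp add: d_def Let_def)
  moreover have "ordered_steps xs"
    using sub by (auto simp: xs_def ordered_steps_def subdivision_def)
  moreover have "norm_mean_sq P (\<lambda>\<omega>. elementary \<omega> xs - X \<omega>) < ennreal e"
    using i by (simp add: xs_def step_integral_map)
  ultimately show "\<exists>xs. ordered_steps xs \<and>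
      energy (\<lambda>u. G u - step_fun xs u) < ennreal e \<and>
      norm_mean_sq P (\<lambda>\<omega>. elementary \<omega> xs - X \<omega>) < ennreal e"
    by (intro exI[of _ xs] conjI)
qed

lemma step_integral_diff_L2_le:
  fixes xs ys :: "(real \<times> real \<times> 'v::euclidean_space) list"
  assumes "ordered_steps xs" "ordered_steps ys"
  shows "norm_mean_sq P (\<lambda>\<omega>. elementary \<omega> xs - elementary \<omega> ys)
    \<le> energy (\<lambda>u. step_fun xs u - step_fun ys u)"
proof -
  have neg: "bounded_linear (\<lambda>x::'v. - x)" by (intro bounded_linear_minus bounded_linear_ident)
  show ?thesis
    using step_integral_L2_le[of "xs @ map_steps (\<lambda>x. - x) ys"] assms
    by (simp add: step_integral_append step_fun_append ordered_steps_append ordered_steps_map_steps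
        step_integral_map_steps[OF neg] step_fun_map_steps[OF neg])
qed

text \<open>
  The approximating integrals form a Cauchy sequence in mean square by the isometry. Fatou's lemma
  identifies the mean-square limit with the almost sure one.
\<close>
lemma wiener_limit_if_AE_limit:
  fixes G :: "real \<Rightarrow> 'v::euclidean_space"
  assumes [measurable]: "G \<in> borel_measurable borel" "X \<in> borel_measurable P"
    and ord: "\<And>m. ordered_steps (xs m)"
    and energy: "(\<lambda>m. energy (\<lambda>u. G u - step_fun (xs m) u)) \<longlonglongrightarrow> 0"
    and lim: "AE \<omega> in P. (\<lambda>m. elementary \<omega> (xs m)) \<longlonglongrightarrow> X \<omega>"
  shows "wiener_limit G X"
  unfolding wiener_limit_def
proof (intro conjI allI impI assms(1,2))
  fix e :: real assume "e > 0"
  let ?E = "\<lambda>m. energy (\<lambda>u. G u - step_fun (xs m) u)"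
  let ?S = "\<lambda>m \<omega>. elementary \<omega> (xs m)"
  have "eventually (\<lambda>m. ?E m < ennreal (e / 2 / 4)) sequentially"
    using order_tendstoD(2)[OF energy, of "ennreal (e / 2 / 4)"] \<open>e > 0\<close> by simp
  then obtain m where m: "\<And>l. l \<ge> m \<Longrightarrow> ?E l < ennreal (e / 2 / 4)"
    unfolding eventually_sequentially by blast
  have close: "norm_mean_sq P (\<lambda>\<omega>. ?S m \<omega> - ?S l \<omega>) \<le> ennreal (e / 2)" if "l \<ge> m" for l
  proof -
    have "norm_mean_sq P (\<lambda>\<omega>. ?S m \<omega> - ?S l \<omega>)
        \<le> energy (\<lambda>u. step_fun (xs m) u - step_fun (xs l) u)"
      by (intro step_integral_diff_L2_le ord)
    also have "\<dots> \<le> 2 * ?E m + 2 * ?E l"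
      by (intro fbm_energy_norm_le) (measurable, norm)
    also have "\<dots> < ennreal (e / 2)"
      using m[OF order_refl] m[OF that] \<open>e > 0\<close> by (intro ennreal_add_quarters_less) auto
    finally show ?thesis by simp
  qed
  have "norm_mean_sq P (\<lambda>\<omega>. ?S m \<omega> - X \<omega>)
      = (\<integral>\<^sup>+\<omega>. liminf (\<lambda>l. ennreal ((norm (?S m \<omega> - ?S l \<omega>))\<^sup>2)) \<partial>P)"
  proof (rule nn_integral_cong_AE)
    show "AE \<omega> in P. ennreal ((norm (?S m \<omega> - X \<omega>))\<^sup>2)
        = liminf (\<lambda>l. ennreal ((norm (?S m \<omega> - ?S l \<omega>))\<^sup>2))"
      using lim
    proof eventually_elim
      case (elim \<omega>)
      then have "(\<lambda>l. ennreal ((norm (?S m \<omega> - ?S l \<omega>))\<^sup>2)) \<longlonglongrightarrow> ennreal ((norm (?S m \<omega> - X \<omega>))\<^sup>2)"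
        by (intro tendsto_intros tendsto_ennrealI)
      then show ?case by (rule lim_imp_Liminf[OF sequentially_bot, symmetric])
    qed
  qed
  also have "\<dots> \<le> liminf (\<lambda>l. \<integral>\<^sup>+\<omega>. ennreal ((norm (?S m \<omega> - ?S l \<omega>))\<^sup>2) \<partial>P)"
    by (rule nn_integral_liminf) measurable
  also have "\<dots> \<le> liminf (\<lambda>l. ennreal (e / 2))"
    using close by (intro Liminf_mono) (auto simp: eventually_sequentially)
  also have "\<dots> = ennreal (e / 2)" by (simp add: lim_imp_Liminf)
  also have "\<dots> < ennreal e" using \<open>e > 0\<close> by (simp add: ennreal_less_iff)
  finally have "norm_mean_sq P (\<lambda>\<omega>. ?S m \<omega> - X \<omega>) < ennreal e" .
  moreover have "?E m < ennreal e"
    using m[OF order_refl] by (rule less_le_trans) (use \<open>e > 0\<close> in \<open>auto intro!: ennreal_leI\<close>)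
  ultimately show "\<exists>xs. ordered_steps xs \<and>
      energy (\<lambda>u. G u - step_fun xs u) < ennreal e \<and>
      norm_mean_sq P (\<lambda>\<omega>. elementary \<omega> xs - X \<omega>) < ennreal e"
    using ord by (intro exI[of _ "xs m"] conjI)
qed

text \<open>
  A pathwise Riemann-Stieltjes integral is the limit of Riemann sums for every choice of tags, in
  particular for tags whose step functions converge to the integrand in energy. Hence it is
  also the Wiener integral.
\<close>
lemma wiener_limit_if_has_RS_integral:
  fixes g G :: "real \<Rightarrow> 'v::euclidean_space"
  assumes RS: "AE \<omega> in P. has_RS_integral g (\<lambda>t. W t \<omega>) a b (X \<omega>)"
    and [measurable]: "X \<in> borel_measurable P" "G \<in> borel_measurable borel"
    and G: "\<And>u. G u = indicat_real {a..b} u *\<^sub>R g u" and bound: "\<And>u. norm (G u) \<le> M" and "a \<le> b"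
  shows "wiener_limit G X"
proof (cases "a = b")
  case True
  have "AE \<omega> in P. X \<omega> = 0"
    using RS
  proof eventually_elim
    case (elim \<omega>)
    have "norm (X \<omega>) < e" if "e > 0" for e
    proof -
      from elim \<open>e > 0\<close> obtain d where "\<forall>n p \<xi>. subdivision a b n p \<longrightarrow>
          (\<forall>j<n. p j \<le> \<xi> j \<and> \<xi> j \<le> p (Suc j) \<and> p (Suc j) - p j < d) \<longrightarrow>
          norm ((\<Sum>j<n. (W (p (Suc j)) \<omega> - W (p j) \<omega>) *\<^sub>R g (\<xi> j)) - X \<omega>) < e"
        unfolding has_RS_integral_def by blast
      from this[rule_format, of 0 "\<lambda>_. a"] True show ?thesis
        by (simp add: subdivision_def)
    qed
    then show ?case by (metis less_irrefl norm_eq_zero norm_ge_zero order_le_less)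
  qed
  then have lim: "AE \<omega> in P. (\<lambda>m::nat. elementary \<omega> []) \<longlonglongrightarrow> X \<omega>"
    by eventually_elim (simp add: step_integral_def)
  have "AE u in lborel. G u = 0"
    using AE_lborel_singleton[of a] by eventually_elim (simp add: G True)
  then have "energy (\<lambda>u. G u - step_fun [] u) \<le> fbm_energy H (\<lambda>_. 0)"
    by (intro fbm_energy_mono) (auto simp: step_fun_def elim: AE_mp)
  then have "(\<lambda>m::nat. energy (\<lambda>u. G u - step_fun [] u)) \<longlonglongrightarrow> 0"
    by (simp add: fbm_energy_zero)
  from wiener_limit_if_AE_limit[OF _ _ _ this lim] show ?thesis
    by (simp add: ordered_steps_def)
next
  case False
  with \<open>a \<le> b\<close> have "a < b" by simp
  have "M \<ge> 0" using order_trans[OF norm_ge_zero bound] .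
  let ?p = "uniform_point a b"
  define good where "good m n \<xi> \<longleftrightarrow> n > m \<and> (\<forall>j<n. \<xi> j \<in> {?p n j..?p n (Suc j)}) \<and>
      (\<integral>\<^sup>+u\<in>{a..b}. ennreal (norm (G u - step_fun (riemann_steps G (?p n) n \<xi>) u)) \<partial>lborel)
        \<le> ennreal (1 / real (Suc m))" for m n \<xi>
  have "\<forall>m. \<exists>n \<xi>. good m n \<xi>"
  proof
    fix m :: nat
    have "1 / real (Suc m) > 0" by simp
    from riemann_steps_L1_approx[OF assms(3) bound \<open>a < b\<close> this] obtain N where
      "\<forall>n\<ge>N. \<exists>\<xi>. (\<forall>j<n. \<xi> j \<in> {?p n j..?p n (Suc j)}) \<and>
        (\<integral>\<^sup>+u\<in>{a..b}. ennreal (norm (G u - step_fun (riemann_steps G (?p n) n \<xi>) u)) \<partial>lborel)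
        \<le> ennreal (1 / real (Suc m))" by auto
    then show "\<exists>n \<xi>. good m n \<xi>"
      unfolding good_def by (intro exI[of _ "max N (Suc m)"]) auto
  qed
  then obtain \<nu> \<xi> where "\<And>m. good m (\<nu> m) (\<xi> m)" by metis
  note good = this[unfolded good_def]
  have \<nu>: "\<nu> m > m" for m using good[of m] by blast
  have \<xi>: "\<xi> m j \<in> {?p (\<nu> m) j..?p (\<nu> m) (Suc j)}" if "j < \<nu> m" for m j
    using good[of m] that by blast
  have L1: "(\<integral>\<^sup>+u\<in>{a..b}. ennreal (norm (G u
        - step_fun (riemann_steps G (?p (\<nu> m)) (\<nu> m) (\<xi> m)) u)) \<partial>lborel) \<le> ennreal (1 / real (Suc m))" for m
    using good[of m] by blast
  define xs where "xs m = riemann_steps G (?p (\<nu> m)) (\<nu> m) (\<xi> m)" for m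
  have sub: "subdivision a b (\<nu> m) (?p (\<nu> m))" for m
    using \<nu>[of m] \<open>a \<le> b\<close> by (intro subdivision_uniform) auto
  have step: "step_fun (xs m) u = (\<Sum>j<\<nu> m. indicat_real {?p (\<nu> m) j<..?p (\<nu> m) (Suc j)} u *\<^sub>R G (\<xi> m j))"
    for m u by (simp add: xs_def riemann_steps_def step_fun_map)
  have diff_le: "norm (G u - step_fun (xs m) u) \<le> 2 * M * indicat_real {a..b} u" for m u
  proof (cases "u \<in> {a<..b}")
    case True
    then obtain j where "j < \<nu> m" "u \<in> {?p (\<nu> m) j<..?p (\<nu> m) (Suc j)}"
      using subdivision_covers[OF sub] by blast
    from subdivision_step_eq[OF sub this] have "step_fun (xs m) u = G (\<xi> m j)" by (simp add: step)
    then have "norm (G u - step_fun (xs m) u) \<le> M + M"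
      using norm_triangle_ineq4[of "G u"] bound[of u] bound[of "\<xi> m j"] by (metis add_mono order_trans)
    then show ?thesis using True by simp
  next
    case False
    then have "step_fun (xs m) u = 0" using subdivision_step_outside[OF sub] by (simp add: step)
    then show ?thesis using bound[of u] \<open>M \<ge> 0\<close> G[of u] by (auto split: split_indicator)
  qed
  let ?c = "2 * M * (2 * H * (b - a) powr (2 * H - 1))"
  have energy_le: "energy (\<lambda>u. G u - step_fun (xs m) u)
      \<le> ennreal (?c * (1 / real (Suc m)))" for m
  proof -
    have le: "ennreal (norm (G u - step_fun (xs m) u)) \<le> ennreal (2 * M) * indicator {a..b} u" for u
      using ennreal_leI[OF diff_le[of u m]] \<open>M \<ge> 0\<close> by (simp split: split_indicator_asm split_indicator)
    have "(\<integral>\<^sup>+u. ennreal (norm (G u - step_fun (xs m) u)) \<partial>lborel)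
        = (\<integral>\<^sup>+u\<in>{a..b}. ennreal (norm (G u - step_fun (xs m) u)) \<partial>lborel)"
    proof (rule nn_integral_cong)
      fix u
      show "ennreal (norm (G u - step_fun (xs m) u))
          = ennreal (norm (G u - step_fun (xs m) u)) * indicator {a..b} u"
        using diff_le[of u m] by (cases "u \<in> {a..b}") auto
    qed
    also have "\<dots> \<le> ennreal (1 / real (Suc m))" using L1[of m] by (simp add: xs_def)
    finally have "ennreal ?c * (\<integral>\<^sup>+u. ennreal (norm (G u - step_fun (xs m) u)) \<partial>lborel)
        \<le> ennreal ?c * ennreal (1 / real (Suc m))" by (rule mult_left_mono) simp
    moreover have "energy (\<lambda>u. G u - step_fun (xs m) u)
        \<le> ennreal ?c * (\<integral>\<^sup>+u. ennreal (norm (G u - step_fun (xs m) u)) \<partial>lborel)"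
      using H(1) \<open>a \<le> b\<close> le \<open>M \<ge> 0\<close> by (intro fbm_energy_le_L1) auto
    ultimately show ?thesis
      using H(1) \<open>M \<ge> 0\<close> by (simp add: ennreal_mult'[symmetric] del: of_nat_Suc)
  qed
  have "(\<lambda>m. ennreal (?c * (1 / real (Suc m)))) \<longlonglongrightarrow> ennreal (?c * 0)"
    by (intro tendsto_ennrealI tendsto_intros LIMSEQ_Suc lim_1_over_n)
  then have "(\<lambda>m. ennreal (?c * (1 / real (Suc m)))) \<longlonglongrightarrow> 0" by (simp only: mult_zero_right ennreal_0)
  then have energy: "(\<lambda>m. energy (\<lambda>u. G u - step_fun (xs m) u)) \<longlonglongrightarrow> 0"
  proof (rule tendsto_sandwich[rotated 3])
    show "\<forall>\<^sub>F m in sequentially. energy (\<lambda>u. G u - step_fun (xs m) u)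
        \<le> ennreal (?c * (1 / real (Suc m)))"
      by (intro always_eventually allI energy_le)
    show "\<forall>\<^sub>F m in sequentially. 0 \<le> energy (\<lambda>u. G u - step_fun (xs m) u)"
      by simp
  qed (rule tendsto_const)
  have "AE \<omega> in P. (\<lambda>m. elementary \<omega> (xs m)) \<longlonglongrightarrow> X \<omega>"
    using RS
  proof eventually_elim
    case (elim \<omega>)
    show ?case
    proof (rule metric_LIMSEQ_I)
      fix e :: real assume "e > 0"
      with elim obtain d where "d > 0" and d: "\<And>n p \<xi>. subdivision a b n p \<Longrightarrow>
          (\<forall>j<n. p j \<le> \<xi> j \<and> \<xi> j \<le> p (Suc j) \<and> p (Suc j) - p j < d) \<Longrightarrow>
          norm ((\<Sum>j<n. (W (p (Suc j)) \<omega> - W (p j) \<omega>) *\<^sub>R g (\<xi> j)) - X \<omega>) < e"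
        unfolding has_RS_integral_def by blast
      obtain N where N: "(b - a) / d < real N" using reals_Archimedean2 by blast
      show "\<exists>N. \<forall>m\<ge>N. dist (elementary \<omega> (xs m)) (X \<omega>) < e"
      proof (intro exI[of _ N] allI impI)
        fix m assume "m \<ge> N"
        with \<nu>[of m] have "N < \<nu> m" by simp
        with N have "(b - a) / d < real (\<nu> m)" by simp
        then have mesh: "(b - a) / real (\<nu> m) < d"
          using \<open>d > 0\<close> \<open>N < \<nu> m\<close> by (simp add: field_simps)
        have "?p (\<nu> m) (Suc j) - ?p (\<nu> m) j = (b - a) / real (\<nu> m)" for j
          by (simp add: uniform_point_def distrib_right add_divide_distrib)
        then have "norm ((\<Sum>j<\<nu> m. (W (?p (\<nu> m) (Suc j)) \<omega> - W (?p (\<nu> m) j) \<omega>) *\<^sub>R g (\<xi> m j)) - X \<omega>) < e"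
          using mesh \<xi>[of _ m] by (intro d sub) auto
        moreover have "G (\<xi> m j) = g (\<xi> m j)" if "j < \<nu> m" for j
        proof -
          have "\<xi> m j \<in> {a..b}"
            using \<xi>[OF that] subdivision_mono[OF sub[of m], of 0 j] that
              subdivision_mono[OF sub[of m], of "Suc j" "\<nu> m"] sub[of m]
            by (auto simp: subdivision_def)
          then show ?thesis by (simp add: G)
        qed
        then have "elementary \<omega> (xs m)
            = (\<Sum>j<\<nu> m. (W (?p (\<nu> m) (Suc j)) \<omega> - W (?p (\<nu> m) j) \<omega>) *\<^sub>R g (\<xi> m j))"
          unfolding xs_def riemann_steps_def step_integral_map by (intro sum.cong) auto
        ultimately show "dist (elementary \<omega> (xs m)) (X \<omega>) < e"
          by (simp only: dist_norm)
      qed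
    qed
  qed
  moreover have "ordered_steps (xs m)" for m
    using sub[of m] by (auto simp: xs_def riemann_steps_def ordered_steps_def subdivision_def)
  ultimately show ?thesis
    using energy by (intro wiener_limit_if_AE_limit) auto
qed

lemma wiener_limit_if_is_fbm_integral:
  fixes g G :: "real \<Rightarrow> 'v::euclidean_space"
  assumes "is_fbm_integral P H W g a b X" "G \<in> borel_measurable borel"
    and "\<And>u. G u = indicat_real {a..b} u *\<^sub>R g u" "\<And>u. norm (G u) \<le> M" "a \<le> b"
  shows "wiener_limit G X"
proof -
  have X: "X \<in> borel_measurable P" using assms(1) by (simp add: is_fbm_integral_def)
  from assms(1) consider "AE \<omega> in P. has_RS_integral g (\<lambda>t. W t \<omega>) a b (X \<omega>)"
    | "has_wiener_integral P H W g a b X"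
    unfolding is_fbm_integral_def by (elim conjE disjE)
  then show ?thesis
  proof cases
    case 1
    then show ?thesis using X assms(2-5) by (rule wiener_limit_if_has_RS_integral)
  next
    case 2
    then show ?thesis using X assms(2,3) by (rule wiener_limit_if_has_wiener_integral)
  qed
qed

lemma wiener_limit_L2_le_interval:
  assumes "wiener_limit G X" "\<And>u. norm (G u) \<le> M * indicat_real {a..b} u" "a \<le> b"
  shows "norm_mean_sq P X \<le> ennreal (4 * M\<^sup>2 * (b - a) powr (2 * H))"
proof -
  have "M \<ge> 0" using order_trans[OF norm_ge_zero assms(2)[of a]] assms(3) by simp
  have "ennreal (norm (G u)) \<le> ennreal M * indicator {a..b} u" for u
    using ennreal_leI[OF assms(2)[of u]] by (simp split: split_indicator_asm split_indicator)
  then have "energy G \<le> ennreal (M\<^sup>2 * (b - a) powr (2 * H))"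
    using H(1) assms(3) \<open>M \<ge> 0\<close> by (intro fbm_energy_indicator_le) auto
  then have "4 * energy G \<le> 4 * ennreal (M\<^sup>2 * (b - a) powr (2 * H))"
    by (rule mult_left_mono) simp
  also have "\<dots> = ennreal (4 * M\<^sup>2 * (b - a) powr (2 * H))"
    by (simp add: ennreal_mult' mult.assoc)
  finally show ?thesis using wiener_limit_L2_le[OF assms(1)] by (rule order_trans[rotated])
qed

end

section \<open>Time integrals and a Gronwall inequality\<close>

text \<open>
  Cauchy-Schwarz in time for each path, then Tonelli.
\<close>
lemma nn_integral_square_time_integral_le:
  fixes g :: "real \<Rightarrow> 'w \<Rightarrow> ennreal"
  assumes "sigma_finite_measure P"
    and meas: "(\<lambda>z. g (fst z) (snd z)) \<in> borel_measurable (borel \<Otimes>\<^sub>M P)"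
    and bound: "\<And>s. s \<in> {a..b} \<Longrightarrow> mean_sq P (\<lambda>\<omega>. g s \<omega>) \<le> B" and "a \<le> b"
  shows "mean_sq P (\<lambda>\<omega>. \<integral>\<^sup>+s\<in>{a..b}. g s \<omega> \<partial>lborel) \<le> ennreal ((b - a)\<^sup>2) * B"
proof -
  interpret P: sigma_finite_measure P by fact
  interpret pair_sigma_finite lborel P ..
  have [measurable (raw)]: "(\<lambda>x. g (h x) (k x)) \<in> borel_measurable N"
    if "h \<in> borel_measurable N" "k \<in> N \<rightarrow>\<^sub>M P" for h k and N :: "'b measure"
    using measurable_compose[OF measurable_Pair[OF that] assms(2)] by simp
  have "(\<integral>\<^sup>+s\<in>{a..b}. g s \<omega> \<partial>lborel)\<^sup>2 \<le> (\<integral>\<^sup>+s\<in>{a..b}. (g s \<omega>)\<^sup>2 \<partial>lborel) * ennreal (b - a)"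
    if "\<omega> \<in> space P" for \<omega>
  proof -
    have [measurable]: "(\<lambda>s. g s \<omega>) \<in> borel_measurable borel" using that by measurable
    have "(\<integral>\<^sup>+s\<in>{a..b}. g s \<omega> \<partial>lborel)
        = (\<integral>\<^sup>+s. (g s \<omega> * indicator {a..b} s) * indicator {a..b} s \<partial>lborel)"
      by (intro nn_integral_cong) (simp split: split_indicator)
    also have "\<dots>\<^sup>2 \<le> (\<integral>\<^sup>+s. (g s \<omega> * indicator {a..b} s)\<^sup>2 \<partial>lborel)
        * (\<integral>\<^sup>+s. (indicator {a..b} s)\<^sup>2 \<partial>lborel)"
      by (rule Cauchy_Schwarz_nn_integral) measurable
    also have "(\<integral>\<^sup>+s. (g s \<omega> * indicator {a..b} s)\<^sup>2 \<partial>lborel) = (\<integral>\<^sup>+s\<in>{a..b}. (g s \<omega>)\<^sup>2 \<partial>lborel)"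
      by (intro nn_integral_cong) (simp split: split_indicator)
    also have "(\<integral>\<^sup>+s. (indicator {a..b} s)\<^sup>2 \<partial>lborel) = (\<integral>\<^sup>+s. indicator {a..b} s \<partial>lborel)"
      by (intro nn_integral_cong) (simp split: split_indicator)
    also have "\<dots> = ennreal (b - a)" using \<open>a \<le> b\<close> by simp
    finally show ?thesis .
  qed
  then have "mean_sq P (\<lambda>\<omega>. \<integral>\<^sup>+s\<in>{a..b}. g s \<omega> \<partial>lborel)
      \<le> (\<integral>\<^sup>+\<omega>. (\<integral>\<^sup>+s\<in>{a..b}. (g s \<omega>)\<^sup>2 \<partial>lborel) * ennreal (b - a) \<partial>P)"
    by (intro nn_integral_mono)
  also have "\<dots> = (\<integral>\<^sup>+\<omega>. (\<integral>\<^sup>+s\<in>{a..b}. (g s \<omega>)\<^sup>2 \<partial>lborel) \<partial>P) * ennreal (b - a)"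
    by (intro nn_integral_multc) measurable
  also have "(\<integral>\<^sup>+\<omega>. (\<integral>\<^sup>+s\<in>{a..b}. (g s \<omega>)\<^sup>2 \<partial>lborel) \<partial>P)
      = (\<integral>\<^sup>+s. \<integral>\<^sup>+\<omega>. (g s \<omega>)\<^sup>2 * indicator {a..b} s \<partial>P \<partial>lborel)"
    by (intro Fubini') (simp add: split_beta')
  also have "\<dots> \<le> (\<integral>\<^sup>+s. B * indicator {a..b} s \<partial>lborel)"
    using bound by (intro nn_integral_mono) (auto split: split_indicator)
  also have "\<dots> = B * ennreal (b - a)"
    using \<open>a \<le> b\<close> by (simp add: nn_integral_cmult_indicator)
  finally have "mean_sq P (\<lambda>\<omega>. \<integral>\<^sup>+s\<in>{a..b}. g s \<omega> \<partial>lborel) \<le> B * ennreal (b - a) * ennreal (b - a)"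
    by (simp add: mult_right_mono)
  then show ?thesis
    using \<open>a \<le> b\<close> by (simp add: power2_eq_square ennreal_mult mult_ac)
qed

lemma nn_integral_exp_weight:
  assumes "l > 0"
  shows "(\<integral>\<^sup>+s\<in>{\<tau>..}. ennreal (exp (- l * (s - t0))) \<partial>lborel) = ennreal (exp (- l * (\<tau> - t0)) / l)"
proof -
  have "((\<lambda>s. exp (- l * (s - t0))) \<longlongrightarrow> 0) at_top"
  proof (rule filterlim_compose[OF exp_at_bot])
    have "filterlim (\<lambda>s. s - t0) at_top at_top"
      using filterlim_tendsto_add_at_top[OF tendsto_const filterlim_ident, of "- t0"] by (simp add: algebra_simps)
    then show "filterlim (\<lambda>s. - l * (s - t0)) at_bot at_top"
      using assms by (intro filterlim_tendsto_neg_mult_at_bot[OF tendsto_const]) auto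
  qed
  then have lim: "((\<lambda>s. - exp (- l * (s - t0)) / l) \<longlongrightarrow> - 0 / l) at_top"
    by (intro tendsto_intros) (use assms in auto)
  have "(\<integral>\<^sup>+s. ennreal (exp (- l * (s - t0))) * indicator {\<tau>..} s \<partial>lborel)
      = ennreal (- 0 / l - (- exp (- l * (\<tau> - t0)) / l))"
    using assms
    by (intro nn_integral_FTC_atLeast[OF _ _ _ lim]) (auto intro!: derivative_eq_intros)
  then show ?thesis by simp
qed

text \<open>
  In the norm with weight \<open>exp (- 2 * k * (s - t0))\<close> the integral operator is a contraction with
  factor one half, so its contribution can be absorbed on the left. The absorption requires the
  integral of \<open>y\<close> to be finite.
\<close>
lemma weighted_gronwall:
  fixes y \<psi> :: "real \<Rightarrow> ennreal"
  assumes [measurable]: "y \<in> borel_measurable borel" "\<psi> \<in> borel_measurable borel"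
    and le: "\<And>s. s \<in> {t0..T} \<Longrightarrow> y s \<le> \<psi> s + ennreal k * (\<integral>\<^sup>+\<tau>\<in>{t0..s}. y \<tau> \<partial>lborel)"
    and finite: "(\<integral>\<^sup>+s\<in>{t0..T}. y s \<partial>lborel) < \<infinity>" and "k > 0" "t0 \<le> T"
  shows "(\<integral>\<^sup>+s\<in>{t0..T}. y s \<partial>lborel)
    \<le> ennreal (2 * exp (2 * k * (T - t0))) * (\<integral>\<^sup>+s\<in>{t0..T}. \<psi> s \<partial>lborel)"
proof -
  define w where "w s = ennreal (exp (- (2 * k) * (s - t0)))" for s
  have [measurable]: "w \<in> borel_measurable borel" unfolding w_def[abs_def] by measurable
  have w_le: "w s \<le> 1" if "t0 \<le> s" for s
    using that \<open>k > 0\<close> by (simp add: w_def)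
  let ?Z = "\<integral>\<^sup>+s\<in>{t0..T}. w s * y s \<partial>lborel"
  let ?Y = "\<integral>\<^sup>+s\<in>{t0..T}. y s \<partial>lborel"
  let ?\<Psi> = "\<integral>\<^sup>+s\<in>{t0..T}. \<psi> s \<partial>lborel"
  have "?Z \<le> ?Y"
    using mult_right_mono[OF w_le] by (intro nn_integral_mono) (auto split: split_indicator)
  with finite have "?Z < \<top>" by (simp add: le_less_trans)
  have swap: "(\<integral>\<^sup>+s\<in>{t0..T}. w s * (\<integral>\<^sup>+\<tau>\<in>{t0..s}. y \<tau> \<partial>lborel) \<partial>lborel) \<le> ?Z * ennreal (1 / (2 * k))"
  proof -
    \<comment> \<open>The constraint \<open>\<tau> \<le> s\<close> is written as \<open>s - \<tau> \<in> {0..}\<close> to be jointly measurable.\<close>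
    let ?h = "\<lambda>\<tau> s. y \<tau> * indicator {t0..T} \<tau> * (w s * indicator {t0..T} s * indicator {0..} (s - \<tau>))"
    have "(\<integral>\<^sup>+s\<in>{t0..T}. w s * (\<integral>\<^sup>+\<tau>\<in>{t0..s}. y \<tau> \<partial>lborel) \<partial>lborel)
        = (\<integral>\<^sup>+s. \<integral>\<^sup>+\<tau>. ?h \<tau> s \<partial>lborel \<partial>lborel)"
    proof (rule nn_integral_cong)
      fix s
      have "w s * (\<integral>\<^sup>+\<tau>\<in>{t0..s}. y \<tau> \<partial>lborel) * indicator {t0..T} s
          = (\<integral>\<^sup>+\<tau>. (w s * indicator {t0..T} s) * (y \<tau> * indicator {t0..s} \<tau>) \<partial>lborel)"
        by (subst nn_integral_cmult) (auto simp: mult_ac)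
      also have "\<dots> = (\<integral>\<^sup>+\<tau>. ?h \<tau> s \<partial>lborel)"
        by (intro nn_integral_cong) (auto simp: mult_ac split: split_indicator)
      finally show "w s * (\<integral>\<^sup>+\<tau>\<in>{t0..s}. y \<tau> \<partial>lborel) * indicator {t0..T} s = (\<integral>\<^sup>+\<tau>. ?h \<tau> s \<partial>lborel)" .
    qed
    also have "\<dots> = (\<integral>\<^sup>+\<tau>. \<integral>\<^sup>+s. ?h \<tau> s \<partial>lborel \<partial>lborel)"
      by (intro lborel_pair.Fubini') measurable
    also have "\<dots> \<le> (\<integral>\<^sup>+\<tau>. (w \<tau> * y \<tau> * indicator {t0..T} \<tau>) * ennreal (1 / (2 * k)) \<partial>lborel)"
    proof (rule nn_integral_mono)
      fix \<tau>
      have "(\<integral>\<^sup>+s. ?h \<tau> s \<partial>lborel) \<le> (\<integral>\<^sup>+s. y \<tau> * indicator {t0..T} \<tau> * (w s * indicator {\<tau>..} s) \<partial>lborel)"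
        by (intro nn_integral_mono mult_left_mono) (auto split: split_indicator)
      also have "\<dots> = y \<tau> * indicator {t0..T} \<tau> * ennreal (exp (- (2 * k) * (\<tau> - t0)) / (2 * k))"
        using nn_integral_exp_weight[where l="2 * k" and \<tau>=\<tau> and ?t0.0=t0] \<open>k > 0\<close>
        by (subst nn_integral_cmult) (auto simp: w_def)
      also have "ennreal (exp (- (2 * k) * (\<tau> - t0)) / (2 * k)) = w \<tau> * ennreal (1 / (2 * k))"
        using \<open>k > 0\<close> by (simp add: w_def ennreal_mult[symmetric])
      finally show "(\<integral>\<^sup>+s. ?h \<tau> s \<partial>lborel)
          \<le> (w \<tau> * y \<tau> * indicator {t0..T} \<tau>) * ennreal (1 / (2 * k))" by (simp add: mult_ac)
    qed
    also have "\<dots> = ?Z * ennreal (1 / (2 * k))" by (rule nn_integral_multc) measurable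
    finally show ?thesis .
  qed
  have Y_meas: "(\<lambda>s. \<integral>\<^sup>+\<tau>\<in>{t0..s}. y \<tau> \<partial>lborel) \<in> borel_measurable borel"
  proof -
    have "(\<lambda>s. \<integral>\<^sup>+\<tau>. y \<tau> * indicator {t0..} \<tau> * indicator {0..} (s - \<tau>) \<partial>lborel) \<in> borel_measurable borel"
      by measurable
    also have "(\<lambda>s. \<integral>\<^sup>+\<tau>. y \<tau> * indicator {t0..} \<tau> * indicator {0..} (s - \<tau>) \<partial>lborel)
        = (\<lambda>s. \<integral>\<^sup>+\<tau>\<in>{t0..s}. y \<tau> \<partial>lborel)"
      by (intro ext nn_integral_cong) (auto split: split_indicator)
    finally show ?thesis .
  qed
  note [measurable] = Y_meas
  have "?Z \<le> (\<integral>\<^sup>+s. \<psi> s * indicator {t0..T} s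
      + ennreal k * (w s * (\<integral>\<^sup>+\<tau>\<in>{t0..s}. y \<tau> \<partial>lborel) * indicator {t0..T} s) \<partial>lborel)"
  proof (rule nn_integral_mono)
    fix s
    show "w s * y s * indicator {t0..T} s \<le> \<psi> s * indicator {t0..T} s
        + ennreal k * (w s * (\<integral>\<^sup>+\<tau>\<in>{t0..s}. y \<tau> \<partial>lborel) * indicator {t0..T} s)"
    proof (cases "s \<in> {t0..T}")
      case True
      have "w s * y s \<le> w s * (\<psi> s + ennreal k * (\<integral>\<^sup>+\<tau>\<in>{t0..s}. y \<tau> \<partial>lborel))"
        by (intro mult_left_mono le True) simp
      also have "\<dots> = w s * \<psi> s + ennreal k * (w s * (\<integral>\<^sup>+\<tau>\<in>{t0..s}. y \<tau> \<partial>lborel))"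
        by (simp add: distrib_left mult_ac)
      also have "\<dots> \<le> \<psi> s + ennreal k * (w s * (\<integral>\<^sup>+\<tau>\<in>{t0..s}. y \<tau> \<partial>lborel))"
        using mult_right_mono[OF w_le, of s "\<psi> s"] True by (intro add_right_mono) auto
      finally show ?thesis using True by simp
    qed simp
  qed
  also have "\<dots> = ?\<Psi> + ennreal k * (\<integral>\<^sup>+s\<in>{t0..T}. w s * (\<integral>\<^sup>+\<tau>\<in>{t0..s}. y \<tau> \<partial>lborel) \<partial>lborel)"
    by (subst nn_integral_add, measurable, subst nn_integral_cmult) auto
  also have "\<dots> \<le> ?\<Psi> + ennreal k * (?Z * ennreal (1 / (2 * k)))"
    by (intro add_left_mono mult_left_mono swap) simp
  also have "ennreal k * (?Z * ennreal (1 / (2 * k))) = ?Z * ennreal (1 / 2)"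
  proof -
    have "ennreal k * ennreal (1 / (2 * k)) = ennreal (1 / 2)"
      using \<open>k > 0\<close> by (simp add: ennreal_mult[symmetric])
    then show ?thesis by (subst mult.left_commute) simp
  qed
  finally have half: "?Z \<le> ?\<Psi> + ?Z * ennreal (1 / 2)" .
  have Z: "?Z \<le> 2 * ?\<Psi>"
  proof (cases "?\<Psi> = \<top>")
    case True
    then show ?thesis by (simp add: ennreal_mult_top)
  next
    case False
    obtain p where p: "?\<Psi> = ennreal p" "p \<ge> 0"
      by (rule ennreal_cases[of ?\<Psi>]) (use False in auto)
    obtain z where z: "?Z = ennreal z" "z \<ge> 0"
      by (rule ennreal_cases[of ?Z]) (use \<open>?Z < \<top>\<close> in auto)
    note pz = p(1) z(1) p(2) z(2)
    have "ennreal p + ennreal z * ennreal (1 / 2) = ennreal (p + z * (1 / 2))"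
      using pz(3,4) by (subst ennreal_plus, simp, simp, subst ennreal_mult, auto)
    with half have "ennreal z \<le> ennreal (p + z * (1 / 2))" unfolding pz by simp
    then have "z \<le> 2 * p" using pz(3,4) by (subst (asm) ennreal_le_iff) auto
    then have "ennreal z \<le> ennreal (2 * p)" by (rule ennreal_leI)
    also have "ennreal (2 * p) = 2 * ennreal p" by (simp add: ennreal_mult')
    finally show ?thesis unfolding pz .
  qed
  have "?Y \<le> (\<integral>\<^sup>+s. ennreal (exp (2 * k * (T - t0))) * (w s * y s * indicator {t0..T} s) \<partial>lborel)"
  proof (rule nn_integral_mono)
    fix s
    show "y s * indicator {t0..T} s
        \<le> ennreal (exp (2 * k * (T - t0))) * (w s * y s * indicator {t0..T} s)"
    proof (cases "s \<in> {t0..T}")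
      case True
      have "2 * k * (s - t0) \<le> 2 * k * (T - t0)" using True \<open>k > 0\<close> by simp
      then have "ennreal 1 \<le> ennreal (exp (2 * k * (T - t0)) * exp (- (2 * k) * (s - t0)))"
        by (intro ennreal_leI) (simp flip: exp_add)
      then have "1 \<le> ennreal (exp (2 * k * (T - t0))) * w s"
        by (simp add: w_def ennreal_mult)
      from mult_right_mono[OF this, of "y s"] True show ?thesis by (simp add: mult.assoc)
    qed simp
  qed
  also have "\<dots> = ennreal (exp (2 * k * (T - t0))) * ?Z" by (rule nn_integral_cmult) measurable
  also have "\<dots> \<le> ennreal (exp (2 * k * (T - t0))) * (2 * ?\<Psi>)" by (intro mult_left_mono Z) simp
  also have "\<dots> = ennreal (2 * exp (2 * k * (T - t0))) * ?\<Psi>"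
    by (simp add: ennreal_mult' mult_ac)
  finally show ?thesis .
qed

section \<open>Moments and regularity of mild solutions\<close>

lemma nn_integral_square_sum3_le:
  fixes X Y1 Y2 Y3 :: "'w \<Rightarrow> ennreal"
  assumes [measurable]: "Y1 \<in> borel_measurable P" "Y2 \<in> borel_measurable P" "Y3 \<in> borel_measurable P"
    and le: "AE \<omega> in P. X \<omega> \<le> Y1 \<omega> + Y2 \<omega> + Y3 \<omega>"
    and "mean_sq P Y1 \<le> ennreal B1" "mean_sq P Y2 \<le> ennreal B2"
      "mean_sq P Y3 \<le> ennreal B3"
    and "B1 \<ge> 0" "B2 \<ge> 0" "B3 \<ge> 0"
  shows "mean_sq P X \<le> ennreal (4 * (B1 + B2 + B3))"
proof -
  have sq: "(a + b + c)\<^sup>2 \<le> 4 * a\<^sup>2 + 4 * b\<^sup>2 + 4 * (c::ennreal)\<^sup>2" for a b c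
  proof -
    have "(a + b + c)\<^sup>2 \<le> 2 * (a + b)\<^sup>2 + 2 * c\<^sup>2" by (rule ennreal_square_add_le)
    also have "\<dots> \<le> 2 * (2 * a\<^sup>2 + 2 * b\<^sup>2) + 4 * c\<^sup>2"
      by (intro add_mono mult_left_mono ennreal_square_add_le mult_right_mono) auto
    also have "\<dots> = (2 * 2) * a\<^sup>2 + (2 * 2) * b\<^sup>2 + 4 * c\<^sup>2"
      by (simp only: distrib_left mult.assoc)
    finally show ?thesis by simp
  qed
  have "mean_sq P X \<le> (\<integral>\<^sup>+\<omega>. 4 * (Y1 \<omega>)\<^sup>2 + 4 * (Y2 \<omega>)\<^sup>2 + 4 * (Y3 \<omega>)\<^sup>2 \<partial>P)"
  proof (rule nn_integral_mono_AE)
    show "AE \<omega> in P. (X \<omega>)\<^sup>2 \<le> 4 * (Y1 \<omega>)\<^sup>2 + 4 * (Y2 \<omega>)\<^sup>2 + 4 * (Y3 \<omega>)\<^sup>2"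
      using le by eventually_elim (rule order_trans[OF power_mono sq], auto)
  qed
  also have "\<dots> = 4 * mean_sq P Y1 + 4 * mean_sq P Y2 + 4 * mean_sq P Y3"
    by (simp add: nn_integral_add nn_integral_cmult)
  also have "\<dots> \<le> 4 * ennreal B1 + 4 * ennreal B2 + 4 * ennreal B3"
    using assms(5-7) by (intro add_mono mult_left_mono) auto
  also have "\<dots> = ennreal (4 * (B1 + B2 + B3))"
    using assms(8-10) by (simp add: ennreal_mult' distrib_left)
  finally show ?thesis .
qed

lemma nn_integral_square_cmult_le:
  assumes [measurable]: "Y \<in> borel_measurable P" and "mean_sq P Y \<le> ennreal B" "k \<ge> 0"
  shows "mean_sq P (\<lambda>\<omega>. ennreal k * Y \<omega>) \<le> ennreal (k\<^sup>2 * B)"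
proof -
  have "mean_sq P (\<lambda>\<omega>. ennreal k * Y \<omega>) = (ennreal k)\<^sup>2 * mean_sq P Y"
    by (simp add: power_mult_distrib nn_integral_cmult)
  also have "\<dots> \<le> (ennreal k)\<^sup>2 * ennreal B" using assms(2) by (rule mult_left_mono) simp
  also have "\<dots> = ennreal (k\<^sup>2 * B)" using assms(3) by (simp add: ennreal_power ennreal_mult')
  finally show ?thesis .
qed

lemma square_le_powr:
  fixes x R H :: real
  assumes "0 \<le> x" "x \<le> R" "H < 1"
  shows "x\<^sup>2 \<le> R powr (2 - 2 * H) * x powr (2 * H)"
proof (cases "x = 0")
  case False
  with assms(1) have "x > 0" by (simp add: less_le)
  have "x\<^sup>2 = x powr (2 - 2 * H) * x powr (2 * H)"
    using \<open>x > 0\<close> by (simp add: powr_add[symmetric] powr_numeral)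
  also have "\<dots> \<le> R powr (2 - 2 * H) * x powr (2 * H)"
    using assms by (intro mult_right_mono powr_mono2) auto
  finally show ?thesis .
qed simp

lemma norm_triangle3: "norm (x + y + z) \<le> norm x + norm y + norm z"
  by (intro norm_triangle_le add_right_mono norm_triangle_ineq)

lemma set_integral_norm_bound_ennreal:
  fixes g :: "real \<Rightarrow> 'v::{banach, second_countable_topology}"
  assumes "set_integrable lborel S g"
  shows "ennreal (norm (LINT s:S|lborel. g s)) \<le> (\<integral>\<^sup>+s\<in>S. ennreal (norm (g s)) \<partial>lborel)"
proof -
  have "ennreal (norm (LINT s:S|lborel. g s)) \<le> (\<integral>\<^sup>+s. ennreal (norm (indicator S s *\<^sub>R g s)) \<partial>lborel)"
    unfolding set_lebesgue_integral_def
    using assms by (intro integral_norm_bound_ennreal) (simp add: set_integrable_def)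
  also have "\<dots> = (\<integral>\<^sup>+s\<in>S. ennreal (norm (g s)) \<partial>lborel)"
    by (intro nn_integral_cong) (simp split: split_indicator)
  finally show ?thesis .
qed

text \<open>
  A solution of the integral equation with the stochastic convolution abstracted to a process \<open>N\<close>.
  The second-moment bound on \<open>N t - flow A (t - r) (N r\<close>), the noise gathered
  between \<open>r\<close> and \<open>t\<close>, is all that the error analysis uses of the driving processes.
  The constant \<open>c\<close> bounds the matrix exponential on the time interval.
\<close>
locale mild_solution = prob_space P for P :: "'w measure" +
  fixes t0 T H D K c m0 Cn :: real and A :: "real^'n^'n"
    and f :: "real \<Rightarrow> real^'n \<Rightarrow> real^'n" and u0 :: "'w \<Rightarrow> real^'n"
    and U N :: "real \<Rightarrow> 'w \<Rightarrow> real^'n"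
  assumes t0_less_T: "t0 < T" and H: "1 / 2 < H" "H < 1"
    and pos: "D > 0" "K > 0" "c \<ge> 1" "m0 \<ge> 0" "Cn \<ge> 0"
    and A_invertible: "invertible A"
    and flow_le: "\<And>s x. 0 \<le> s \<Longrightarrow> s \<le> T - t0 \<Longrightarrow> norm (flow A s x) \<le> c * norm x"
    and flow_diff_le: "\<And>s x. 0 \<le> s \<Longrightarrow> s \<le> T - t0 \<Longrightarrow> norm (flow A s x - x) \<le> c * s * norm x"
    and f_measurable: "(\<lambda>z. f (fst z) (snd z)) \<in> borel_measurable (borel \<Otimes>\<^sub>M borel)"
    and f_growth: "\<And>s x. norm (f s x) \<le> D * (1 + norm x)"
    and f_lipschitz: "\<And>s r x y. norm (f s x - f r y) \<le> K * (\<bar>s - r\<bar> + norm (x - y))"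
    and U_measurable: "(\<lambda>z. U (fst z) (snd z)) \<in> borel_measurable (borel \<Otimes>\<^sub>M P)"
    and u0_measurable [measurable]: "u0 \<in> borel_measurable P"
    and u0_L2: "mean_sq P (\<lambda>\<omega>. ennreal (norm (u0 \<omega>))) \<le> ennreal m0"
    and N_measurable [measurable]: "\<And>t. N t \<in> borel_measurable P"
    and N_start: "AE \<omega> in P. N t0 \<omega> = 0"
    and N_L2: "\<And>t. t \<in> {t0..T} \<Longrightarrow> mean_sq P (\<lambda>\<omega>. ennreal (norm (N t \<omega>))) \<le> ennreal Cn"
    and N_increment: "\<And>r t. t0 \<le> r \<Longrightarrow> r \<le> t \<Longrightarrow> t \<le> T \<Longrightarrow>
      mean_sq P (\<lambda>\<omega>. ennreal (norm (N t \<omega> - flow A (t - r) (N r \<omega>))))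
        \<le> ennreal (Cn * (t - r) powr (2 * H))"
    and mild: "\<And>t. t \<in> {t0..T} \<Longrightarrow> AE \<omega> in P.
      set_integrable lborel {t0..t} (\<lambda>s. flow A (t - s) (f s (U s \<omega>))) \<and>
      U t \<omega> = flow A (t - t0) (u0 \<omega>)
        + (LINT s:{t0..t}|lborel. flow A (t - s) (f s (U s \<omega>))) + N t \<omega>"
begin

lemma U_compose [measurable (raw)]:
  assumes "g \<in> borel_measurable M" "h \<in> M \<rightarrow>\<^sub>M P"
  shows "(\<lambda>x. U (g x) (h x)) \<in> borel_measurable M"
  using measurable_compose[OF measurable_Pair[OF assms] U_measurable] by simp

lemma f_compose [measurable (raw)]:
  assumes "g \<in> borel_measurable M" "h \<in> borel_measurable M"
  shows "(\<lambda>x. f (g x) (h x)) \<in> borel_measurable M"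
  using measurable_compose[OF measurable_Pair[OF assms] f_measurable] by simp

lemma mat_exp_vector_measurable [measurable (raw)]:
  assumes "h \<in> borel_measurable M"
  shows "(\<lambda>x. flow A s (h x)) \<in> borel_measurable M"
  by (rule measurable_compose[OF assms borel_measurable_continuous_onI])
     (intro linear_continuous_on matrix_vector_mul_bounded_linear)

abbreviation drift :: "real \<Rightarrow> 'w \<Rightarrow> ennreal" where
  "drift s \<omega> \<equiv> ennreal (norm (f s (U s \<omega>)))"

definition cumulated_drift :: "real \<Rightarrow> 'w \<Rightarrow> ennreal" where
  "cumulated_drift t \<omega> = (\<integral>\<^sup>+s\<in>{t0..t}. drift s \<omega> \<partial>lborel)"

lemma cumulated_drift_compose [measurable (raw)]:
  assumes [measurable]: "g \<in> borel_measurable M" "h \<in> M \<rightarrow>\<^sub>M P"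
  shows "(\<lambda>x. cumulated_drift (g x) (h x)) \<in> borel_measurable M"
proof -
  have "(\<lambda>x. \<integral>\<^sup>+s. drift s (h x) * indicator {t0..} s * indicator {0..} (g x - s) \<partial>lborel)
      \<in> borel_measurable M"
    by measurable
  also have "(\<lambda>x. \<integral>\<^sup>+s. drift s (h x) * indicator {t0..} s * indicator {0..} (g x - s) \<partial>lborel)
      = (\<lambda>x. cumulated_drift (g x) (h x))"
    unfolding cumulated_drift_def
    by (intro ext nn_integral_cong) (auto split: split_indicator)
  finally show ?thesis .
qed

lemma flow_integral_le:
  assumes "set_integrable lborel {r..t} (\<lambda>s. flow A (t - s) (g s))" "t0 \<le> r" "t \<le> T"
    and [measurable]: "g \<in> borel_measurable borel"
  shows "ennreal (norm (LINT s:{r..t}|lborel. flow A (t - s) (g s)))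
    \<le> ennreal c * (\<integral>\<^sup>+s\<in>{r..t}. ennreal (norm (g s)) \<partial>lborel)"
proof -
  have "ennreal (norm (LINT s:{r..t}|lborel. flow A (t - s) (g s)))
      \<le> (\<integral>\<^sup>+s\<in>{r..t}. ennreal (norm (flow A (t - s) (g s))) \<partial>lborel)"
    by (rule set_integral_norm_bound_ennreal) fact
  also have "\<dots> \<le> (\<integral>\<^sup>+s. ennreal c * (ennreal (norm (g s)) * indicator {r..t} s) \<partial>lborel)"
  proof (rule nn_integral_mono)
    fix s
    show "ennreal (norm (flow A (t - s) (g s))) * indicator {r..t} s
        \<le> ennreal c * (ennreal (norm (g s)) * indicator {r..t} s)"
    proof (cases "s \<in> {r..t}")
      case True
      then have "norm (flow A (t - s) (g s)) \<le> c * norm (g s)"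
        using assms(2,3) by (intro flow_le) auto
      then show ?thesis using True pos(3) by (simp add: ennreal_mult[symmetric] ennreal_leI)
    qed simp
  qed
  also have "\<dots> = ennreal c * (\<integral>\<^sup>+s\<in>{r..t}. ennreal (norm (g s)) \<partial>lborel)"
    by (rule nn_integral_cmult) measurable
  finally show ?thesis .
qed

lemma drift_measurable_path:
  "\<omega> \<in> space P \<Longrightarrow> (\<lambda>s. f s (U s \<omega>)) \<in> borel_measurable borel"
  by measurable

lemma norm_U_le:
  assumes "t \<in> {t0..T}"
  shows "AE \<omega> in P. ennreal (norm (U t \<omega>))
    \<le> ennreal c * ennreal (norm (u0 \<omega>)) + ennreal c * cumulated_drift t \<omega> + ennreal (norm (N t \<omega>))"
  using mild[OF assms] AE_space
proof eventually_elim
  case (elim \<omega>)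
  let ?I = "LINT s:{t0..t}|lborel. flow A (t - s) (f s (U s \<omega>))"
  have "norm (U t \<omega>) \<le> norm (flow A (t - t0) (u0 \<omega>)) + norm ?I + norm (N t \<omega>)"
    unfolding elim(1)[THEN conjunct2] by (rule norm_triangle3)
  also have "norm (flow A (t - t0) (u0 \<omega>)) \<le> c * norm (u0 \<omega>)"
    using assms by (intro flow_le) auto
  finally have "ennreal (norm (U t \<omega>)) \<le> ennreal (c * norm (u0 \<omega>) + norm ?I + norm (N t \<omega>))"
    by (intro ennreal_leI) simp
  also have "\<dots> = ennreal c * ennreal (norm (u0 \<omega>)) + ennreal (norm ?I) + ennreal (norm (N t \<omega>))"
    using pos(3) by (simp add: ennreal_mult)
  also have "ennreal (norm ?I) \<le> ennreal c * cumulated_drift t \<omega>"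
    unfolding cumulated_drift_def
    using elim assms drift_measurable_path by (intro flow_integral_le) auto
  finally show ?case by (simp add: add_mono)
qed

text \<open>
  Over the full interval, the definition of a solution makes \<open>flow A (T - s) (f s (U s \<omega>))\<close>
  integrable; applying the inverse matrices \<open>mat_exp ((T - s) *\<^sub>R (- A))\<close>, which are bounded, recovers
  the drift itself.
\<close>
lemma cumulated_drift_finite: "AE \<omega> in P. cumulated_drift T \<omega> < \<infinity>"
proof -
  obtain k where "k \<ge> 1" and k: "\<And>s x. 0 \<le> s \<Longrightarrow> s \<le> T - t0 \<Longrightarrow> norm (mat_exp (s *\<^sub>R (- A)) *v x) \<le> k * norm x"
    using mat_exp_bounds[of "T - t0" "- A"] by metis
  have "T \<in> {t0..T}" using t0_less_T by simp
  from mild[OF this] AE_space show ?thesis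
  proof eventually_elim
    case (elim \<omega>)
    let ?g = "\<lambda>s. flow A (T - s) (f s (U s \<omega>))"
    have int: "integrable lborel (\<lambda>s. indicat_real {t0..T} s *\<^sub>R ?g s)"
      using elim by (simp add: set_integrable_def)
    then have meas: "(\<lambda>s. indicat_real {t0..T} s *\<^sub>R ?g s) \<in> borel_measurable lborel" by simp
    have "norm (f s (U s \<omega>)) \<le> k * norm (?g s)" if "s \<in> {t0..T}" for s
    proof -
      have "(T - s) *\<^sub>R - A = (- (T - s)) *\<^sub>R A" by (simp add: scaleR_diff_left)
      then have "mat_exp ((T - s) *\<^sub>R - A) ** mat_exp ((T - s) *\<^sub>R A) = mat 1"
        using mat_exp_add[of "- (T - s)" "T - s" A, symmetric] by (simp only:) simp
      then have "mat_exp ((T - s) *\<^sub>R - A) *v ?g s = f s (U s \<omega>)"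
        by (simp only: matrix_vector_mul_assoc matrix_vector_mul_lid)
      then show ?thesis using k[of "T - s" "?g s"] that by simp
    qed
    then have "cumulated_drift T \<omega> \<le> (\<integral>\<^sup>+s. ennreal k * ennreal (norm (indicat_real {t0..T} s *\<^sub>R ?g s)) \<partial>lborel)"
      unfolding cumulated_drift_def using \<open>k \<ge> 1\<close>
      by (intro nn_integral_mono) (auto simp: ennreal_mult[symmetric] ennreal_leI split: split_indicator)
    also have "\<dots> = ennreal k * (\<integral>\<^sup>+s. ennreal (norm (indicat_real {t0..T} s *\<^sub>R ?g s)) \<partial>lborel)"
      by (intro nn_integral_cmult measurable_compose[OF meas]) measurable
    also have "\<dots> < \<infinity>"
      using int by (simp add: integrable_iff_bounded ennreal_mult_less_top)
    finally show ?case .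
  qed
qed

lemma cumulated_drift_mono: "s \<le> t \<Longrightarrow> cumulated_drift s \<omega> \<le> cumulated_drift t \<omega>"
  unfolding cumulated_drift_def by (intro nn_integral_mono) (auto split: split_indicator)

text \<open>
  Nothing is assumed about the moments of \<open>U\<close>, so Gronwall's inequality is applied to each path,
  where \<open>cumulated_drift_finite\<close> provides the finiteness it requires. The pathwise bound on \<open>U s\<close> by
  initial value, drift and noise holds outside a null set that depends on \<open>s\<close>, so it cannot be
  integrated in time as it stands. Therefore \<open>R s\<close> is defined as the
  excess of \<open>U s\<close> over the first two contributions, is jointly measurable, and is dominated by
  \<open>N s\<close> almost surely for each \<open>s\<close>, hence bounded in mean square.
\<close>
lemma cumulated_drift_L2: "\<exists>B\<ge>0. mean_sq P (\<lambda>\<omega>. cumulated_drift T \<omega>) \<le> ennreal B"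
proof -
  define R where "R s \<omega> = ennreal (norm (U s \<omega>))
      - (ennreal c * ennreal (norm (u0 \<omega>)) + ennreal c * cumulated_drift s \<omega>)" for s \<omega>
  define \<psi> where "\<psi> s \<omega> = ennreal D * (1 + ennreal c * ennreal (norm (u0 \<omega>)) + R s \<omega>)" for s \<omega>
  have [measurable]: "R s \<in> borel_measurable P" for s unfolding R_def[abs_def] by measurable
  have R_L2: "mean_sq P (\<lambda>\<omega>. R s \<omega>) \<le> ennreal Cn" if "s \<in> {t0..T}" for s
  proof -
    have "AE \<omega> in P. R s \<omega> \<le> ennreal (norm (N s \<omega>))"
      using norm_U_le[OF that]
      by eventually_elim (simp add: R_def ennreal_minus_le_iff)
    then have "mean_sq P (\<lambda>\<omega>. R s \<omega>) \<le> mean_sq P (\<lambda>\<omega>. ennreal (norm (N s \<omega>)))"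
      by (intro nn_integral_mono_AE) (auto elim!: eventually_mono intro: power_mono)
    with N_L2[OF that] show ?thesis by (rule order_trans[rotated])
  qed
  define B where "B = D\<^sup>2 * (4 * (1 + c\<^sup>2 * m0 + Cn))"
  have \<psi>_L2: "mean_sq P (\<lambda>\<omega>. \<psi> s \<omega>) \<le> ennreal B" if "s \<in> {t0..T}" for s
    unfolding \<psi>_def B_def
  proof (rule nn_integral_square_cmult_le)
    show "mean_sq P (\<lambda>\<omega>. 1 + ennreal c * ennreal (norm (u0 \<omega>)) + R s \<omega>)
        \<le> ennreal (4 * (1 + c\<^sup>2 * m0 + Cn))"
    proof (rule nn_integral_square_sum3_le)
      show "mean_sq P (\<lambda>\<omega>. ennreal c * ennreal (norm (u0 \<omega>))) \<le> ennreal (c\<^sup>2 * m0)"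
        using u0_L2 pos(3) by (intro nn_integral_square_cmult_le) auto
    qed (use R_L2[OF that] pos in \<open>auto simp: emeasure_space_1\<close>)
  qed (use pos in auto)
  \<comment> \<open>The growth of \<open>f\<close> and the bound on the exponential give the Gronwall constant.\<close>
  define k where "k = D * c"
  have "k > 0" using pos by (simp add: k_def)
  define C where "C = 2 * exp (2 * k * (T - t0))"
  have "AE \<omega> in P. cumulated_drift T \<omega> \<le> ennreal C * (\<integral>\<^sup>+s\<in>{t0..T}. \<psi> s \<omega> \<partial>lborel)"
    using cumulated_drift_finite AE_space
  proof eventually_elim
    case (elim \<omega>)
    note [measurable] = \<open>\<omega> \<in> space P\<close>
    show ?case
      unfolding cumulated_drift_def C_def
    proof (rule weighted_gronwall)
      show "(\<lambda>s. drift s \<omega>) \<in> borel_measurable borel" by measurable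
      show "(\<lambda>s. \<psi> s \<omega>) \<in> borel_measurable borel" unfolding \<psi>_def R_def by measurable
      show "(\<integral>\<^sup>+s\<in>{t0..T}. drift s \<omega> \<partial>lborel) < \<infinity>"
        using elim(1) by (simp add: cumulated_drift_def)
      fix s assume s: "s \<in> {t0..T}"
      let ?a = "ennreal c * ennreal (norm (u0 \<omega>)) + ennreal c * cumulated_drift s \<omega>"
      have "ennreal (norm (U s \<omega>)) \<le> R s \<omega> + ?a"
        unfolding R_def diff_add_self_ennreal by (simp add: not_le less_imp_le)
      have "drift s \<omega> \<le> ennreal (D * (1 + norm (U s \<omega>)))" by (intro ennreal_leI f_growth)
      also have "\<dots> = ennreal D * (1 + ennreal (norm (U s \<omega>)))"
        using pos(1) by (simp add: ennreal_mult)
      also have "\<dots> \<le> ennreal D * (1 + (R s \<omega> + ?a))"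
        by (intro mult_left_mono add_left_mono) (fact, simp)
      also have "\<dots> = \<psi> s \<omega> + ennreal D * (ennreal c * cumulated_drift s \<omega>)"
        unfolding \<psi>_def by (simp add: distrib_left add_ac)
      also have "ennreal D * (ennreal c * cumulated_drift s \<omega>) = ennreal k * cumulated_drift s \<omega>"
        using pos by (simp add: k_def ennreal_mult mult.assoc)
      finally show "drift s \<omega> \<le> \<psi> s \<omega> + ennreal k * (\<integral>\<^sup>+\<tau>\<in>{t0..s}. drift \<tau> \<omega> \<partial>lborel)"
        unfolding cumulated_drift_def .
    qed (use \<open>k > 0\<close> t0_less_T in auto)
  qed
  then have "mean_sq P (\<lambda>\<omega>. cumulated_drift T \<omega>)
      \<le> mean_sq P (\<lambda>\<omega>. ennreal C * (\<integral>\<^sup>+s\<in>{t0..T}. \<psi> s \<omega> \<partial>lborel))"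
    by (intro nn_integral_mono_AE) (auto elim!: eventually_mono intro: power_mono)
  also have "\<dots> \<le> ennreal (C\<^sup>2 * ((T - t0)\<^sup>2 * B))"
  proof (rule nn_integral_square_cmult_le)
    have "mean_sq P (\<lambda>\<omega>. \<integral>\<^sup>+s\<in>{t0..T}. \<psi> s \<omega> \<partial>lborel) \<le> ennreal ((T - t0)\<^sup>2) * ennreal B"
    proof (rule nn_integral_square_time_integral_le)
      show "(\<lambda>z. \<psi> (fst z) (snd z)) \<in> borel_measurable (borel \<Otimes>\<^sub>M P)"
        unfolding \<psi>_def R_def by measurable
    qed (use \<psi>_L2 t0_less_T sigma_finite_measure_axioms in auto)
    then show "mean_sq P (\<lambda>\<omega>. \<integral>\<^sup>+s\<in>{t0..T}. \<psi> s \<omega> \<partial>lborel) \<le> ennreal ((T - t0)\<^sup>2 * B)"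
      by (simp add: ennreal_mult')
    show "(\<lambda>\<omega>. \<integral>\<^sup>+s\<in>{t0..T}. \<psi> s \<omega> \<partial>lborel) \<in> borel_measurable P"
      unfolding \<psi>_def R_def by measurable
  qed (simp add: C_def)
  finally have bound: "mean_sq P (\<lambda>\<omega>. cumulated_drift T \<omega>) \<le> ennreal (C\<^sup>2 * ((T - t0)\<^sup>2 * B))" .
  show ?thesis
  proof (intro exI[of _ "C\<^sup>2 * ((T - t0)\<^sup>2 * B)"] conjI bound)
    show "C\<^sup>2 * ((T - t0)\<^sup>2 * B) \<ge> 0" using pos by (simp add: B_def)
  qed
qed

lemma U_L2_bounded:
  "\<exists>B\<ge>0. \<forall>t\<in>{t0..T}. mean_sq P (\<lambda>\<omega>. ennreal (norm (U t \<omega>))) \<le> ennreal B"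
proof -
  obtain BY where BY: "BY \<ge> 0" "mean_sq P (\<lambda>\<omega>. cumulated_drift T \<omega>) \<le> ennreal BY"
    using cumulated_drift_L2 by (elim exE conjE)
  show ?thesis
  proof (intro exI[of _ "4 * (c\<^sup>2 * m0 + c\<^sup>2 * BY + Cn)"] conjI ballI)
    show "4 * (c\<^sup>2 * m0 + c\<^sup>2 * BY + Cn) \<ge> 0" using pos BY(1) by simp
  next
    fix t assume t: "t \<in> {t0..T}"
    show "mean_sq P (\<lambda>\<omega>. ennreal (norm (U t \<omega>))) \<le> ennreal (4 * (c\<^sup>2 * m0 + c\<^sup>2 * BY + Cn))"
    proof (rule nn_integral_square_sum3_le)
      show "AE \<omega> in P. ennreal (norm (U t \<omega>)) \<le> ennreal c * ennreal (norm (u0 \<omega>))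
          + ennreal c * cumulated_drift T \<omega> + ennreal (norm (N t \<omega>))"
        using norm_U_le[OF t]
      proof eventually_elim
        case (elim \<omega>)
        have "cumulated_drift t \<omega> \<le> cumulated_drift T \<omega>" using t by (intro cumulated_drift_mono) simp
        then have "ennreal c * cumulated_drift t \<omega> \<le> ennreal c * cumulated_drift T \<omega>"
          by (rule mult_left_mono) simp
        then show ?case by (intro order_trans[OF elim] add_mono order_refl)
      qed
      show "mean_sq P (\<lambda>\<omega>. ennreal c * ennreal (norm (u0 \<omega>))) \<le> ennreal (c\<^sup>2 * m0)"
        using u0_L2 pos(3) by (intro nn_integral_square_cmult_le) auto
      show "mean_sq P (\<lambda>\<omega>. ennreal c * cumulated_drift T \<omega>) \<le> ennreal (c\<^sup>2 * BY)"
        using BY(2) pos(3) by (intro nn_integral_square_cmult_le) auto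
    qed (use N_L2[OF t] pos BY(1) in auto)
  qed
qed

lemma drift_L2_bounded:
  "\<exists>B\<ge>0. \<forall>t\<in>{t0..T}. mean_sq P (\<lambda>\<omega>. drift t \<omega>) \<le> ennreal B"
proof -
  obtain BU where BU: "BU \<ge> 0" "\<forall>t\<in>{t0..T}. mean_sq P (\<lambda>\<omega>. ennreal (norm (U t \<omega>))) \<le> ennreal BU"
    using U_L2_bounded by (elim exE conjE)
  show ?thesis
  proof (intro exI[of _ "4 * (D\<^sup>2 + D\<^sup>2 * BU + 0)"] conjI ballI)
    show "4 * (D\<^sup>2 + D\<^sup>2 * BU + 0) \<ge> 0" using BU(1) by simp
  next
    fix t assume t: "t \<in> {t0..T}"
    show "mean_sq P (\<lambda>\<omega>. drift t \<omega>) \<le> ennreal (4 * (D\<^sup>2 + D\<^sup>2 * BU + 0))"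
    proof (rule nn_integral_square_sum3_le)
      show "AE \<omega> in P. drift t \<omega> \<le> ennreal D + ennreal D * ennreal (norm (U t \<omega>)) + 0"
      proof (rule AE_I2)
        fix \<omega>
        have "drift t \<omega> \<le> ennreal (D + D * norm (U t \<omega>))"
          using f_growth[of t "U t \<omega>"] by (intro ennreal_leI) (simp add: distrib_left)
        then show "drift t \<omega> \<le> ennreal D + ennreal D * ennreal (norm (U t \<omega>)) + 0"
          using pos(1) by (simp add: ennreal_mult)
      qed
      show "mean_sq P (\<lambda>\<omega>. ennreal D * ennreal (norm (U t \<omega>))) \<le> ennreal (D\<^sup>2 * BU)"
        using BU(2) t pos(1) by (intro nn_integral_square_cmult_le) auto
      show "mean_sq P (\<lambda>\<omega>. ennreal D) \<le> ennreal (D\<^sup>2)"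
        using pos(1) by (simp add: emeasure_space_1 ennreal_power)
    qed (use BU(1) in auto)
  qed
qed

text \<open>
  By the semigroup law, the contributions of initial value, drift and noise up to time \<open>r\<close> combine into
  the propagated value of \<open>U\<close> at \<open>r\<close>.
\<close>
lemma mild_restart:
  assumes "t0 \<le> r" "r \<le> t" "t \<le> T"
  shows "AE \<omega> in P. set_integrable lborel {r..t} (\<lambda>s. flow A (t - s) (f s (U s \<omega>))) \<and>
    U t \<omega> = flow A (t - r) (U r \<omega>)
      + (LINT s:{r..t}|lborel. flow A (t - s) (f s (U s \<omega>)))
      + (N t \<omega> - flow A (t - r) (N r \<omega>))"
proof -
  have "t \<in> {t0..T}" "r \<in> {t0..T}" using assms by auto
  from mild[OF this(1)] mild[OF this(2)] show ?thesis
  proof eventually_elim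
    case (elim \<omega>)
    let ?E = "\<lambda>s. mat_exp (s *\<^sub>R A)"
    let ?g = "\<lambda>t s. ?E (t - s) *v f s (U s \<omega>)"
    have int: "set_integrable lborel {r..t} (?g t)" "set_integrable lborel {t0..r} (?g t)"
      using elim assms by (auto intro: set_integrable_subset)
    have "{t0..r} \<union> {r..t} = {t0..t}" using assms by auto
    moreover have "AE s in lborel. \<not> (s \<in> {t0..r} \<and> s \<in> {r..t})"
      using AE_lborel_singleton[of r] by eventually_elim auto
    ultimately have split: "(LINT s:{t0..t}|lborel. ?g t s)
        = (LINT s:{t0..r}|lborel. ?g t s) + (LINT s:{r..t}|lborel. ?g t s)"
      using set_integral_Un_AE[where M=lborel and A="{t0..r}" and B="{r..t}" and f="?g t"] int by simp
    have semigroup: "?E (t - s) *v x = ?E (t - r) *v (?E (r - s) *v x)" for s x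
      using mat_exp_add[of "t - r" "r - s" A] by (simp add: matrix_vector_mul_assoc)
    have "?E (t - r) *v (LINT s:{t0..r}|lborel. ?g r s) = (LINT s:{t0..r}|lborel. ?E (t - r) *v ?g r s)"
      unfolding set_lebesgue_integral_def
      using elim(2) integral_bounded_linear[OF matrix_vector_mul_bounded_linear[of "?E (t - r)"],
          of lborel "\<lambda>s. indicator {t0..r} s *\<^sub>R ?g r s"]
      by (simp add: set_integrable_def mv.scaleR_right)
    also have "\<dots> = (LINT s:{t0..r}|lborel. ?g t s)" by (simp add: semigroup[of _ "f _ _", symmetric])
    finally have "?E (t - r) *v U r \<omega> = ?E (t - t0) *v u0 \<omega> + (LINT s:{t0..r}|lborel. ?g t s)
        + ?E (t - r) *v N r \<omega>"
      using elim(2) by (simp add: mv.add_right semigroup[of t0, symmetric])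
    then show ?case using elim(1) int(1) split by simp
  qed
qed

text \<open>
  After a restart at \<open>r\<close> the linear part and the drift move by an amount of order \<open>t - r\<close>, and the noise by
  \<open>(t - r) powr H\<close>. The last order is the worst, since \<open>H < 1\<close>.
\<close>
lemma U_increment_L2:
  "\<exists>B\<ge>0. \<forall>r t. t0 \<le> r \<longrightarrow> r \<le> t \<longrightarrow> t \<le> T \<longrightarrow>
     mean_sq P (\<lambda>\<omega>. ennreal (norm (U t \<omega> - U r \<omega>))) \<le> ennreal (B * (t - r) powr (2 * H))"
proof -
  obtain BU where BU: "BU \<ge> 0" "\<forall>t\<in>{t0..T}. mean_sq P (\<lambda>\<omega>. ennreal (norm (U t \<omega>))) \<le> ennreal BU"
    using U_L2_bounded by (elim exE conjE)
  obtain BF where BF: "BF \<ge> 0" "\<forall>t\<in>{t0..T}. mean_sq P (\<lambda>\<omega>. drift t \<omega>) \<le> ennreal BF"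
    using drift_L2_bounded by (elim exE conjE)
  define q where "q = (T - t0) powr (2 - 2 * H)"
  define B where "B = 4 * (c\<^sup>2 * BU * q + c\<^sup>2 * BF * q + Cn)"
  show ?thesis
  proof (intro exI[of _ B] conjI allI impI)
    show "B \<ge> 0" using BU(1) BF(1) pos by (simp add: B_def q_def)
  next
    fix r t assume rt: "t0 \<le> r" "r \<le> t" "t \<le> T"
    let ?\<nu> = "\<lambda>\<omega>. N t \<omega> - flow A (t - r) (N r \<omega>)"
    let ?S = "\<lambda>\<omega>. \<integral>\<^sup>+s\<in>{r..t}. drift s \<omega> \<partial>lborel"
    have "mean_sq P (\<lambda>\<omega>. ennreal (norm (U t \<omega> - U r \<omega>)))
        \<le> ennreal (4 * ((c * (t - r))\<^sup>2 * BU + c\<^sup>2 * ((t - r)\<^sup>2 * BF) + Cn * (t - r) powr (2 * H)))"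
    proof (rule nn_integral_square_sum3_le)
      show "AE \<omega> in P. ennreal (norm (U t \<omega> - U r \<omega>))
          \<le> ennreal (c * (t - r)) * ennreal (norm (U r \<omega>)) + ennreal c * ?S \<omega> + ennreal (norm (?\<nu> \<omega>))"
        using mild_restart[OF rt] AE_space
      proof eventually_elim
        case (elim \<omega>)
        let ?I = "LINT s:{r..t}|lborel. flow A (t - s) (f s (U s \<omega>))"
        have "U t \<omega> - U r \<omega> = (flow A (t - r) (U r \<omega>) - U r \<omega>) + ?I + ?\<nu> \<omega>"
          using elim by simp
        then have "norm (U t \<omega> - U r \<omega>) \<le> norm (flow A (t - r) (U r \<omega>) - U r \<omega>) + norm ?I + norm (?\<nu> \<omega>)"
          by (simp only: norm_triangle3)
        also have "norm (flow A (t - r) (U r \<omega>) - U r \<omega>) \<le> c * (t - r) * norm (U r \<omega>)"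
          using rt by (intro flow_diff_le) auto
        finally have "ennreal (norm (U t \<omega> - U r \<omega>))
            \<le> ennreal (c * (t - r) * norm (U r \<omega>) + norm ?I + norm (?\<nu> \<omega>))"
          by (intro ennreal_leI) simp
        also have "\<dots> = ennreal (c * (t - r)) * ennreal (norm (U r \<omega>)) + ennreal (norm ?I) + ennreal (norm (?\<nu> \<omega>))"
          using pos(3) rt by (simp add: ennreal_mult'')
        also have "ennreal (norm ?I) \<le> ennreal c * ?S \<omega>"
          using elim rt drift_measurable_path by (intro flow_integral_le) auto
        finally show ?case by (simp add: add_mono)
      qed
      show "mean_sq P (\<lambda>\<omega>. ennreal (c * (t - r)) * ennreal (norm (U r \<omega>))) \<le> ennreal ((c * (t - r))\<^sup>2 * BU)"
        using BU(2) rt pos(3) by (intro nn_integral_square_cmult_le) auto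
      show "mean_sq P (\<lambda>\<omega>. ennreal c * ?S \<omega>) \<le> ennreal (c\<^sup>2 * ((t - r)\<^sup>2 * BF))"
      proof (rule nn_integral_square_cmult_le)
        have "mean_sq P ?S \<le> ennreal ((t - r)\<^sup>2) * ennreal BF"
          using BF(2) rt sigma_finite_measure_axioms
          by (intro nn_integral_square_time_integral_le) auto
        then show "mean_sq P ?S \<le> ennreal ((t - r)\<^sup>2 * BF)" by (simp add: ennreal_mult')
      qed (use pos(3) in \<open>auto\<close>)
      show "mean_sq P (\<lambda>\<omega>. ennreal (norm (?\<nu> \<omega>))) \<le> ennreal (Cn * (t - r) powr (2 * H))"
        using rt by (rule N_increment)
    qed (use BU(1) BF(1) pos in auto)
    also have "\<dots> \<le> ennreal (B * (t - r) powr (2 * H))"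
    proof (rule ennreal_leI)
      let ?p = "(t - r) powr (2 * H)"
      have sq: "(t - r)\<^sup>2 \<le> q * ?p" unfolding q_def using rt H(2) by (intro square_le_powr) auto
      have "(c * (t - r))\<^sup>2 * BU + c\<^sup>2 * ((t - r)\<^sup>2 * BF) + Cn * ?p
          = (c\<^sup>2 * BU + c\<^sup>2 * BF) * (t - r)\<^sup>2 + Cn * ?p"
        unfolding power_mult_distrib by (simp add: distrib_right distrib_left mult_ac)
      also have "\<dots> \<le> (c\<^sup>2 * BU + c\<^sup>2 * BF) * (q * ?p) + Cn * ?p"
        using sq BU(1) BF(1) by (intro add_right_mono mult_left_mono) auto
      finally show "4 * ((c * (t - r))\<^sup>2 * BU + c\<^sup>2 * ((t - r)\<^sup>2 * BF) + Cn * ?p) \<le> B * ?p"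
        unfolding B_def by (simp add: algebra_simps)
    qed
    finally show "mean_sq P (\<lambda>\<omega>. ennreal (norm (U t \<omega> - U r \<omega>))) \<le> ennreal (B * (t - r) powr (2 * H))" .
  qed
qed

end

section \<open>Mean-square error of the exponential Euler scheme\<close>

lemma subdivision_time_grid: "time_grid t0 T M t \<Longrightarrow> subdivision t0 T M t"
  by (auto simp: time_grid_def subdivision_def less_imp_le)

lemma max_step_ge:
  assumes "k < M"
  shows "t (Suc k) - t k \<le> max_step M t"
  using assms unfolding max_step_def by (intro Max_ge) auto

lemma time_grid_mem:
  assumes "time_grid t0 T M t" "j \<le> M"
  shows "t j \<in> {t0..T}"
proof -
  note sub = subdivision_time_grid[OF assms(1)]
  show ?thesis
    using subdivision_mono[OF sub, of 0 j] subdivision_mono[OF sub, of j M] assms(2) sub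
    by (simp add: subdivision_def)
qed

lemma max_step_bounds:
  assumes "time_grid t0 T M t" "M > 0"
  shows "0 < max_step M t" "max_step M t \<le> T - t0"
proof -
  have "max_step M t \<in> (\<lambda>k. t (Suc k) - t k) ` {0..<M}"
    unfolding max_step_def using assms(2) by (intro Max_in) auto
  then obtain k where "k < M" "max_step M t = t (Suc k) - t k" by auto
  then show "0 < max_step M t" "max_step M t \<le> T - t0"
    using assms(1) time_grid_mem[OF assms(1), of k] time_grid_mem[OF assms(1), of "Suc k"]
    by (auto simp: time_grid_def)
qed

lemma discrete_gronwall_ennreal:
  fixes e d :: "nat \<Rightarrow> ennreal" and p :: "nat \<Rightarrow> real"
  assumes step: "\<And>k. k < M \<Longrightarrow> e (Suc k) \<le> ennreal (1 + \<kappa> * (p (Suc k) - p k)) * e k + d k"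
    and "e 0 = 0" "\<kappa> \<ge> 0" and mono: "\<And>k. k < M \<Longrightarrow> p k \<le> p (Suc k)"
    and "k \<le> M"
  shows "e k \<le> ennreal (exp (\<kappa> * (p k - p 0))) * (\<Sum>j<k. d j)"
  using \<open>k \<le> M\<close>
proof (induction k)
  case (Suc k)
  let ?x = "\<kappa> * (p (Suc k) - p k)"
  have "k < M" using Suc.prems by simp
  have p0: "p 0 \<le> p j" if "j \<le> M" for j
    using that by (induction j) (auto intro: order_trans[OF _ mono])
  have "e (Suc k) \<le> ennreal (1 + ?x) * e k + d k" by (rule step) fact
  also have "\<dots> \<le> ennreal (exp ?x) * (ennreal (exp (\<kappa> * (p k - p 0))) * (\<Sum>j<k. d j)) + d k"
    using Suc \<open>k < M\<close> by (intro add_right_mono mult_mono ennreal_leI exp_ge_add_one_self) auto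
  also have "ennreal (exp ?x) * (ennreal (exp (\<kappa> * (p k - p 0))) * (\<Sum>j<k. d j))
      = ennreal (exp (\<kappa> * (p (Suc k) - p 0))) * (\<Sum>j<k. d j)"
  proof -
    have "exp ?x * exp (\<kappa> * (p k - p 0)) = exp (\<kappa> * (p (Suc k) - p 0))"
      by (simp add: exp_add[symmetric] algebra_simps)
    then show ?thesis by (simp add: mult.assoc[symmetric] ennreal_mult[symmetric])
  qed
  also have "d k \<le> ennreal (exp (\<kappa> * (p (Suc k) - p 0))) * d k"
  proof -
    have "ennreal 1 \<le> ennreal (exp (\<kappa> * (p (Suc k) - p 0)))"
      using p0[OF Suc.prems] \<open>\<kappa> \<ge> 0\<close> by (intro ennreal_leI) simp
    from mult_right_mono[OF this, of "d k"] show ?thesis by simp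
  qed
  finally show ?case by (simp add: distrib_left add_mono)
qed (use \<open>e 0 = 0\<close> in simp)

context mild_solution
begin

definition euler_step :: "real \<Rightarrow> real \<Rightarrow> real^'n \<Rightarrow> real^'n" where
  "euler_step r t x = flow A (t - r) x
     + (matrix_inv A ** (mat_exp ((t - r) *\<^sub>R A) - mat 1)) *v f r x"

definition noise_increment :: "real \<Rightarrow> real \<Rightarrow> 'w \<Rightarrow> real^'n" where
  "noise_increment r t \<omega> = N t \<omega> - flow A (t - r) (N r \<omega>)"

text \<open>
  One step of the scheme adds the same noise as the solution, so only the drift contributes, by
  the Lipschitz condition. The path regularity of \<open>U\<close> within the step is kept as an integral, to
  be estimated in mean square only after summation.
\<close>
lemma euler_step_error:
  assumes "t0 \<le> r" "r \<le> t" "t \<le> T" "t - r \<le> h" and \<omega>: "\<omega> \<in> space P"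
    and int: "set_integrable lborel {r..t} (\<lambda>s. flow A (t - s) (f s (U s \<omega>)))"
    and U: "U t \<omega> = flow A (t - r) (U r \<omega>)
      + (LINT s:{r..t}|lborel. flow A (t - s) (f s (U s \<omega>))) + noise_increment r t \<omega>"
  shows "ennreal (norm (U t \<omega> - (euler_step r t v + noise_increment r t \<omega>)))
    \<le> ennreal (1 + (c + c * K) * (t - r)) * ennreal (norm (U r \<omega> - v))
      + (\<integral>\<^sup>+s\<in>{r..t}. ennreal (c * K * (h + norm (U s \<omega> - U r \<omega>))) \<partial>lborel)"
proof -
  let ?E = "\<lambda>s. mat_exp (s *\<^sub>R A)"
  let ?e = "U r \<omega> - v"
  let ?d = "\<lambda>s. f s (U s \<omega>) - f r v"
  have path [measurable]: "(\<lambda>s. f s (U s \<omega>)) \<in> borel_measurable borel" "(\<lambda>s. U s \<omega>) \<in> borel_measurable borel"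
    using \<omega> by measurable
  note int' = matrix_inv_mat_exp_integral[OF A_invertible \<open>r \<le> t\<close>, of "f r v"]
  have int_d: "set_integrable lborel {r..t} (\<lambda>s. ?E (t - s) *v ?d s)"
    using set_integral_diff(1)[OF int int'(1)] by (simp add: mv.diff_right)
  have "U t \<omega> - (euler_step r t v + noise_increment r t \<omega>)
      = ?E (t - r) *v ?e + (LINT s:{r..t}|lborel. ?E (t - s) *v ?d s)"
    using set_integral_diff(2)[OF int int'(1)]
    by (simp add: U euler_step_def int'(2)[symmetric] mv.diff_right)
  also have "norm \<dots> \<le> norm (?E (t - r) *v ?e) + norm (LINT s:{r..t}|lborel. ?E (t - s) *v ?d s)"
    by (rule norm_triangle_ineq)
  finally have "ennreal (norm (U t \<omega> - (euler_step r t v + noise_increment r t \<omega>)))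
      \<le> ennreal (norm (?E (t - r) *v ?e)) + ennreal (norm (LINT s:{r..t}|lborel. ?E (t - s) *v ?d s))"
    by (simp add: ennreal_leI flip: ennreal_plus)
  also have "ennreal (norm (?E (t - r) *v ?e)) \<le> ennreal ((1 + c * (t - r)) * norm ?e)"
  proof (rule ennreal_leI)
    have "norm (?E (t - r) *v ?e) \<le> norm ?e + norm (?E (t - r) *v ?e - ?e)" by norm
    also have "norm (?E (t - r) *v ?e - ?e) \<le> c * (t - r) * norm ?e"
      using assms by (intro flow_diff_le) auto
    finally show "norm (?E (t - r) *v ?e) \<le> (1 + c * (t - r)) * norm ?e"
      by (simp add: distrib_right)
  qed
  also have "ennreal (norm (LINT s:{r..t}|lborel. ?E (t - s) *v ?d s))
      \<le> ennreal c * (\<integral>\<^sup>+s\<in>{r..t}. ennreal (norm (?d s)) \<partial>lborel)"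
    using int_d assms by (intro flow_integral_le) auto
  also have "\<dots> = (\<integral>\<^sup>+s. ennreal c * (ennreal (norm (?d s)) * indicator {r..t} s) \<partial>lborel)"
    by (rule nn_integral_cmult[symmetric]) measurable
  also have "\<dots> \<le> (\<integral>\<^sup>+s. ennreal (c * K * norm ?e) * indicator {r..t} s
      + ennreal (c * K * (h + norm (U s \<omega> - U r \<omega>))) * indicator {r..t} s \<partial>lborel)"
  proof (rule nn_integral_mono)
    fix s
    show "ennreal c * (ennreal (norm (?d s)) * indicator {r..t} s)
      \<le> ennreal (c * K * norm ?e) * indicator {r..t} s
        + ennreal (c * K * (h + norm (U s \<omega> - U r \<omega>))) * indicator {r..t} s"
    proof (cases "s \<in> {r..t}")
      case True
      have "norm (?d s) \<le> K * (\<bar>s - r\<bar> + norm (U s \<omega> - v))" by (rule f_lipschitz)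
      also have "\<dots> \<le> K * (h + (norm (U s \<omega> - U r \<omega>) + norm ?e))"
      proof (intro mult_left_mono add_mono)
        show "\<bar>s - r\<bar> \<le> h" using True assms(4) by auto
        show "norm (U s \<omega> - v) \<le> norm (U s \<omega> - U r \<omega>) + norm ?e" by norm
      qed (use pos in simp)
      finally have "c * norm (?d s) \<le> c * (K * (h + (norm (U s \<omega> - U r \<omega>) + norm ?e)))"
        using pos by (intro mult_left_mono) auto
      also have "\<dots> = c * K * norm ?e + c * K * (h + norm (U s \<omega> - U r \<omega>))"
        by (simp add: algebra_simps)
      finally have "ennreal (c * norm (?d s))
          \<le> ennreal (c * K * norm ?e + c * K * (h + norm (U s \<omega> - U r \<omega>)))"
        by (rule ennreal_leI)
      moreover have "h \<ge> 0" using assms by simp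
      ultimately show ?thesis using True pos by (simp add: ennreal_mult)
    qed simp
  qed
  also have "\<dots> = ennreal (c * K * norm ?e) * ennreal (t - r)
      + (\<integral>\<^sup>+s\<in>{r..t}. ennreal (c * K * (h + norm (U s \<omega> - U r \<omega>))) \<partial>lborel)"
    using \<open>r \<le> t\<close> by (subst nn_integral_add) (auto simp: nn_integral_cmult_indicator)
  also have "ennreal (c * K * norm ?e) * ennreal (t - r) = ennreal (c * K * norm ?e * (t - r))"
    using \<open>r \<le> t\<close> by (simp add: ennreal_mult'')
  finally have "ennreal (norm (U t \<omega> - (euler_step r t v + noise_increment r t \<omega>)))
      \<le> ennreal ((1 + c * (t - r)) * norm ?e) + (ennreal (c * K * norm ?e * (t - r))
        + (\<integral>\<^sup>+s\<in>{r..t}. ennreal (c * K * (h + norm (U s \<omega> - U r \<omega>))) \<partial>lborel))"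
    by (simp add: add_mono)
  also have "\<dots> = ennreal ((1 + c * (t - r)) * norm ?e + c * K * norm ?e * (t - r))
        + (\<integral>\<^sup>+s\<in>{r..t}. ennreal (c * K * (h + norm (U s \<omega> - U r \<omega>))) \<partial>lborel)"
    using pos \<open>r \<le> t\<close> by (subst ennreal_plus) (auto simp: add.assoc)
  also have "(1 + c * (t - r)) * norm ?e + c * K * norm ?e * (t - r)
      = (1 + (c + c * K) * (t - r)) * norm ?e"
    by (simp add: algebra_simps)
  also have "ennreal \<dots> = ennreal (1 + (c + c * K) * (t - r)) * ennreal (norm ?e)"
    by (rule ennreal_mult'') simp
  finally show ?thesis .
qed

text \<open>
  The local errors are gathered into one time integral over \<open>[t0, T]\<close> before taking second moments;
  in each cell its integrand is of order \<open>h powr H\<close> in mean square, irrespective of the number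
  of cells.
\<close>
lemma local_error_integral_L2:
  "\<exists>B\<ge>0. \<forall>M t. time_grid t0 T M t \<longrightarrow>
    mean_sq P (\<lambda>\<omega>. \<Sum>j<M. \<integral>\<^sup>+s\<in>{t j..t (Suc j)}.
        ennreal (c * K * (max_step M t + norm (U s \<omega> - U (t j) \<omega>))) \<partial>lborel)
      \<le> ennreal (B * max_step M t powr (2 * H))"
proof -
  obtain BI where BI: "BI \<ge> 0" "\<forall>r t. t0 \<le> r \<longrightarrow> r \<le> t \<longrightarrow> t \<le> T \<longrightarrow>
     mean_sq P (\<lambda>\<omega>. ennreal (norm (U t \<omega> - U r \<omega>))) \<le> ennreal (BI * (t - r) powr (2 * H))"
    using U_increment_L2 by (elim exE conjE)
  define q where "q = (T - t0) powr (2 - 2 * H)"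
  define B where "B = 4 * ((c * K)\<^sup>2 * q + (c * K)\<^sup>2 * BI)"
  have "B \<ge> 0" using BI(1) by (simp add: B_def q_def)
  show ?thesis
  proof (intro exI[of _ "(T - t0)\<^sup>2 * B"] conjI allI impI)
    show "(T - t0)\<^sup>2 * B \<ge> 0" using \<open>B \<ge> 0\<close> by simp
  next
    fix M t assume grid: "time_grid t0 T M t"
    define h where "h = max_step M t"
    have sub: "subdivision t0 T M t" using grid by (rule subdivision_time_grid)
    note t_in = time_grid_mem[OF grid]
    have t_le: "t j \<le> t (Suc j)" if "j < M" for j using sub that by (simp add: subdivision_def)
    have "M > 0" using grid t0_less_T by (auto simp: time_grid_def intro: gr0I)
    have h: "0 \<le> h" "h \<le> T - t0"
      using max_step_bounds[OF grid \<open>M > 0\<close>] by (simp_all add: h_def)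
    let ?F = "\<lambda>j s \<omega>. ennreal (c * K * (h + norm (U s \<omega> - U (t j) \<omega>)))"
    define G where "G s \<omega> = (\<Sum>j<M. ?F j s \<omega> * indicator {t j<..t (Suc j)} s)" for s \<omega>
    have G_measurable: "(\<lambda>z. G (fst z) (snd z)) \<in> borel_measurable (borel \<Otimes>\<^sub>M P)"
      unfolding G_def by measurable
    have F_L2: "mean_sq P (\<lambda>\<omega>. ?F j s \<omega>) \<le> ennreal (B * h powr (2 * H))"
      if j: "j < M" "s \<in> {t j<..t (Suc j)}" for j s
    proof -
      have s: "t0 \<le> t j" "t j \<le> s" "s \<le> T" "s - t j \<le> h"
        using j t_in[of j] t_in[of "Suc j"] max_step_ge[OF j(1), of t] by (auto simp: h_def)
      have "mean_sq P (\<lambda>\<omega>. ?F j s \<omega>)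
          \<le> ennreal (4 * ((c * K)\<^sup>2 * h\<^sup>2 + (c * K)\<^sup>2 * (BI * h powr (2 * H)) + 0))"
      proof (rule nn_integral_square_sum3_le)
        show "AE \<omega> in P. ?F j s \<omega> \<le> ennreal (c * K) * ennreal h
            + ennreal (c * K) * ennreal (norm (U s \<omega> - U (t j) \<omega>)) + 0"
          using pos h(1) by (simp add: distrib_left ennreal_mult)
        show "mean_sq P (\<lambda>\<omega>. ennreal (c * K) * ennreal (norm (U s \<omega> - U (t j) \<omega>)))
            \<le> ennreal ((c * K)\<^sup>2 * (BI * h powr (2 * H)))"
        proof (rule nn_integral_square_cmult_le)
          have "mean_sq P (\<lambda>\<omega>. ennreal (norm (U s \<omega> - U (t j) \<omega>))) \<le> ennreal (BI * (s - t j) powr (2 * H))"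
            using BI(2)[rule_format, OF s(1-3)] .
          also have "\<dots> \<le> ennreal (BI * h powr (2 * H))"
            using s BI(1) H by (intro ennreal_leI mult_left_mono powr_mono2) auto
          finally show "mean_sq P (\<lambda>\<omega>. ennreal (norm (U s \<omega> - U (t j) \<omega>))) \<le> ennreal (BI * h powr (2 * H))" .
        qed (use pos in auto)
        show "mean_sq P (\<lambda>\<omega>. ennreal (c * K) * ennreal h) \<le> ennreal ((c * K)\<^sup>2 * h\<^sup>2)"
          using pos h(1)
          by (simp add: emeasure_space_1 power_mult_distrib ennreal_power ennreal_mult)
      qed (use BI(1) in auto)
      also have "\<dots> \<le> ennreal (B * h powr (2 * H))"
      proof (rule ennreal_leI)
        have "(c * K)\<^sup>2 * h\<^sup>2 \<le> (c * K)\<^sup>2 * (q * h powr (2 * H))"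
          unfolding q_def using h H(2) by (intro mult_left_mono square_le_powr) auto
        then show "4 * ((c * K)\<^sup>2 * h\<^sup>2 + (c * K)\<^sup>2 * (BI * h powr (2 * H)) + 0) \<le> B * h powr (2 * H)"
          by (simp add: B_def distrib_right)
      qed
      finally show ?thesis .
    qed
    have G_L2: "mean_sq P (\<lambda>\<omega>. G s \<omega>) \<le> ennreal (B * h powr (2 * H))" for s
    proof (cases "\<exists>j<M. s \<in> {t j<..t (Suc j)}")
      case True
      then obtain j where j: "j < M" "s \<in> {t j<..t (Suc j)}" by (elim exE conjE)
      have "G s \<omega> = ?F j s \<omega>" for \<omega>
      proof -
        have "?F i s \<omega> * indicator {t i<..t (Suc i)} s = (if i = j then ?F j s \<omega> else 0)" if "i < M" for i
        proof (cases "i = j")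
          case False
          then have "s \<notin> {t i<..t (Suc i)}"
            using subdivision_cell_unique[OF sub that j(1) _ j(2)] by blast
          then show ?thesis using False by simp
        qed (use j(2) in simp)
        then have "G s \<omega> = (\<Sum>i<M. if i = j then ?F j s \<omega> else 0)"
          unfolding G_def by (intro sum.cong) simp_all
        then show ?thesis using j(1) by simp
      qed
      then show ?thesis using F_L2[OF j] by simp
    next
      case False
      then have "G s \<omega> = 0" for \<omega> unfolding G_def by (intro sum.neutral) auto
      then show ?thesis by simp
    qed
    have sum_eq: "(\<Sum>j<M. \<integral>\<^sup>+s\<in>{t j..t (Suc j)}. ?F j s \<omega> \<partial>lborel) = (\<integral>\<^sup>+s\<in>{t0..T}. G s \<omega> \<partial>lborel)"
      if "\<omega> \<in> space P" for \<omega>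
    proof -
      note [measurable] = that
      have "(\<Sum>j<M. \<integral>\<^sup>+s\<in>{t j..t (Suc j)}. ?F j s \<omega> \<partial>lborel)
          = (\<Sum>j<M. \<integral>\<^sup>+s\<in>{t j<..t (Suc j)}. ?F j s \<omega> \<partial>lborel)"
      proof (intro sum.cong refl nn_integral_cong_AE)
        fix j
        show "AE s in lborel. ?F j s \<omega> * indicator {t j..t (Suc j)} s = ?F j s \<omega> * indicator {t j<..t (Suc j)} s"
          using AE_lborel_singleton[of "t j"] by eventually_elim (simp split: split_indicator)
      qed
      also have "\<dots> = (\<integral>\<^sup>+s. G s \<omega> \<partial>lborel)"
        unfolding G_def by (rule nn_integral_sum[symmetric]) measurable
      also have "\<dots> = (\<integral>\<^sup>+s\<in>{t0..T}. G s \<omega> \<partial>lborel)"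
      proof (rule nn_integral_cong)
        fix s
        have "G s \<omega> = 0" if "s \<notin> {t0..T}"
          unfolding G_def
        proof (rule sum.neutral, rule ballI)
          fix j assume "j \<in> {..<M}"
          then have "s \<notin> {t j<..t (Suc j)}" using that t_in[of j] t_in[of "Suc j"] by auto
          then show "?F j s \<omega> * indicator {t j<..t (Suc j)} s = 0" by simp
        qed
        then show "G s \<omega> = G s \<omega> * indicator {t0..T} s" by (cases "s \<in> {t0..T}") auto
      qed
      finally show ?thesis .
    qed
    have "mean_sq P (\<lambda>\<omega>. \<Sum>j<M. \<integral>\<^sup>+s\<in>{t j..t (Suc j)}. ?F j s \<omega> \<partial>lborel)
        = mean_sq P (\<lambda>\<omega>. \<integral>\<^sup>+s\<in>{t0..T}. G s \<omega> \<partial>lborel)"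
      by (intro nn_integral_cong) (simp only: sum_eq)
    also have "\<dots> \<le> ennreal ((T - t0)\<^sup>2) * ennreal (B * h powr (2 * H))"
      using G_measurable G_L2 t0_less_T sigma_finite_measure_axioms
      by (intro nn_integral_square_time_integral_le) auto
    also have "\<dots> = ennreal ((T - t0)\<^sup>2 * B * h powr (2 * H))"
      by (simp add: ennreal_mult'[symmetric] mult.assoc)
    finally show "mean_sq P (\<lambda>\<omega>. \<Sum>j<M. \<integral>\<^sup>+s\<in>{t j..t (Suc j)}.
          ennreal (c * K * (max_step M t + norm (U s \<omega> - U (t j) \<omega>))) \<partial>lborel)
        \<le> ennreal ((T - t0)\<^sup>2 * B * max_step M t powr (2 * H))"
      unfolding h_def .
  qed
qed

theorem euler_scheme_L2_error:
  "\<exists>C\<ge>0. \<forall>M t V. time_grid t0 T M t \<longrightarrow> (AE \<omega> in P. V 0 \<omega> = u0 \<omega>) \<longrightarrow>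
    (\<forall>k<M. AE \<omega> in P. V (Suc k) \<omega> = euler_step (t k) (t (Suc k)) (V k \<omega>) + noise_increment (t k) (t (Suc k)) \<omega>) \<longrightarrow>
    (\<forall>k\<le>M. mean_sq P (\<lambda>\<omega>. ennreal (norm (U (t k) \<omega> - V k \<omega>))) \<le> ennreal (C * max_step M t powr (2 * H)))"
proof -
  obtain B where B: "B \<ge> 0" "\<forall>M t. time_grid t0 T M t \<longrightarrow>
    mean_sq P (\<lambda>\<omega>. \<Sum>j<M. \<integral>\<^sup>+s\<in>{t j..t (Suc j)}.
        ennreal (c * K * (max_step M t + norm (U s \<omega> - U (t j) \<omega>))) \<partial>lborel)
      \<le> ennreal (B * max_step M t powr (2 * H))"
    using local_error_integral_L2 by (elim exE conjE)
  define \<kappa> where "\<kappa> = c + c * K"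
  have "\<kappa> \<ge> 0" using pos by (simp add: \<kappa>_def)
  define a where "a = exp (\<kappa> * (T - t0))"
  show ?thesis
  proof (intro exI[of _ "a\<^sup>2 * B"] conjI allI impI)
    show "a\<^sup>2 * B \<ge> 0" using B(1) by simp
  next
    fix M :: nat and t :: "nat \<Rightarrow> real" and V :: "nat \<Rightarrow> 'w \<Rightarrow> real^'n" and k
    assume grid: "time_grid t0 T M t" and start: "AE \<omega> in P. V 0 \<omega> = u0 \<omega>"
      and scheme: "\<forall>k<M. AE \<omega> in P. V (Suc k) \<omega>
        = euler_step (t k) (t (Suc k)) (V k \<omega>) + noise_increment (t k) (t (Suc k)) \<omega>"
      and k: "k \<le> M"
    have sub: "subdivision t0 T M t" using grid by (rule subdivision_time_grid)
    note t_in = time_grid_mem[OF grid]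
    have t_le: "t j \<le> t (Suc j)" if "j < M" for j using sub that by (simp add: subdivision_def)
    have t_0: "t 0 = t0" using grid by (simp add: time_grid_def)
    let ?D = "\<lambda>j \<omega>. \<integral>\<^sup>+s\<in>{t j..t (Suc j)}. ennreal (c * K * (max_step M t + norm (U s \<omega> - U (t j) \<omega>))) \<partial>lborel"
    let ?e = "\<lambda>j \<omega>. ennreal (norm (U (t j) \<omega> - V j \<omega>))"
    have e0: "AE \<omega> in P. ?e 0 \<omega> = 0"
    proof -
      have "t0 \<in> {t0..T}" using t0_less_T by simp
      from mild[OF this] start N_start show ?thesis
      proof eventually_elim
        case (elim \<omega>)
        have "(LINT s:{t0..t0}|lborel. flow A (t0 - s) (f s (U s \<omega>))) = 0"
          unfolding set_lebesgue_integral_def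
        proof (rule integral_eq_zero_AE)
          show "AE s in lborel. indicat_real {t0..t0} s *\<^sub>R (flow A (t0 - s) (f s (U s \<omega>))) = 0"
            using AE_lborel_singleton[of t0] by eventually_elim simp
        qed
        then show ?case using elim by (simp add: t_0)
      qed
    qed
    have step: "AE \<omega> in P. \<forall>j\<in>{..<M}. ?e (Suc j) \<omega>
        \<le> ennreal (1 + \<kappa> * (t (Suc j) - t j)) * ?e j \<omega> + ?D j \<omega>"
    proof (rule AE_finite_allI)
      fix j assume "j \<in> {..<M}"
      then have j: "j < M" by simp
      have rt: "t0 \<le> t j" "t j \<le> t (Suc j)" "t (Suc j) \<le> T"
        using t_in[of j] t_in[of "Suc j"] t_le[OF j] j by auto
      from mild_restart[OF rt] scheme[rule_format, OF j] AE_space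
      show "AE \<omega> in P. ?e (Suc j) \<omega> \<le> ennreal (1 + \<kappa> * (t (Suc j) - t j)) * ?e j \<omega> + ?D j \<omega>"
      proof eventually_elim
        case (elim \<omega>)
        have int: "set_integrable lborel {t j..t (Suc j)} (\<lambda>s. flow A (t (Suc j) - s) (f s (U s \<omega>)))"
          using elim(1) by (rule conjunct1)
        show ?case
          unfolding elim(2) \<kappa>_def
          by (rule euler_step_error[OF rt max_step_ge[OF j] elim(3) int])
             (use elim(1) in \<open>simp only: noise_increment_def\<close>)
      qed
    qed simp
    have "AE \<omega> in P. ?e k \<omega> \<le> ennreal a * (\<Sum>j<M. ?D j \<omega>)"
      using e0 step
    proof eventually_elim
      case (elim \<omega>)
      have "?e k \<omega> \<le> ennreal (exp (\<kappa> * (t k - t 0))) * (\<Sum>j<k. ?D j \<omega>)"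
        using elim \<open>\<kappa> \<ge> 0\<close> t_le k by (intro discrete_gronwall_ennreal[where M = M]) auto
      also have "\<dots> \<le> ennreal a * (\<Sum>j<M. ?D j \<omega>)"
      proof (rule mult_mono)
        have "\<kappa> * (t k - t 0) \<le> \<kappa> * (T - t0)"
          using \<open>\<kappa> \<ge> 0\<close> t_in[OF k] t_0 by (intro mult_left_mono) auto
        then show "ennreal (exp (\<kappa> * (t k - t 0))) \<le> ennreal a"
          unfolding a_def by (intro ennreal_leI) simp
        show "(\<Sum>j<k. ?D j \<omega>) \<le> (\<Sum>j<M. ?D j \<omega>)"
          using k by (intro sum_mono2) auto
      qed auto
      finally show ?case .
    qed
    then have "mean_sq P (\<lambda>\<omega>. ?e k \<omega>) \<le> mean_sq P (\<lambda>\<omega>. ennreal a * (\<Sum>j<M. ?D j \<omega>))"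
      by (intro nn_integral_mono_AE) (auto elim!: eventually_mono intro: power_mono)
    also have "\<dots> \<le> ennreal (a\<^sup>2 * (B * max_step M t powr (2 * H)))"
    proof (rule nn_integral_square_cmult_le)
      show "mean_sq P (\<lambda>\<omega>. \<Sum>j<M. ?D j \<omega>) \<le> ennreal (B * max_step M t powr (2 * H))"
        using B(2)[rule_format, OF grid] .
    qed (simp_all add: a_def)
    finally show "mean_sq P (\<lambda>\<omega>. ?e k \<omega>) \<le> ennreal (a\<^sup>2 * B * max_step M t powr (2 * H))"
      by (simp add: mult.assoc)
  qed
qed

end

section \<open>Stochastic convolutions with fractional Brownian motion\<close>

text \<open>
  The covariance formula alone does not give square integrability, since the expectation of a
  function that is not integrable is zero by convention.
\<close>
lemma gaussian_rv_square_integrable: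
  assumes "prob_space P" "gaussian_rv P X"
  shows "integrable P (\<lambda>\<omega>. (X \<omega>)\<^sup>2)"
proof -
  interpret prob_space P by fact
  have [measurable]: "X \<in> borel_measurable P" using assms(2) by (simp add: gaussian_rv_def)
  from assms(2) obtain m \<sigma> where
    "(\<sigma> > 0 \<and> distributed P lborel X (normal_density m \<sigma>)) \<or> (AE \<omega> in P. X \<omega> = m)"
    unfolding gaussian_rv_def by (elim conjE exE)
  then show ?thesis
  proof (elim disjE conjE)
    assume \<sigma>: "\<sigma> > 0" and dist: "distributed P lborel X (\<lambda>x. ennreal (normal_density m \<sigma> x))"
    have "integrable lborel (\<lambda>x. normal_density m \<sigma> x * (x - m) ^ 2
        + (2 * m) * (normal_density m \<sigma> x * (x - m) ^ 1) + m\<^sup>2 * (normal_density m \<sigma> x * (x - m) ^ 0))"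
      using \<sigma> by (intro Bochner_Integration.integrable_add integrable_mult_right integrable_normal_moment)
    also have "(\<lambda>x. normal_density m \<sigma> x * (x - m) ^ 2
        + (2 * m) * (normal_density m \<sigma> x * (x - m) ^ 1) + m\<^sup>2 * (normal_density m \<sigma> x * (x - m) ^ 0))
        = (\<lambda>x. normal_density m \<sigma> x * x\<^sup>2)"
      by (rule ext) (simp add: power2_eq_square algebra_simps)
    finally show ?thesis
      using distributed_integrable[OF dist, of "\<lambda>x. x\<^sup>2"] by simp
  next
    assume "AE \<omega> in P. X \<omega> = m"
    then have "AE \<omega> in P. (X \<omega>)\<^sup>2 = m\<^sup>2" by eventually_elim simp
    then have "integrable P (\<lambda>\<omega>. (X \<omega>)\<^sup>2) \<longleftrightarrow> integrable P (\<lambda>\<omega>. m\<^sup>2)"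
      by (intro integrable_cong_AE) auto
    then show ?thesis by simp
  qed
qed

lemma fractional_process_if_fbm:
  assumes "prob_space P" "1 / 2 < H" "H < 1" "fractional_brownian_motion P H W"
  shows "fractional_process P H W"
proof -
  interpret prob_space P by fact
  have gauss: "gaussian_rv P (W t)" for t
  proof -
    have "\<forall>S c. finite S \<longrightarrow> gaussian_rv P (\<lambda>\<omega>. \<Sum>t\<in>S. c t * W t \<omega>)"
      using assms(4) unfolding fractional_brownian_motion_def gaussian_process_def by (elim conjE)
    from this[rule_format, of "{t}" "\<lambda>_. 1"] show ?thesis by simp
  qed
  then have meas: "W t \<in> borel_measurable P" for t by (simp add: gaussian_rv_def)
  show ?thesis
  proof
    show "W t \<in> borel_measurable P" for t by (rule meas)
    show "integrable P (\<lambda>\<omega>. W t \<omega> * W s \<omega>)" for t s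
    proof (rule Bochner_Integration.integrable_bound)
      show "integrable P (\<lambda>\<omega>. (W t \<omega>)\<^sup>2 + (W s \<omega>)\<^sup>2)"
        using gaussian_rv_square_integrable[OF assms(1) gauss] by simp
      have "\<bar>x * y\<bar> \<le> x\<^sup>2 + y\<^sup>2" for x y :: real
      proof -
        have "2 * (\<bar>x\<bar> * \<bar>y\<bar>) \<le> x\<^sup>2 + y\<^sup>2" using sum_squares_bound[of "\<bar>x\<bar>" "\<bar>y\<bar>"] by simp
        moreover have "0 \<le> \<bar>x\<bar> * \<bar>y\<bar>" by simp
        ultimately show ?thesis unfolding abs_mult by linarith
      qed
      then show "AE \<omega> in P. norm (W t \<omega> * W s \<omega>) \<le> norm ((W t \<omega>)\<^sup>2 + (W s \<omega>)\<^sup>2)" by simp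
    qed (use meas in measurable)
  qed (use assms in \<open>simp_all add: fractional_brownian_motion_def\<close>)
qed

lemma borel_measurable_mat_exp_vector:
  fixes b :: "real \<Rightarrow> real^'n" and A :: "real^'n^'n"
  assumes [measurable]: "b \<in> borel_measurable borel"
  shows "(\<lambda>s. flow A (t - s) (b s)) \<in> borel_measurable borel"
proof (rule borel_measurable_continuous_Pair[where H="(*v)", OF _ assms])
  show "(\<lambda>s. mat_exp ((t - s) *\<^sub>R A)) \<in> borel_measurable borel"
    by (intro borel_measurable_continuous_onI continuous_on_compose2[OF continuous_on_mat_exp]
        continuous_intros) auto
  show "continuous_on UNIV (\<lambda>z :: (real^'n^'n) \<times> (real^'n). fst z *v snd z)"
    by (intro mv.continuous_on continuous_intros)
qed

definition flow_kernel :: "real^'n^'n \<Rightarrow> (real \<Rightarrow> real^'n) \<Rightarrow> real \<Rightarrow> real \<Rightarrow> real \<Rightarrow> real^'n" where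
  "flow_kernel A b r t s = indicat_real {r..t} s *\<^sub>R (flow A (t - s) (b s))"

lemma flow_kernel_measurable [measurable]:
  assumes [measurable]: "b \<in> borel_measurable borel"
  shows "flow_kernel A b r t \<in> borel_measurable borel"
  unfolding flow_kernel_def[abs_def] using borel_measurable_mat_exp_vector[OF assms] by measurable

context fractional_process
begin

context
  fixes A :: "real^'n^'n" and b :: "real \<Rightarrow> real^'n" and c \<beta> R :: real
  assumes b_measurable [measurable]: "b \<in> borel_measurable borel"
    and b_le: "\<And>s. norm (b s) \<le> \<beta>"
    and flow_le: "\<And>s x. 0 \<le> s \<Longrightarrow> s \<le> R \<Longrightarrow> norm (flow A s x) \<le> c * norm x"
    and c_nonneg: "c \<ge> 0"
begin

lemma norm_flow_le:
  assumes "r \<le> s" "s \<le> t" "t - r \<le> R"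
  shows "norm (flow A (t - s) (b s)) \<le> c * \<beta>"
proof -
  have "norm (flow A (t - s) (b s)) \<le> c * norm (b s)" using assms by (intro flow_le) auto
  also have "\<dots> \<le> c * \<beta>" by (intro mult_left_mono b_le c_nonneg)
  finally show ?thesis .
qed

lemma wiener_limit_flow_kernel:
  assumes "is_fbm_integral P H W (\<lambda>s. flow A (t - s) (g s)) r t X"
    and "\<And>s. s \<in> {r..t} \<Longrightarrow> g s = b s" "r \<le> t" "t - r \<le> R"
  shows "wiener_limit (flow_kernel A b r t) X"
  using assms(1)
proof (rule wiener_limit_if_is_fbm_integral)
  have "c * \<beta> \<ge> 0" using order_trans[OF norm_ge_zero b_le] c_nonneg by simp
  show "norm (flow_kernel A b r t s) \<le> c * \<beta>" for s
    using norm_flow_le[of r s t] assms(4) \<open>c * \<beta> \<ge> 0\<close> by (simp add: flow_kernel_def split: split_indicator)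
  show "flow_kernel A b r t s = indicat_real {r..t} s *\<^sub>R (flow A (t - s) (g s))" for s
    using assms(2)[of s] by (simp add: flow_kernel_def split: split_indicator)
qed (use assms(3) in auto)

lemma flow_kernel_L2_le:
  assumes "wiener_limit (flow_kernel A b r t) X" "r \<le> t" "t - r \<le> R"
  shows "norm_mean_sq P X \<le> ennreal (4 * (c * \<beta>)\<^sup>2 * (t - r) powr (2 * H))"
  using assms(1)
proof (rule wiener_limit_L2_le_interval)
  show "norm (flow_kernel A b r t s) \<le> c * \<beta> * indicat_real {r..t} s" for s
    using norm_flow_le[of r s t] assms(3) by (simp add: flow_kernel_def split: split_indicator)
qed (rule assms(2))

text \<open>
  The integrand over \<open>[a, t]\<close> is the propagated integrand over \<open>[a, r]\<close> plus the integrand over \<open>[r, t]\<close>. At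
  \<open>s = r\<close> the latter two overlap.
\<close>
lemma flow_kernel_split:
  assumes "a \<le> r" "r \<le> t" "s \<noteq> r"
  shows "flow_kernel A b a t s - flow A (t - r) (flow_kernel A b a r s) = flow_kernel A b r t s"
proof -
  have "mat_exp ((t - s) *\<^sub>R A) = mat_exp ((t - r) *\<^sub>R A) ** mat_exp ((r - s) *\<^sub>R A)"
    using mat_exp_add[of "t - r" "r - s" A] by simp
  then have eq: "flow A (t - s) (b s) = flow A (t - r) (flow A (r - s) (b s))"
    by (simp only: matrix_vector_mul_assoc)
  have "s < a \<or> (a \<le> s \<and> s < r) \<or> (r < s \<and> s \<le> t) \<or> t < s" using assms(3) by linarith
  then show ?thesis
  proof (elim disjE conjE)
    assume "a \<le> s" "s < r"
    then show ?thesis using assms(1,2) unfolding flow_kernel_def by (simp add: eq[symmetric])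
  qed (use assms(1,2) in \<open>simp_all add: flow_kernel_def\<close>)
qed

text \<open>
  The noise that the solution gathers during a step, defined through integrals starting at the
  initial time, equals the integral over the step that the scheme uses.
\<close>
lemma wiener_limit_flow_kernel_increment:
  assumes "wiener_limit (flow_kernel A b a t) X" "wiener_limit (flow_kernel A b a r) Y"
    "wiener_limit (flow_kernel A b r t) Z" "a \<le> r" "r \<le> t"
  shows "AE \<omega> in P. X \<omega> - flow A (t - r) (Y \<omega>) = Z \<omega>"
proof -
  have "wiener_limit (\<lambda>s. flow_kernel A b a t s - flow A (t - r) (flow_kernel A b a r s) - flow_kernel A b r t s)
      (\<lambda>\<omega>. X \<omega> - flow A (t - r) (Y \<omega>) - Z \<omega>)"
    by (rule wiener_limit_diff[OF wiener_limit_diff[OF assms(1)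
          wiener_limit_linear[OF matrix_vector_mul_bounded_linear assms(2)]] assms(3)])
  then have "AE \<omega> in P. X \<omega> - flow A (t - r) (Y \<omega>) - Z \<omega> = 0"
  proof (rule wiener_limit_AE_zero)
    show "AE s in lborel. flow_kernel A b a t s - flow A (t - r) (flow_kernel A b a r s) - flow_kernel A b r t s = 0"
    using AE_lborel_singleton[of r] by eventually_elim (simp add: flow_kernel_split[OF assms(4,5)])
  qed
  then show ?thesis by eventually_elim simp
qed

lemma flow_kernel_increment_L2_le:
  assumes "wiener_limit (flow_kernel A b a t) X" "wiener_limit (flow_kernel A b a r) Y"
    "a \<le> r" "r \<le> t" "t - r \<le> R"
  shows "norm_mean_sq P (\<lambda>\<omega>. X \<omega> - flow A (t - r) (Y \<omega>))
    \<le> ennreal (4 * (c * \<beta>)\<^sup>2 * (t - r) powr (2 * H))"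
proof (rule order_trans[OF wiener_limit_L2_le])
  show "wiener_limit (\<lambda>s. flow_kernel A b a t s - flow A (t - r) (flow_kernel A b a r s))
      (\<lambda>\<omega>. X \<omega> - flow A (t - r) (Y \<omega>))"
    by (rule wiener_limit_diff[OF assms(1) wiener_limit_linear[OF matrix_vector_mul_bounded_linear assms(2)]])
  have "c * \<beta> \<ge> 0" using order_trans[OF norm_ge_zero b_le] c_nonneg by simp
  have "energy (\<lambda>s. flow_kernel A b a t s - flow A (t - r) (flow_kernel A b a r s))
      \<le> energy (\<lambda>s. flow_kernel A b r t s)"
  proof (rule fbm_energy_mono)
    show "AE s in lborel. ennreal (norm (flow_kernel A b a t s - flow A (t - r) (flow_kernel A b a r s)))
        \<le> ennreal (norm (flow_kernel A b r t s))"
      using AE_lborel_singleton[of r] by eventually_elim (simp add: flow_kernel_split[OF assms(3,4)])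
  qed
  also have "\<dots> \<le> ennreal ((c * \<beta>)\<^sup>2 * (t - r) powr (2 * H))"
  proof (rule fbm_energy_indicator_le)
    fix s
    have "norm (flow_kernel A b r t s) \<le> c * \<beta> * indicat_real {r..t} s"
      using norm_flow_le[of r s t] assms(5) by (simp add: flow_kernel_def split: split_indicator)
    from ennreal_leI[OF this] show "ennreal (norm (flow_kernel A b r t s)) \<le> ennreal (c * \<beta>) * indicator {r..t} s"
      by (simp split: split_indicator_asm split_indicator)
  qed (use H assms(4) \<open>c * \<beta> \<ge> 0\<close> in auto)
  finally have "4 * energy (\<lambda>s. flow_kernel A b a t s - flow A (t - r) (flow_kernel A b a r s))
      \<le> 4 * ennreal ((c * \<beta>)\<^sup>2 * (t - r) powr (2 * H))"
    by (rule mult_left_mono) simp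
  also have "\<dots> = ennreal (4 * (c * \<beta>)\<^sup>2 * (t - r) powr (2 * H))"
    by (simp add: ennreal_mult' mult.assoc)
  finally show "4 * energy (\<lambda>s. flow_kernel A b a t s - flow A (t - r) (flow_kernel A b a r s))
      \<le> ennreal (4 * (c * \<beta>)\<^sup>2 * (t - r) powr (2 * H))" .
qed

end

end

lemma nn_integral_square_norm_sum_le:
  fixes X :: "'i \<Rightarrow> 'w \<Rightarrow> 'v::euclidean_space"
  assumes [measurable]: "\<And>i. i \<in> I \<Longrightarrow> X i \<in> borel_measurable P"
    and bound: "\<And>i. i \<in> I \<Longrightarrow> norm_mean_sq P (\<lambda>\<omega>. X i \<omega>) \<le> ennreal B" and "B \<ge> 0"
  shows "mean_sq P (\<lambda>\<omega>. ennreal (norm (\<Sum>i\<in>I. X i \<omega>))) \<le> ennreal ((real (card I))\<^sup>2 * B)"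
proof -
  have "(norm (\<Sum>i\<in>I. X i \<omega>))\<^sup>2 \<le> real (card I) * (\<Sum>i\<in>I. (norm (X i \<omega>))\<^sup>2)" for \<omega>
  proof -
    have "(norm (\<Sum>i\<in>I. X i \<omega>))\<^sup>2 \<le> (\<Sum>i\<in>I. norm (X i \<omega>))\<^sup>2"
      by (intro power_mono norm_sum) simp
    also have "\<dots> \<le> real (card I) * (\<Sum>i\<in>I. (norm (X i \<omega>))\<^sup>2)"
      using Cauchy_Schwarz_ineq_sum[of "\<lambda>_. 1" "\<lambda>i. norm (X i \<omega>)" I] by simp
    finally show ?thesis .
  qed
  then have "mean_sq P (\<lambda>\<omega>. ennreal (norm (\<Sum>i\<in>I. X i \<omega>)))
      \<le> (\<integral>\<^sup>+\<omega>. ennreal (real (card I)) * (\<Sum>i\<in>I. ennreal ((norm (X i \<omega>))\<^sup>2)) \<partial>P)"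
    by (intro nn_integral_mono)
       (simp add: ennreal_power sum_ennreal sum_nonneg ennreal_mult[symmetric] ennreal_leI)
  also have "\<dots> = ennreal (real (card I)) * (\<Sum>i\<in>I. \<integral>\<^sup>+\<omega>. ennreal ((norm (X i \<omega>))\<^sup>2) \<partial>P)"
    by (subst nn_integral_cmult, measurable, subst nn_integral_sum) auto
  also have "\<dots> \<le> ennreal (real (card I)) * (\<Sum>i\<in>I. ennreal B)"
    by (intro mult_left_mono sum_mono bound) auto
  also have "\<dots> = ennreal ((real (card I))\<^sup>2 * B)"
    using \<open>B \<ge> 0\<close> by (simp add: power2_eq_square ennreal_mult'[symmetric] ennreal_of_nat_eq_real_of_nat mult.assoc)
  finally show ?thesis .
qed

section \<open>Convergence of the exponential Euler scheme\<close>

theorem theorem3p2: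
  fixes P :: "'w measure" and H t0 T D K M L :: real and m :: nat
    and B :: "nat \<Rightarrow> real \<Rightarrow> 'w \<Rightarrow> real"
    and A :: "real^'n^'n"
    and f :: "real \<Rightarrow> real^'n \<Rightarrow> real^'n"
    and b :: "nat \<Rightarrow> real \<Rightarrow> real^'n"
    and u0 :: "'w \<Rightarrow> real^'n"
    and U :: "real \<Rightarrow> 'w \<Rightarrow> real^'n"
  assumes "prob_space P"
    and "1 / 2 < H" and "H < 1"
    and "t0 < T"
    and "independent_fbms P H m B"
    and "invertible A"
    and "\<forall>i\<in>{1..m}. b i \<in> borel_measurable (restrict_space borel {t0..T})"
    and "u0 \<in> borel_measurable P"
    and "integrable P (\<lambda>\<omega>. (norm (u0 \<omega>))\<^sup>2)"
    and "integrable P (\<lambda>\<omega>. (norm (A *v u0 \<omega>))\<^sup>2)"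
    and "continuous_on ({t0..T} \<times> UNIV) (\<lambda>(t, x). f t x)"
    and "D > 0" and "K > 0"
    and "\<forall>t\<in>{t0..T}. \<forall>x. norm (f t x) \<le> D * (1 + norm x)"
    and "\<forall>t\<in>{t0..T}. \<forall>s\<in>{t0..T}. \<forall>x y.
           norm (f t x - f s y) \<le> K * (\<bar>t - s\<bar> + norm (x - y))"
    and "\<forall>i\<in>{1..m}. \<forall>t\<in>{t0..T}. (norm (b i t))\<^sup>2 \<le> M"
    and "L > 0"
    and "\<forall>t\<in>{t0..T}. \<forall>s\<in>{t0..T}. s < t \<longrightarrow>
           mat_norm (A ** mat_exp ((t - s) *\<^sub>R A)) \<le> L / (t - s) \<and>
           mat_norm (matrix_inv A ** (mat 1 - mat_exp ((t - s) *\<^sub>R A))) \<le> L * (t - s)"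
    and "bdd_above ((\<lambda>t. exp (log_norm A * (t - t0))) ` {t0..T})"
    and "is_solution P H m B t0 T A f b u0 U"
  shows "\<forall>\<epsilon>>0. \<exists>C>0. \<forall>N\<ge>2. \<forall>t V.
           time_grid t0 T N t \<longrightarrow> is_exponential_euler P H m B A f b u0 N t V \<longrightarrow>
             (\<forall>k\<in>{0..N}. integrable P (\<lambda>\<omega>. (norm (U (t k) \<omega> - V k \<omega>))\<^sup>2)) \<and>
             (SUP k\<in>{0..N}. sqrt (prob_space.expectation P (\<lambda>\<omega>. (norm (U (t k) \<omega> - V k \<omega>))\<^sup>2)))
               \<le> C * max_step N t powr (H - \<epsilon>)"
proof -
  interpret prob_space P by fact
  note H = assms(2,3) and t0T = assms(4) and D = assms(12) and K = assms(13)
  \<comment> \<open>Clamping time to \<open>[t0, T]\<close> extends all coefficients and the solution to the whole line without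
    changing the equation, and preserves the Lipschitz, growth and measurability properties.\<close>
  define \<tau> where "\<tau> s = max t0 (min T s)" for s
  have \<tau>_in: "\<tau> s \<in> {t0..T}" for s using t0T by (auto simp: \<tau>_def)
  have \<tau>_id: "\<tau> s = s" if "s \<in> {t0..T}" for s using that by (auto simp: \<tau>_def)
  have \<tau>_lip: "\<bar>\<tau> s - \<tau> r\<bar> \<le> \<bar>s - r\<bar>" for s r by (auto simp: \<tau>_def max_def min_def)
  have \<tau>_cont: "continuous_on UNIV \<tau>" unfolding \<tau>_def[abs_def] by (intro continuous_intros)
  have \<tau>_measurable: "\<tau> \<in> borel \<rightarrow>\<^sub>M restrict_space borel {t0..T}"
    using \<tau>_in by (intro measurable_restrict_space2 borel_measurable_continuous_onI \<tau>_cont) auto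
  define f' where "f' s x = f (\<tau> s) x" for s x
  define U' where "U' s \<omega> = U (\<tau> s) \<omega>" for s \<omega>
  define b' where "b' i s = b i (\<tau> s)" for i s
  define \<beta> where "\<beta> = sqrt \<bar>M\<bar>"
  obtain c where c: "c \<ge> 1"
    "\<And>s x. 0 \<le> s \<Longrightarrow> s \<le> T - t0 \<Longrightarrow> norm (flow A s x) \<le> c * norm x"
    "\<And>s x. 0 \<le> s \<Longrightarrow> s \<le> T - t0 \<Longrightarrow> norm (flow A s x - x) \<le> c * s * norm x"
    using mat_exp_bounds[of "T - t0" A] by metis
  have "c \<ge> 0" using c(1) by simp
  have fp: "fractional_process P H (B i)" if "i \<in> {1..m}" for i
    using assms(5) that unfolding independent_fbms_def
    by (intro fractional_process_if_fbm[OF assms(1) H]) (elim conjE, rule bspec)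
  have b'_measurable: "b' i \<in> borel_measurable borel" if "i \<in> {1..m}" for i
    unfolding b'_def[abs_def] using measurable_compose[OF \<tau>_measurable] assms(7) that by (elim ballE) auto
  have b'_le: "norm (b' i s) \<le> \<beta>" if "i \<in> {1..m}" for i s
  proof -
    have "(norm (b' i s))\<^sup>2 \<le> M" unfolding b'_def using assms(16) that \<tau>_in by (elim ballE) auto
    then have "(norm (b' i s))\<^sup>2 \<le> \<bar>M\<bar>" by simp
    then show ?thesis unfolding \<beta>_def by (rule real_le_rsqrt)
  qed
  have wiener: "fractional_process.wiener_limit P H (B i) (flow_kernel A (b' i) r t) X"
    if "is_fbm_integral P H (B i) (\<lambda>s. flow A (t - s) (b i s)) r t X" "i \<in> {1..m}"
      "t0 \<le> r" "r \<le> t" "t \<le> T" for i r t X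
  proof (rule fractional_process.wiener_limit_flow_kernel[OF fp[OF that(2)] b'_measurable[OF that(2)]
        b'_le[OF that(2)] c(2) \<open>c \<ge> 0\<close> that(1)])
    show "b i s = b' i s" if "s \<in> {r..t}" for s
      unfolding b'_def using that \<open>t0 \<le> r\<close> \<open>t \<le> T\<close> by (subst \<tau>_id) auto
    show "r \<le> t" by (rule that(4))
    show "t - r \<le> T - t0" using that(3,5) by linarith
  qed
  define J_ok where "J_ok t J \<longleftrightarrow>
        (\<forall>i\<in>{1..m}. is_fbm_integral P H (B i) (\<lambda>s. flow A (t - s) (b i s)) t0 t (J i)) \<and>
        (AE \<omega> in P.
           set_integrable lborel {t0..t} (\<lambda>s. flow A (t - s) (f s (U s \<omega>))) \<and>
           U t \<omega> = flow A (t - t0) (u0 \<omega>)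
                   + (LINT s:{t0..t}|lborel. flow A (t - s) (f s (U s \<omega>)))
                   + (\<Sum>i=1..m. J i \<omega>))" for t J
  note solution = assms(20)[unfolded is_solution_def]
  note U_measurable = conjunct1[OF solution]
  have J_exists: "\<exists>J. J_ok t J" if "t \<in> {t0..T}" for t
    unfolding J_ok_def by (rule bspec[OF conjunct2[OF solution] that])
  define J where "J t = (SOME J. J_ok t J)" for t
  have J: "J_ok t (J t)" if "t \<in> {t0..T}" for t
    unfolding J_def using J_exists[OF that] by (rule someI_ex)
  define N where "N t \<omega> = (if t \<in> {t0..T} then (\<Sum>i=1..m. J t i \<omega>) else 0)" for t \<omega>
  have J_int: "is_fbm_integral P H (B i) (\<lambda>s. flow A (t - s) (b i s)) t0 t (J t i)"
    if "t \<in> {t0..T}" "i \<in> {1..m}" for t i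
    using J[OF that(1)] that(2) unfolding J_ok_def by (elim conjE) (rule bspec)
  have J_wiener: "fractional_process.wiener_limit P H (B i) (flow_kernel A (b' i) t0 t) (J t i)"
    if "t \<in> {t0..T}" "i \<in> {1..m}" for t i
    using that by (intro wiener J_int) auto
  have J_measurable: "J t i \<in> borel_measurable P" if "t \<in> {t0..T}" "i \<in> {1..m}" for t i
    using J_int[OF that] by (simp add: is_fbm_integral_def)
  have N_measurable: "N t \<in> borel_measurable P" for t
  proof (cases "t \<in> {t0..T}")
    case True
    then show ?thesis unfolding N_def[abs_def] using J_measurable[OF True] by (simp add: borel_measurable_sum)
  next
    case False
    then have "N t = (\<lambda>_. 0)" unfolding N_def[abs_def] by (simp only: if_False)
    then show ?thesis by simp
  qed
  have N_eq: "N t \<omega> = (\<Sum>i=1..m. J t i \<omega>)" if "t \<in> {t0..T}" for t \<omega>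
    using that by (simp add: N_def)
  define v where "v = 4 * (c * \<beta>)\<^sup>2"
  have "v \<ge> 0" by (simp add: v_def)
  define Cn where "Cn = (real m)\<^sup>2 * (v * (1 + (T - t0) powr (2 * H)))"
  have N_L2: "mean_sq P (\<lambda>\<omega>. ennreal (norm (N t \<omega>))) \<le> ennreal ((real m)\<^sup>2 * (v * (t - t0) powr (2 * H)))"
    if t: "t \<in> {t0..T}" for t
  proof -
    have "mean_sq P (\<lambda>\<omega>. ennreal (norm (\<Sum>i=1..m. J t i \<omega>)))
        \<le> ennreal ((real (card {1..m}))\<^sup>2 * (v * (t - t0) powr (2 * H)))"
    proof (rule nn_integral_square_norm_sum_le)
      fix i assume i: "i \<in> {1..m}"
      show "J t i \<in> borel_measurable P" using t i by (rule J_measurable)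
      show "norm_mean_sq P (\<lambda>\<omega>. J t i \<omega>) \<le> ennreal (v * (t - t0) powr (2 * H))"
        unfolding v_def
        by (rule fractional_process.flow_kernel_L2_le[OF fp[OF i] b'_measurable[OF i] b'_le[OF i] c(2)
              \<open>c \<ge> 0\<close> J_wiener[OF t i]]) (use t in auto)
    qed (use \<open>v \<ge> 0\<close> in simp)
    then show ?thesis by (simp add: N_eq[OF t])
  qed
  have N_increment: "mean_sq P (\<lambda>\<omega>. ennreal (norm (N t \<omega> - flow A (t - r) (N r \<omega>))))
      \<le> ennreal ((real m)\<^sup>2 * (v * (t - r) powr (2 * H)))"
    if rt: "t0 \<le> r" "r \<le> t" "t \<le> T" for r t
  proof -
    have r: "r \<in> {t0..T}" and t: "t \<in> {t0..T}" using rt by auto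
    have step_le: "t - r \<le> T - t0" using rt by linarith
    let ?X = "\<lambda>i \<omega>. J t i \<omega> - flow A (t - r) (J r i \<omega>)"
    have "mean_sq P (\<lambda>\<omega>. ennreal (norm (\<Sum>i=1..m. ?X i \<omega>)))
        \<le> ennreal ((real (card {1..m}))\<^sup>2 * (v * (t - r) powr (2 * H)))"
    proof (rule nn_integral_square_norm_sum_le)
      fix i assume i: "i \<in> {1..m}"
      have "(\<lambda>\<omega>. flow A (t - r) (J r i \<omega>)) \<in> borel_measurable P"
        by (rule measurable_compose[OF J_measurable[OF r i] borel_measurable_continuous_onI])
           (intro linear_continuous_on matrix_vector_mul_bounded_linear)
      then show "?X i \<in> borel_measurable P"
        by (rule borel_measurable_diff[OF J_measurable[OF t i]])
      show "norm_mean_sq P (\<lambda>\<omega>. ?X i \<omega>) \<le> ennreal (v * (t - r) powr (2 * H))"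
        unfolding v_def
        by (rule fractional_process.flow_kernel_increment_L2_le[OF fp[OF i] b'_measurable[OF i] b'_le[OF i] c(2)
              \<open>c \<ge> 0\<close> J_wiener[OF t i] J_wiener[OF r i] rt(1,2) step_le])
    qed (use \<open>v \<ge> 0\<close> in simp)
    moreover have "(\<Sum>i=1..m. ?X i \<omega>) = N t \<omega> - flow A (t - r) (N r \<omega>)" for \<omega>
      unfolding N_eq[OF t] N_eq[OF r] by (simp add: sum_subtractf mv.sum_right)
    ultimately show ?thesis by simp
  qed
  define m0 where "m0 = expectation (\<lambda>\<omega>. (norm (u0 \<omega>))\<^sup>2)"
  interpret mild: mild_solution P t0 T H D K c m0 Cn A f' u0 U' N
  proof unfold_locales
    show "t0 < T" "1 / 2 < H" "H < 1" "0 < D" "0 < K" "1 \<le> c" "invertible A" "u0 \<in> borel_measurable P"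
      by (fact assms c(1))+
    show "0 \<le> m0" by (simp add: m0_def)
    show "0 \<le> Cn" using \<open>v \<ge> 0\<close> by (simp add: Cn_def)
    show "norm (flow A s x) \<le> c * norm x"
      "norm (flow A s x - x) \<le> c * s * norm x" if "0 \<le> s" "s \<le> T - t0" for s x
      using c(2,3)[OF that] by blast+
    have "continuous_on UNIV (\<lambda>z. (\<lambda>(t, x). f t x) (\<tau> (fst z), snd z))"
      using \<tau>_in by (intro continuous_on_compose2[OF assms(11)] continuous_intros
          continuous_on_compose2[OF \<tau>_cont]) auto
    then show "(\<lambda>z. f' (fst z) (snd z)) \<in> borel_measurable (borel \<Otimes>\<^sub>M borel)"
      unfolding borel_prod f'_def by (intro borel_measurable_continuous_onI) simp
    show "norm (f' s x) \<le> D * (1 + norm x)" for s x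
      unfolding f'_def using assms(14) \<tau>_in by simp
    show "norm (f' s x - f' r y) \<le> K * (\<bar>s - r\<bar> + norm (x - y))" for s r x y
    proof -
      have "norm (f' s x - f' r y) \<le> K * (\<bar>\<tau> s - \<tau> r\<bar> + norm (x - y))"
        unfolding f'_def using assms(15)[rule_format, OF \<tau>_in \<tau>_in] .
      also have "\<dots> \<le> K * (\<bar>s - r\<bar> + norm (x - y))"
        using \<tau>_lip K by (intro mult_left_mono add_right_mono) auto
      finally show ?thesis .
    qed
    have "(\<lambda>z. (\<tau> (fst z), snd z)) \<in> borel \<Otimes>\<^sub>M P \<rightarrow>\<^sub>M restrict_space borel {t0..T} \<Otimes>\<^sub>M P"
      by (intro measurable_Pair measurable_compose[OF measurable_fst \<tau>_measurable] measurable_snd)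
    from measurable_compose[OF this U_measurable]
    show "(\<lambda>z. U' (fst z) (snd z)) \<in> borel_measurable (borel \<Otimes>\<^sub>M P)" by (simp add: U'_def)
    have "mean_sq P (\<lambda>\<omega>. ennreal (norm (u0 \<omega>))) = norm_mean_sq P u0"
      by (simp add: ennreal_power)
    also have "\<dots> = ennreal m0"
      unfolding m0_def by (rule nn_integral_eq_integral[OF assms(9)]) simp
    finally show "mean_sq P (\<lambda>\<omega>. ennreal (norm (u0 \<omega>))) \<le> ennreal m0" by simp
    show "N t \<in> borel_measurable P" for t by (rule N_measurable)
    have "mean_sq P (\<lambda>\<omega>. ennreal (norm (N t0 \<omega>))) = 0" using N_L2[of t0] t0T by simp
    then have "AE \<omega> in P. (ennreal (norm (N t0 \<omega>)))\<^sup>2 = 0"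
      using N_measurable[of t0] by (subst (asm) nn_integral_0_iff_AE) measurable
    then show "AE \<omega> in P. N t0 \<omega> = 0" by eventually_elim simp
    show "mean_sq P (\<lambda>\<omega>. ennreal (norm (N t \<omega>))) \<le> ennreal Cn" if "t \<in> {t0..T}" for t
    proof (rule order_trans[OF N_L2[OF that] ennreal_leI])
      have "(t - t0) powr (2 * H) \<le> (T - t0) powr (2 * H)" using that H by (intro powr_mono2) auto
      then show "(real m)\<^sup>2 * (v * (t - t0) powr (2 * H)) \<le> Cn"
        unfolding Cn_def using \<open>v \<ge> 0\<close> by (intro mult_left_mono) auto
    qed
    show "mean_sq P (\<lambda>\<omega>. ennreal (norm (N t \<omega> - flow A (t - r) (N r \<omega>))))
        \<le> ennreal (Cn * (t - r) powr (2 * H))" if "t0 \<le> r" "r \<le> t" "t \<le> T" for r t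
    proof (rule order_trans[OF N_increment[OF that] ennreal_leI])
      have "(real m)\<^sup>2 * (v * 1) * (t - r) powr (2 * H) \<le> Cn * (t - r) powr (2 * H)"
        unfolding Cn_def using \<open>v \<ge> 0\<close> by (intro mult_right_mono mult_left_mono) auto
      then show "(real m)\<^sup>2 * (v * (t - r) powr (2 * H)) \<le> Cn * (t - r) powr (2 * H)" by (simp add: mult.assoc)
    qed
    show "AE \<omega> in P. set_integrable lborel {t0..t} (\<lambda>s. flow A (t - s) (f' s (U' s \<omega>))) \<and>
      U' t \<omega> = flow A (t - t0) (u0 \<omega>)
        + (LINT s:{t0..t}|lborel. flow A (t - s) (f' s (U' s \<omega>))) + N t \<omega>"
      if t: "t \<in> {t0..T}" for t
    proof -
      have eq: "f' s (U' s \<omega>) = f s (U s \<omega>)" if "s \<in> {t0..t}" for s \<omega>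
        using that t by (simp add: f'_def U'_def \<tau>_id)
      have "set_integrable lborel {t0..t} (\<lambda>s. flow A (t - s) (f' s (U' s \<omega>)))
          \<longleftrightarrow> set_integrable lborel {t0..t} (\<lambda>s. flow A (t - s) (f s (U s \<omega>)))" for \<omega>
        by (rule set_integrable_cong) (simp_all only: eq)
      moreover have "(LINT s:{t0..t}|lborel. flow A (t - s) (f' s (U' s \<omega>)))
          = (LINT s:{t0..t}|lborel. flow A (t - s) (f s (U s \<omega>)))" for \<omega>
        by (rule set_lebesgue_integral_cong) (simp_all add: eq)
      moreover have "U' t \<omega> = U t \<omega>" for \<omega> using t by (simp add: U'_def \<tau>_id)
      ultimately show ?thesis
        using J[OF t] by (simp only: J_ok_def N_eq[OF t])
    qed
  qed
  obtain C where "C \<ge> 0" and C: "\<forall>M t V. time_grid t0 T M t \<longrightarrow> (AE \<omega> in P. V 0 \<omega> = u0 \<omega>) \<longrightarrow>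
    (\<forall>k<M. AE \<omega> in P. V (Suc k) \<omega> = mild.euler_step (t k) (t (Suc k)) (V k \<omega>)
        + mild.noise_increment (t k) (t (Suc k)) \<omega>) \<longrightarrow>
    (\<forall>k\<le>M. mean_sq P (\<lambda>\<omega>. ennreal (norm (U' (t k) \<omega> - V k \<omega>)))
        \<le> ennreal (C * max_step M t powr (2 * H)))"
    using mild.euler_scheme_L2_error by (elim exE conjE)
  show ?thesis
  proof (intro allI impI)
    fix \<epsilon> :: real assume "\<epsilon> > 0"
    define C' where "C' = sqrt C * (T - t0) powr \<epsilon> + 1"
    have "C' > 0" using \<open>C \<ge> 0\<close> by (simp add: C'_def add_nonneg_pos)
    show "\<exists>C>0. \<forall>N\<ge>2. \<forall>t V.
           time_grid t0 T N t \<longrightarrow> is_exponential_euler P H m B A f b u0 N t V \<longrightarrow>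
             (\<forall>k\<in>{0..N}. integrable P (\<lambda>\<omega>. (norm (U (t k) \<omega> - V k \<omega>))\<^sup>2)) \<and>
             (SUP k\<in>{0..N}. sqrt (prob_space.expectation P (\<lambda>\<omega>. (norm (U (t k) \<omega> - V k \<omega>))\<^sup>2)))
               \<le> C * max_step N t powr (H - \<epsilon>)"
    proof (intro exI[of _ C'] conjI[OF \<open>C' > 0\<close>] allI impI)
      fix n :: nat and t :: "nat \<Rightarrow> real" and V :: "nat \<Rightarrow> 'w \<Rightarrow> real^'n"
      assume "n \<ge> 2" and grid: "time_grid t0 T n t" and scheme: "is_exponential_euler P H m B A f b u0 n t V"
      have sub: "subdivision t0 T n t" using grid by (rule subdivision_time_grid)
      note t_in = time_grid_mem[OF grid]
      have V_measurable: "V k \<in> borel_measurable P" if "k \<le> n" for k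
        using scheme that unfolding is_exponential_euler_def by (elim conjE) simp
      have V_start: "AE \<omega> in P. V 0 \<omega> = u0 \<omega>"
        using scheme unfolding is_exponential_euler_def by (elim conjE)
      have V_step: "AE \<omega> in P. V (Suc k) \<omega> = mild.euler_step (t k) (t (Suc k)) (V k \<omega>)
          + mild.noise_increment (t k) (t (Suc k)) \<omega>" if k: "k < n" for k
      proof -
        let ?t = "t (Suc k)" and ?r = "t k"
        have r: "?r \<in> {t0..T}" and t: "?t \<in> {t0..T}" using t_in[of k] t_in[of "Suc k"] k by auto
        have rt: "?r \<le> ?t" using sub k by (simp add: subdivision_def)
        from scheme k obtain Z where
          Z: "\<forall>i\<in>{1..m}. is_fbm_integral P H (B i) (\<lambda>s. flow A (?t - s) (b i s)) ?r ?t (Z i)"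
          and V: "AE \<omega> in P. V (Suc k) \<omega> = flow A (?t - ?r) (V k \<omega>)
             + (matrix_inv A ** (mat_exp ((?t - ?r) *\<^sub>R A) - mat 1)) *v f ?r (V k \<omega>)
             + (\<Sum>i=1..m. Z i \<omega>)"
          unfolding is_exponential_euler_def by (elim conjE) (drule spec, drule mp, assumption, elim exE conjE)
        have "AE \<omega> in P. \<forall>i\<in>{1..m}. J ?t i \<omega> - flow A (?t - ?r) (J ?r i \<omega>) = Z i \<omega>"
        proof (rule AE_finite_allI)
          fix i assume i: "i \<in> {1..m}"
          have Zw: "fractional_process.wiener_limit P H (B i) (flow_kernel A (b' i) ?r ?t) (Z i)"
            using Z i r t rt by (intro wiener) auto
          show "AE \<omega> in P. J ?t i \<omega> - flow A (?t - ?r) (J ?r i \<omega>) = Z i \<omega>"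
            using r rt by (intro fractional_process.wiener_limit_flow_kernel_increment[OF fp[OF i]
                b'_measurable[OF i] b'_le[OF i] c(2) \<open>c \<ge> 0\<close> J_wiener[OF t i] J_wiener[OF r i] Zw]) auto
        qed simp
        with V show ?thesis
        proof eventually_elim
          case (elim \<omega>)
          have "(\<Sum>i=1..m. Z i \<omega>) = (\<Sum>i=1..m. J ?t i \<omega> - flow A (?t - ?r) (J ?r i \<omega>))"
            using elim(2) by (intro sum.cong) simp_all
          also have "\<dots> = N ?t \<omega> - flow A (?t - ?r) (N ?r \<omega>)"
            unfolding N_eq[OF t] N_eq[OF r] by (simp add: sum_subtractf mv.sum_right)
          finally show ?case
            using elim(1) by (simp add: mild.euler_step_def mild.noise_increment_def f'_def \<tau>_id[OF r])
        qed
      qed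
      \<comment> \<open>The error is of order \<open>h powr H\<close>; the factor \<open>h powr \<epsilon>\<close> is bounded since \<open>h \<le> T - t0\<close>.\<close>
      define h where "h = max_step n t"
      have h: "0 < h" "h \<le> T - t0"
        using max_step_bounds[OF grid] \<open>n \<ge> 2\<close> by (simp_all add: h_def)
      have error: "integrable P (\<lambda>\<omega>. (norm (U (t k) \<omega> - V k \<omega>))\<^sup>2)"
        "expectation (\<lambda>\<omega>. (norm (U (t k) \<omega> - V k \<omega>))\<^sup>2) \<le> C * h powr (2 * H)" if k: "k \<le> n" for k
      proof -
        let ?e = "\<lambda>\<omega>. (norm (U (t k) \<omega> - V k \<omega>))\<^sup>2"
        have "U' (t k) \<in> borel_measurable P" by measurable
        then have [measurable]: "U (t k) \<in> borel_measurable P"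
          using \<tau>_id[OF t_in[OF k]] by (simp add: U'_def[abs_def])
        note [measurable] = V_measurable[OF k]
        have "mean_sq P (\<lambda>\<omega>. ennreal (norm (U' (t k) \<omega> - V k \<omega>))) \<le> ennreal (C * h powr (2 * H))"
          unfolding h_def using C[rule_format, OF grid V_start V_step k] .
        then have nn: "(\<integral>\<^sup>+\<omega>. ennreal (?e \<omega>) \<partial>P) \<le> ennreal (C * h powr (2 * H))"
          using \<tau>_id[OF t_in[OF k]] by (simp add: U'_def ennreal_power)
        then show int: "integrable P ?e"
          by (intro integrableI_bounded) (measurable, simp add: le_less_trans)
        have "ennreal (expectation ?e) \<le> ennreal (C * h powr (2 * H))"
          using nn nn_integral_eq_integral[OF int] by simp
        then show "expectation ?e \<le> C * h powr (2 * H)"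
          using \<open>C \<ge> 0\<close> by (subst (asm) ennreal_le_iff) auto
      qed
      have "sqrt (expectation (\<lambda>\<omega>. (norm (U (t k) \<omega> - V k \<omega>))\<^sup>2)) \<le> C' * h powr (H - \<epsilon>)"
        if k: "k \<in> {0..n}" for k
      proof -
        have "h powr (2 * H) = (h powr H)\<^sup>2"
          using h(1) by (simp add: power2_eq_square powr_add[symmetric])
        then have "sqrt (C * h powr (2 * H)) = sqrt C * h powr H"
          by (simp add: real_sqrt_mult)
        moreover have "sqrt (expectation (\<lambda>\<omega>. (norm (U (t k) \<omega> - V k \<omega>))\<^sup>2)) \<le> sqrt (C * h powr (2 * H))"
          using error(2)[of k] k by simp
        moreover have "h powr H = h powr \<epsilon> * h powr (H - \<epsilon>)"
          by (simp add: powr_add[symmetric])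
        moreover have "sqrt C * (h powr \<epsilon> * h powr (H - \<epsilon>)) \<le> sqrt C * ((T - t0) powr \<epsilon> * h powr (H - \<epsilon>))"
          using h \<open>\<epsilon> > 0\<close> \<open>C \<ge> 0\<close> by (intro mult_left_mono mult_right_mono powr_mono2) auto
        moreover have "sqrt C * ((T - t0) powr \<epsilon> * h powr (H - \<epsilon>)) \<le> C' * h powr (H - \<epsilon>)"
          by (simp add: C'_def distrib_right mult.assoc)
        ultimately show ?thesis by simp
      qed
      then have "(SUP k\<in>{0..n}. sqrt (expectation (\<lambda>\<omega>. (norm (U (t k) \<omega> - V k \<omega>))\<^sup>2))) \<le> C' * h powr (H - \<epsilon>)"
        by (intro cSUP_least) auto
      then show "(\<forall>k\<in>{0..n}. integrable P (\<lambda>\<omega>. (norm (U (t k) \<omega> - V k \<omega>))\<^sup>2)) \<and>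
          (SUP k\<in>{0..n}. sqrt (expectation (\<lambda>\<omega>. (norm (U (t k) \<omega> - V k \<omega>))\<^sup>2)))
            \<le> C' * max_step n t powr (H - \<epsilon>)"
        using error(1) unfolding h_def by (intro conjI ballI) simp_all
    qed
  qed
qed

end
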